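(* Let $K_0$ be an algebraically closed field, $K_\infty/K_0$ a purely transcendental extension of infinite transcendence degree, $K/K_\infty$ a finite field extension, and $p$ a prime number with $p\neq \mathrm{char}(K_0)$. Then there exists a central division LFD-algebra $R$ over $K$ with the following properties: (a) The dimension $[R:K]$ is countable, and finite-dimensional $K$-subalgebras of $R$ are of $p$-power dimensions (over $K$); (b) $R$ does not possess finite-dimensional central $K$-subalgebras different from $K$; in particular, $R$ is not an NLF-algebra over $K$.
   Context: All algebras are associative and unital, and subalgebras of an algebra contain its unit. An algebra over a field $K$ is central if its centre equals $K$. A $K$-algebra $A$ is locally finite-dimensional (LFD) if every finite subset of $A$ generates a finite-dimensional $K$-subalgebra. $A$ is normally locally finite (NLF) if every finite subset of $A$ is contained in a finite-dimensional central $K$-subalgebra of $A$ (containing the unit of $A$). The dimension $[A:K]$ is said to be countable if it is countably infinite. *)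

theory Defs
  imports "HOL-Algebra.Algebra" "HOL-Library.Countable_Set" "HOL-Computational_Algebra.Primes"
begin

section \<open>Fields\<close>

text \<open>The same normalisation as \<open>CHAR\<close> for type classes; in particular the value is \<open>0\<close> when
  no positive multiple of \<open>\<one>\<close> vanishes.\<close>

definition ring_char :: "('a, 'b) ring_scheme \<Rightarrow> nat" where
  "ring_char R = Gcd {n :: nat. [n] \<cdot>\<^bsub>R\<^esub> \<one>\<^bsub>R\<^esub> = \<zero>\<^bsub>R\<^esub>}"

text \<open>A polynomial whose variables are indexed by elements of \<open>R\<close> (a member of
  \<open>ring.indexed_pset R B F\<close>, i.e. of \<open>F[X\<^sub>b | b \<in> B]\<close>; monomials are multisets) is evaluated by
  sending the variable \<open>X\<^sub>b\<close> to \<open>b\<close>.\<close>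

definition indexed_value :: "('a, 'b) ring_scheme \<Rightarrow> ('a multiset \<Rightarrow> 'a) \<Rightarrow> 'a" where
  "indexed_value R P =
     (\<Oplus>\<^bsub>R\<^esub>m\<in>{m. P m \<noteq> \<zero>\<^bsub>R\<^esub>}. P m \<otimes>\<^bsub>R\<^esub> (\<Otimes>\<^bsub>R\<^esub>x\<in>set_mset m. x [^]\<^bsub>R\<^esub> count m x))"

text \<open>The sum above is a genuine finite one, so the convention for infinite sums is never used.\<close>

lemma (in ring) indexed_pset_finite_support:
  assumes "P \<in> indexed_pset B F"
  shows "finite {m. P m \<noteq> \<zero>}"
  using assms
proof (induction rule: indexed_pset.induct)
  case (indexed_const k)
  have "{m. indexed_const k m \<noteq> \<zero>} \<subseteq> {{#}}"
    by (auto simp: indexed_const_def)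
  then show ?case
    by (rule finite_subset) simp
next
  case (indexed_padd P Q)
  have "{m. indexed_padd P Q m \<noteq> \<zero>} \<subseteq> {m. P m \<noteq> \<zero>} \<union> {m. Q m \<noteq> \<zero>}"
    by (auto simp: indexed_padd_def)
  then show ?case
    by (rule finite_subset) (use indexed_padd.IH in simp)
next
  case (indexed_pmult P i)
  have "{m. indexed_pmult P i m \<noteq> \<zero>} \<subseteq> add_mset i ` {m. P m \<noteq> \<zero>}"
    by (auto simp: indexed_pmult_def image_iff split: if_splits intro!: exI[of _ "_ - {#i#}"])
  then show ?case
    by (rule finite_subset) (use indexed_pmult.IH in simp)
qed

definition algebraically_independent :: "('a, 'b) ring_scheme \<Rightarrow> 'a set \<Rightarrow> 'a set \<Rightarrow> bool" where
  "algebraically_independent R F B \<longleftrightarrow>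
     B \<subseteq> carrier R \<and>
     (\<forall>P \<in> ring.indexed_pset R B F. indexed_value R P = \<zero>\<^bsub>R\<^esub> \<longrightarrow> P = (\<lambda>_. \<zero>\<^bsub>R\<^esub>))"

text \<open>\<open>L = F(B)\<close> with \<open>B\<close> algebraically independent over \<open>F\<close>: the extension \<open>L/F\<close> is purely
  transcendental, \<open>B\<close> is a transcendence basis of it, and its transcendence degree is the
  cardinality of \<open>B\<close>. Here \<open>F\<close> and \<open>L\<close> are subfields of an ambient field \<open>R\<close>.\<close>

definition purely_transcendental_basis ::
    "('a, 'b) ring_scheme \<Rightarrow> 'a set \<Rightarrow> 'a set \<Rightarrow> 'a set \<Rightarrow> bool" where
  "purely_transcendental_basis R F L B \<longleftrightarrow>
     algebraically_independent R F B \<and> L = generate_field R (F \<union> B)"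


section \<open>Algebras over a field\<close>

text \<open>An algebra over \<open>K\<close> is a not necessarily commutative ring \<open>R\<close> with a ring homomorphism from
  \<open>K\<close> into the centre of \<open>R\<close>. For \<open>R\<close> nonzero, \<open>K\<close> is thereby identified with a central
  subfield \<open>k = f ` carrier K\<close> of \<open>R\<close>, and the notions after this definition refer to such
  a \<open>k\<close> (as do the library's \<^const>\<open>ring.dimension\<close> and \<^const>\<open>ring.Span\<close>).\<close>

definition centre :: "('a, 'b) ring_scheme \<Rightarrow> 'a set" where
  "centre R = {z \<in> carrier R. \<forall>x \<in> carrier R. z \<otimes>\<^bsub>R\<^esub> x = x \<otimes>\<^bsub>R\<^esub> z}"

definition algebra_over ::
    "('a, 'b) ring_scheme \<Rightarrow> ('a \<Rightarrow> 'c) \<Rightarrow> ('c, 'd) ring_scheme \<Rightarrow> bool" where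
  "algebra_over K f R \<longleftrightarrow>
     field K \<and> ring R \<and> f \<in> ring_hom K R \<and> f ` carrier K \<subseteq> centre R"

locale skew_field = ring R for R (structure) +
  assumes one_not_zero: "\<one> \<noteq> \<zero>"
    and nonzero_Units: "Units R = carrier R - {\<zero>}"

text \<open>The library's \<^locale>\<open>subalgebra\<close> only asks for a \<open>k\<close>-subspace.\<close>

definition unital_subalgebra :: "'a set \<Rightarrow> 'a set \<Rightarrow> ('a, 'b) ring_scheme \<Rightarrow> bool" where
  "unital_subalgebra k A R \<longleftrightarrow> subring A R \<and> subalgebra k A R"

definition central_subalgebra :: "'a set \<Rightarrow> 'a set \<Rightarrow> ('a, 'b) ring_scheme \<Rightarrow> bool" where
  "central_subalgebra k A R \<longleftrightarrow> unital_subalgebra k A R \<and> centre (R\<lparr>carrier := A\<rparr>) = k"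

text \<open>\<open>generate_ring R (k \<union> F)\<close> is the \<open>k\<close>-subalgebra generated by \<open>F\<close>.\<close>

definition LFD :: "'a set \<Rightarrow> ('a, 'b) ring_scheme \<Rightarrow> bool" where
  "LFD k R \<longleftrightarrow>
     (\<forall>F. finite F \<and> F \<subseteq> carrier R \<longrightarrow>
        ring.finite_dimension R k (generate_ring R (k \<union> F)))"

definition NLF :: "'a set \<Rightarrow> ('a, 'b) ring_scheme \<Rightarrow> bool" where
  "NLF k R \<longleftrightarrow>
     (\<forall>F. finite F \<and> F \<subseteq> carrier R \<longrightarrow>
        (\<exists>A. central_subalgebra k A R \<and> ring.finite_dimension R k A \<and> F \<subseteq> A))"

definition linear_basis :: "'a set \<Rightarrow> ('a, 'b) ring_scheme \<Rightarrow> 'a set \<Rightarrow> bool" where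
  "linear_basis k R B \<longleftrightarrow>
     B \<subseteq> carrier R \<and>
     (\<forall>us. distinct us \<and> set us \<subseteq> B \<longrightarrow> ring.independent R k us) \<and>
     (\<forall>x \<in> carrier R. \<exists>us. set us \<subseteq> B \<and> x \<in> ring.Span R k us)"

definition countable_dimension :: "'a set \<Rightarrow> ('a, 'b) ring_scheme \<Rightarrow> bool" where
  "countable_dimension k R \<longleftrightarrow> (\<exists>B. linear_basis k R B \<and> countable B \<and> infinite B)"

end

theory Submission
  imports Defs "HOL-Library.Poly_Mapping"
begin

text \<open>Since only finitely many variables enter the structure constants of \<open>K\<close> over \<open>K\<^sub>\<infinity>\<close>, one can write
  \<open>K = Frac F[y\<^sub>0, y\<^sub>1, \<dots>]\<close> with the \<open>y\<^sub>i\<close> algebraically independent over a domain \<open>F \<supseteq> K\<^sub>0\<close>. The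
  algebra \<open>R\<close> is generated by \<open>u\<^sub>0, u\<^sub>1, \<dots>\<close> with \<open>u\<^sub>i\<close> raised to \<open>p\<^sup>i\<^sup>+\<^sup>1\<close> equal to \<open>y\<^sub>i\<close>, where \<open>u\<^sub>i\<close> and
  \<open>u\<^sub>i\<^sub>+\<^sub>1\<close> commute up to a primitive root of unity of order \<open>p\<^sup>i\<^sup>+\<^sup>1\<close> and all other pairs commute: a twisted
  group algebra of \<open>G = \<Gamma>/D\<close>, where \<open>\<Gamma> = \<int>\<^sup>(\<^sup>\<nat>\<^sup>)\<close> and \<open>D = \<Oplus>\<^sub>i p\<^sup>i\<^sup>+\<^sup>1\<int>\<close>. The lexicographic leading monomial
  valuation of \<open>K\<close> extends to a valuation \<open>w\<close> of \<open>R\<close> for which the basis elements have values in distinct classes modulo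
  the values of \<open>K\<close>; hence \<open>R\<close> has no zero divisors.

  Let \<open>V\<close> be a finite-dimensional subalgebra and \<open>J\<close> the finite subgroup of \<open>G\<close> formed by the classes of
  \<open>w\<close> on \<open>V\<close>. Gram--Schmidt for the trace form \<open>tr (x y)\<close> (\<open>tr\<close> is the coefficient at \<open>0\<close>) produces
  dual bases \<open>A\<^sub>j\<close>, \<open>B\<^sub>j\<close> of \<open>V\<close> indexed by \<open>J\<close> with \<open>w (B\<^sub>j) = - w (A\<^sub>j)\<close>. So \<open>[V : K] = |J|\<close> is a power
  of \<open>p\<close>. If \<open>V\<close> is central and \<open>J \<noteq> 0\<close> has exponent \<open>p\<^sup>m\<close>, then some \<open>0 \<noteq> g \<in> p\<^sup>m\<^sup>-\<^sup>1J\<close> is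
  orthogonal to \<open>J\<close>, because the commutator pairing takes values of order at most \<open>p\<^sup>m\<^sup>-\<^sup>1\<close> on
  \<open>p\<^sup>m\<close>-torsion elements. For \<open>x \<in> V\<close> of class \<open>g\<close> the element \<open>\<Sum>\<^sub>j A\<^sub>j x B\<^sub>j\<close> is central
  in \<open>V\<close>, but equals \<open>|J| x\<close> up to terms of smaller value and hence is not in \<open>K\<close>.\<close>


section \<open>Twisted group algebras\<close>

text \<open>The difficulty is to have enough noncommutativity in the whole algebra and none that
  closes up at a finite stage. A nondegenerate alternating pairing on a finite group of exponent
  \<open>p^m\<close> must take values of order \<open>p^m\<close>. Here coordinate
  \<open>i+1\<close> has order \<open>p^(i+2)\<close>, but it is paired with coordinate
  \<open>i\<close> only through a root of order \<open>p^(i+1)\<close>; this deficit of one power of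
  \<open>p\<close> gives every nontrivial finite subgroup a radical. In the limit the radical
  disappears, because the last nonzero coordinate of an element is always detected by the next
  generator, and so the centre of \<open>R\<close> is \<open>K\<close>.

  Subalgebras need not be spanned by monomials, so a radical in the group of leading classes does
  not by itself yield central elements. The Casimir sum replaces the averaging over a group: its
  result is truly central and has the wanted leading term up to the factor \<open>|J|\<close>. That
  factor is a power of \<open>p\<close>, a nonzero constant of value 0 because \<open>p\<close> is
  not the characteristic. The roots of unity of all orders \<open>p^i\<close> are supplied by the
  algebraic closedness of \<open>K0\<close>.\<close>

locale twisted_group = field K for K (structure) +
  fixes e :: "nat \<Rightarrow> 'g::ab_group_add" and \<tau> :: "'g \<Rightarrow> nat" and D :: "'g set"
    and \<chi> :: "'g \<Rightarrow> 'a" and \<beta> :: "'g \<Rightarrow> 'g \<Rightarrow> 'a"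
  assumes \<tau>_e [simp]: "\<tau> (e n) = n"
    and e_unit [simp]: "e (\<tau> 0) = 0"
    and \<tau>_eq_iff: "\<tau> s = \<tau> t \<longleftrightarrow> s - t \<in> D"
    and \<chi>_closed: "d \<in> D \<Longrightarrow> \<chi> d \<in> carrier K - {\<zero>}"
    and \<chi>_add: "\<lbrakk>d \<in> D; d' \<in> D\<rbrakk> \<Longrightarrow> \<chi> (d + d') = \<chi> d \<otimes> \<chi> d'"
    and \<beta>_closed: "\<beta> s t \<in> carrier K - {\<zero>}"
    and \<beta>_add_left: "\<beta> (s + s') t = \<beta> s t \<otimes> \<beta> s' t"
    and \<beta>_add_right: "\<beta> s (t + t') = \<beta> s t \<otimes> \<beta> s t'"
    and \<beta>_D_left: "d \<in> D \<Longrightarrow> \<beta> d t = \<one>"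
    and \<beta>_D_right: "d \<in> D \<Longrightarrow> \<beta> s d = \<one>"
begin

lemma D_zero [simp]: "0 \<in> D"
  using \<tau>_eq_iff[of 0 0] by simp

lemma D_add: "\<lbrakk>a \<in> D; b \<in> D\<rbrakk> \<Longrightarrow> a + b \<in> D"
  using \<tau>_eq_iff[of "a + b" b] \<tau>_eq_iff[of b 0] \<tau>_eq_iff[of "a + b" 0] by simp

lemma e_\<tau>: "e (\<tau> s) - s \<in> D" "s - e (\<tau> s) \<in> D"
  using \<tau>_eq_iff[of "e (\<tau> s)" s] \<tau>_eq_iff[of s "e (\<tau> s)"] by simp_all

lemma \<tau>_eqI: "s - t \<in> D \<Longrightarrow> \<tau> s = \<tau> t"
  by (simp add: \<tau>_eq_iff)

lemma \<tau>_shift: "d \<in> D \<Longrightarrow> \<tau> (d + s) = \<tau> s" "d \<in> D \<Longrightarrow> \<tau> (s + d) = \<tau> s"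
  by (simp_all add: \<tau>_eq_iff)

lemma \<tau>_e_simps [simp]:
  "\<tau> (e (\<tau> s) + t) = \<tau> (s + t)"
  "\<tau> (t + e (\<tau> s)) = \<tau> (t + s)"
  "\<tau> (e (\<tau> s) - t) = \<tau> (s - t)"
  "\<tau> (t - e (\<tau> s)) = \<tau> (t - s)"
  "\<tau> (- e (\<tau> s)) = \<tau> (- s)"
  using e_\<tau>[of s] by (auto simp: \<tau>_eq_iff algebra_simps)

lemma \<beta>_cong_left: "s - s' \<in> D \<Longrightarrow> \<beta> s t = \<beta> s' t"
  using \<beta>_add_left[of "s - s'" s' t] \<beta>_D_left[of "s - s'" t] \<beta>_closed[of s' t] by simp

lemma \<beta>_cong_right: "t - t' \<in> D \<Longrightarrow> \<beta> s t = \<beta> s t'"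
  using \<beta>_add_right[of s "t - t'" t'] \<beta>_D_right[of "t - t'" s] \<beta>_closed[of s t'] by simp

lemma \<beta>_e\<tau> [simp]: "\<beta> (e (\<tau> s)) t = \<beta> s t" "\<beta> t (e (\<tau> s)) = \<beta> t s"
  using \<beta>_cong_left[OF e_\<tau>(1)] \<beta>_cong_right[OF e_\<tau>(1)] by auto

lemma \<beta>_carrier [simp, intro]: "\<beta> s t \<in> carrier K" and \<beta>_nz [simp]: "\<beta> s t \<noteq> \<zero>"
  using \<beta>_closed by auto

lemma \<chi>_carrier [simp, intro]: "d \<in> D \<Longrightarrow> \<chi> d \<in> carrier K" and \<chi>_nz [simp]: "d \<in> D \<Longrightarrow> \<chi> d \<noteq> \<zero>"
  using \<chi>_closed by auto

lemma \<chi>_zero [simp]: "\<chi> 0 = \<one>"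
proof -
  have "\<chi> 0 \<otimes> \<chi> 0 = \<chi> 0 \<otimes> \<one>"
    using \<chi>_add[of 0 0] by simp
  then show ?thesis
    using m_lcancel[of "\<chi> 0" "\<chi> 0" \<one>] by simp
qed

lemma \<beta>_zero [simp]: "\<beta> 0 t = \<one>" "\<beta> t 0 = \<one>"
  by (simp_all add: \<beta>_D_left \<beta>_D_right)

text \<open>Both are inverse to \<open>\<beta> s s\<close>, since \<open>\<beta> s 0\<close> and
  \<open>\<beta> 0 s\<close> are trivial. This symmetry on opposite elements makes the trace
  symmetric in \<open>tr_comm\<close>.\<close>

lemma \<beta>_self_minus: "\<beta> s (- s) = \<beta> (- s) s"
proof -
  have "\<beta> s s \<otimes> \<beta> s (- s) = \<beta> s s \<otimes> \<beta> (- s) s"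
    using \<beta>_add_right[of s s "- s"] \<beta>_add_left[of s "- s" s] by simp
  then show ?thesis
    using m_lcancel[of "\<beta> s s"] by simp
qed

text \<open>The structure constant of the basis \<open>u i = U (e i)\<close>, where formal monomials
  satisfy \<open>U s U t = \<beta> s t U (s + t)\<close> and \<open>U d\<close> is the scalar
  \<open>\<chi> d\<close> for \<open>d \<in> D\<close>. The factor \<open>\<chi>\<close> moves
  \<open>e i + e j\<close> back to the chosen representative of its class.\<close>

definition coc :: "nat \<Rightarrow> nat \<Rightarrow> 'a" where
  "coc i j = \<beta> (e i) (e j) \<otimes> \<chi> (e i + e j - e (\<tau> (e i + e j)))"

lemma coc_carrier [simp, intro]: "coc i j \<in> carrier K"
  by (simp add: coc_def e_\<tau>)

lemma coc_nz [simp]: "coc i j \<noteq> \<zero>"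
  using integral_iff[of "\<beta> (e i) (e j)" "\<chi> (e i + e j - e (\<tau> (e i + e j)))"]
  by (simp add: coc_def e_\<tau>)

lemma coc_unit [simp]: "coc (\<tau> 0) j = \<one>" "coc j (\<tau> 0) = \<one>"
  by (simp_all add: coc_def)

text \<open>By bimultiplicativity both \<open>\<beta>\<close> parts are the product over the three
  pairs, and on both sides the two arguments of \<open>\<chi>\<close> add up to
  \<open>e i + e j + e k\<close> minus the representative of its class.\<close>

lemma coc_cocycle:
  "coc i j \<otimes> coc (\<tau> (e i + e j)) k = coc i (\<tau> (e j + e k)) \<otimes> coc j k"
proof -
  let ?A = "e i + e j - e (\<tau> (e i + e j))"
  let ?B = "e (\<tau> (e i + e j)) + e k - e (\<tau> (e i + e j + e k))"
  let ?A' = "e i + e (\<tau> (e j + e k)) - e (\<tau> (e i + e j + e k))"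
  let ?B' = "e j + e k - e (\<tau> (e j + e k))"
  have B: "?B \<in> D"
    using e_\<tau>(2)[of "e (\<tau> (e i + e j)) + e k"] by simp
  have A': "?A' \<in> D"
    using e_\<tau>(2)[of "e i + e (\<tau> (e j + e k))"] by (simp add: add.assoc)
  have "\<chi> ?A \<otimes> \<chi> ?B = \<chi> (?A + ?B)"
    by (rule \<chi>_add[OF e_\<tau>(2) B, symmetric])
  also have "?A + ?B = ?A' + ?B'"
    by (simp add: algebra_simps)
  also have "\<chi> \<dots> = \<chi> ?A' \<otimes> \<chi> ?B'"
    by (rule \<chi>_add[OF A' e_\<tau>(2)])
  finally have \<chi>: "\<chi> ?A \<otimes> \<chi> ?B = \<chi> ?A' \<otimes> \<chi> ?B'" .
  have c: "\<chi> ?A \<in> carrier K" "\<chi> ?B \<in> carrier K" "\<chi> ?A' \<in> carrier K" "\<chi> ?B' \<in> carrier K"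
    using A' B e_\<tau> by auto
  have "coc i j \<otimes> coc (\<tau> (e i + e j)) k
      = (\<beta> (e i) (e j) \<otimes> (\<beta> (e i) (e k) \<otimes> \<beta> (e j) (e k))) \<otimes> (\<chi> ?A \<otimes> \<chi> ?B)"
    using c by (simp add: coc_def \<beta>_add_left m_ac)
  moreover have "coc i (\<tau> (e j + e k)) \<otimes> coc j k
      = (\<beta> (e i) (e j) \<otimes> (\<beta> (e i) (e k) \<otimes> \<beta> (e j) (e k))) \<otimes> (\<chi> ?A' \<otimes> \<chi> ?B')"
    using c by (simp add: coc_def \<beta>_add_right m_ac add.assoc)
  ultimately show ?thesis
    by (simp add: \<chi>)
qed

section \<open>The convolution ring of finitely supported functions\<close>

definition tmono :: "'a \<Rightarrow> nat \<Rightarrow> nat \<Rightarrow> 'a" where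
  "tmono a i = (\<lambda>k. if k = i then a else \<zero>)"

text \<open>The index \<open>k\<close> stands for the class of \<open>e k\<close>, so that
  coefficients live on the natural numbers instead of a quotient. For given \<open>i\<close> and
  \<open>k\<close> the second factor is read at the only index \<open>j\<close> with
  \<open>\<tau> (e i + e j) = k\<close>; hence the sum runs over one index.\<close>

definition TW :: "(nat \<Rightarrow> 'a) ring" where
  "TW = \<lparr>carrier = {f. (\<forall>i. f i \<in> carrier K) \<and> finite {i. f i \<noteq> \<zero>}},
         monoid.mult = (\<lambda>f g k. \<Oplus>i\<in>{i. f i \<noteq> \<zero>}. f i \<otimes> g (\<tau> (e k - e i)) \<otimes> coc i (\<tau> (e k - e i))),
         monoid.one = tmono \<one> (\<tau> 0),
         ring.zero = (\<lambda>_. \<zero>),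
         ring.add = (\<lambda>f g i. f i \<oplus> g i)\<rparr>"

lemma TW_carrier_iff: "f \<in> carrier TW \<longleftrightarrow> (\<forall>i. f i \<in> carrier K) \<and> finite {i. f i \<noteq> \<zero>}"
  by (simp add: TW_def)

lemma TW_carrierI: "\<lbrakk>\<And>i. f i \<in> carrier K; finite {i. f i \<noteq> \<zero>}\<rbrakk> \<Longrightarrow> f \<in> carrier TW"
  by (simp add: TW_def)

lemma TW_zero: "\<zero>\<^bsub>TW\<^esub> = (\<lambda>_. \<zero>)"
  and TW_one: "\<one>\<^bsub>TW\<^esub> = tmono \<one> (\<tau> 0)"
  and TW_add: "f \<oplus>\<^bsub>TW\<^esub> g = (\<lambda>i. f i \<oplus> g i)"
  by (simp_all add: TW_def)

lemma TW_mult: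
  "f \<otimes>\<^bsub>TW\<^esub> g
    = (\<lambda>k. \<Oplus>i\<in>{i. f i \<noteq> \<zero>}. f i \<otimes> g (\<tau> (e k - e i)) \<otimes> coc i (\<tau> (e k - e i)))"
  by (simp add: TW_def)

lemma TW_zero_apply: "\<zero>\<^bsub>TW\<^esub> i = \<zero>" and TW_add_apply: "(f \<oplus>\<^bsub>TW\<^esub> g) i = f i \<oplus> g i"
  by (simp_all add: TW_def)

lemma TW_coeff [simp]: "f \<in> carrier TW \<Longrightarrow> f i \<in> carrier K"
  by (simp add: TW_carrier_iff)

lemma TW_finite [simp]: "f \<in> carrier TW \<Longrightarrow> finite {i. f i \<noteq> \<zero>}"
  by (simp add: TW_carrier_iff)

lemma tmono_apply: "tmono a i k = (if k = i then a else \<zero>)"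
  by (simp add: tmono_def)

lemma tmono_carrier [simp, intro]: "a \<in> carrier K \<Longrightarrow> tmono a i \<in> carrier TW"
  by (rule TW_carrierI) (auto simp: tmono_def intro: finite_subset[of _ "{i}"])

lemma TW_add_closed: "\<lbrakk>f \<in> carrier TW; g \<in> carrier TW\<rbrakk> \<Longrightarrow> f \<oplus>\<^bsub>TW\<^esub> g \<in> carrier TW"
proof -
  assume fg: "f \<in> carrier TW" "g \<in> carrier TW"
  have "{i. f i \<oplus> g i \<noteq> \<zero>} \<subseteq> {i. f i \<noteq> \<zero>} \<union> {i. g i \<noteq> \<zero>}"
    using fg by auto
  then have "finite {i. f i \<oplus> g i \<noteq> \<zero>}"
    by (rule finite_subset) (use fg in auto)
  with fg show ?thesis
    by (intro TW_carrierI) (simp_all add: TW_add_apply)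
qed

lemma TW_mult_apply:
  assumes "f \<in> carrier TW" "g \<in> carrier TW" "finite S" "{i. f i \<noteq> \<zero>} \<subseteq> S"
  shows "(f \<otimes>\<^bsub>TW\<^esub> g) k = (\<Oplus>i\<in>S. f i \<otimes> g (\<tau> (e k - e i)) \<otimes> coc i (\<tau> (e k - e i)))"
proof -
  have "(f \<otimes>\<^bsub>TW\<^esub> g) k
      = (\<Oplus>i\<in>{i. f i \<noteq> \<zero>}. f i \<otimes> g (\<tau> (e k - e i)) \<otimes> coc i (\<tau> (e k - e i)))"
    by (simp add: TW_mult)
  also have "\<dots> = (\<Oplus>i\<in>S. f i \<otimes> g (\<tau> (e k - e i)) \<otimes> coc i (\<tau> (e k - e i)))"
    by (rule add.finprod_mono_neutral_cong_left) (use assms in \<open>auto simp: Pi_iff\<close>)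
  finally show ?thesis .
qed

lemma finsum_nonzero_term:
  assumes "finsum K f A \<noteq> \<zero>"
  shows "\<exists>x\<in>A. f x \<noteq> \<zero>"
  using assms add.finprod_one_eqI[of A f] by auto

lemma TW_mult_support:
  assumes "f \<in> carrier TW" "g \<in> carrier TW" "(f \<otimes>\<^bsub>TW\<^esub> g) k \<noteq> \<zero>"
  obtains i j where "f i \<noteq> \<zero>" "g j \<noteq> \<zero>" "k = \<tau> (e i + e j)"
proof -
  obtain i where i: "f i \<noteq> \<zero>" "f i \<otimes> g (\<tau> (e k - e i)) \<otimes> coc i (\<tau> (e k - e i)) \<noteq> \<zero>"
    using finsum_nonzero_term[OF assms(3)[unfolded TW_mult]] by blast
  have "g (\<tau> (e k - e i)) \<noteq> \<zero>"
    using i assms by auto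
  with i(1) show ?thesis
    by (intro that[of i "\<tau> (e k - e i)"]) auto
qed

lemma TW_mult_closed: "\<lbrakk>f \<in> carrier TW; g \<in> carrier TW\<rbrakk> \<Longrightarrow> f \<otimes>\<^bsub>TW\<^esub> g \<in> carrier TW"
proof -
  assume fg: "f \<in> carrier TW" "g \<in> carrier TW"
  have "{k. (f \<otimes>\<^bsub>TW\<^esub> g) k \<noteq> \<zero>} \<subseteq> (\<lambda>(i, j). \<tau> (e i + e j)) ` ({i. f i \<noteq> \<zero>} \<times> {i. g i \<noteq> \<zero>})"
  proof
    fix k assume "k \<in> {k. (f \<otimes>\<^bsub>TW\<^esub> g) k \<noteq> \<zero>}"
    then obtain i j where "f i \<noteq> \<zero>" "g j \<noteq> \<zero>" "k = \<tau> (e i + e j)"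
      using TW_mult_support[OF fg] by blast
    then show "k \<in> (\<lambda>(i, j). \<tau> (e i + e j)) ` ({i. f i \<noteq> \<zero>} \<times> {i. g i \<noteq> \<zero>})"
      by (intro image_eqI[of _ _ "(i, j)"]) auto
  qed
  then have "finite {k. (f \<otimes>\<^bsub>TW\<^esub> g) k \<noteq> \<zero>}"
    by (rule finite_subset) (use fg in auto)
  moreover have "(f \<otimes>\<^bsub>TW\<^esub> g) k \<in> carrier K" for k
    unfolding TW_mult by (rule finsum_closed) (use fg in \<open>simp add: Pi_iff\<close>)
  ultimately show ?thesis
    by (intro TW_carrierI)
qed

lemma TW_l_distr:
  assumes f: "f \<in> carrier TW" and g: "g \<in> carrier TW" and h: "h \<in> carrier TW"
  shows "(f \<oplus>\<^bsub>TW\<^esub> g) \<otimes>\<^bsub>TW\<^esub> h = f \<otimes>\<^bsub>TW\<^esub> h \<oplus>\<^bsub>TW\<^esub> g \<otimes>\<^bsub>TW\<^esub> h"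
proof
  fix k
  let ?S = "{i. f i \<noteq> \<zero>} \<union> {i. g i \<noteq> \<zero>}"
  have S: "finite ?S" "{i. (f \<oplus>\<^bsub>TW\<^esub> g) i \<noteq> \<zero>} \<subseteq> ?S"
    using assms by (auto simp: TW_add_apply)
  have S': "{i. f i \<noteq> \<zero>} \<subseteq> ?S" "{i. g i \<noteq> \<zero>} \<subseteq> ?S"
    by blast+
  show "((f \<oplus>\<^bsub>TW\<^esub> g) \<otimes>\<^bsub>TW\<^esub> h) k = (f \<otimes>\<^bsub>TW\<^esub> h \<oplus>\<^bsub>TW\<^esub> g \<otimes>\<^bsub>TW\<^esub> h) k"
    unfolding TW_mult_apply[OF TW_add_closed[OF f g] h S] TW_mult_apply[OF f h S(1) S'(1)]
      TW_mult_apply[OF g h S(1) S'(2)] TW_add_apply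
    using assms by (subst finsum_addf[symmetric]) (auto simp: Pi_iff l_distr)
qed

lemma TW_r_distr:
  assumes f: "f \<in> carrier TW" and g: "g \<in> carrier TW" and h: "h \<in> carrier TW"
  shows "h \<otimes>\<^bsub>TW\<^esub> (f \<oplus>\<^bsub>TW\<^esub> g) = h \<otimes>\<^bsub>TW\<^esub> f \<oplus>\<^bsub>TW\<^esub> h \<otimes>\<^bsub>TW\<^esub> g"
proof
  fix k
  have S: "finite {i. h i \<noteq> \<zero>}"
    using assms by auto
  show "(h \<otimes>\<^bsub>TW\<^esub> (f \<oplus>\<^bsub>TW\<^esub> g)) k = (h \<otimes>\<^bsub>TW\<^esub> f \<oplus>\<^bsub>TW\<^esub> h \<otimes>\<^bsub>TW\<^esub> g) k"
    unfolding TW_mult TW_add_apply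
    using assms by (subst finsum_addf[symmetric]) (auto simp: Pi_iff r_distr l_distr)
qed

lemma TW_tmono_mult_apply:
  assumes "a \<in> carrier K" "g \<in> carrier TW"
  shows "(tmono a i \<otimes>\<^bsub>TW\<^esub> g) k = a \<otimes> g (\<tau> (e k - e i)) \<otimes> coc i (\<tau> (e k - e i))"
proof -
  have "{k. tmono a i k \<noteq> \<zero>} \<subseteq> {i}"
    by (auto simp: tmono_def)
  then have "(tmono a i \<otimes>\<^bsub>TW\<^esub> g) k
      = (\<Oplus>j\<in>{i}. tmono a i j \<otimes> g (\<tau> (e k - e j)) \<otimes> coc j (\<tau> (e k - e j)))"
    by (intro TW_mult_apply assms tmono_carrier) auto
  also have "\<dots> = a \<otimes> g (\<tau> (e k - e i)) \<otimes> coc i (\<tau> (e k - e i))"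
    using assms by (simp add: tmono_def Pi_iff)
  finally show ?thesis .
qed

lemma \<tau>_diff_eq_iff: "\<tau> (e k - e i) = j \<longleftrightarrow> k = \<tau> (e i + e j)"
proof
  assume "\<tau> (e k - e i) = j"
  then show "k = \<tau> (e i + e j)"
    by (simp flip: \<open>\<tau> (e k - e i) = j\<close>)
qed simp

lemma tmono_mult_tmono:
  assumes "a \<in> carrier K" "b \<in> carrier K"
  shows "tmono a i \<otimes>\<^bsub>TW\<^esub> tmono b j = tmono (a \<otimes> b \<otimes> coc i j) (\<tau> (e i + e j))"
  using assms
  by (auto simp: fun_eq_iff TW_tmono_mult_apply tmono_apply \<tau>_diff_eq_iff)

text \<open>Coefficients are removed one at a time from a finite support. The rule reduces
  identities that are additive in an argument to monomials.\<close>

lemma TW_induct [consumes 1, case_names zero tmono_add]: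
  assumes "f \<in> carrier TW"
    and "P \<zero>\<^bsub>TW\<^esub>"
    and "\<And>a i f. \<lbrakk>a \<in> carrier K; f \<in> carrier TW; P f\<rbrakk> \<Longrightarrow> P (tmono a i \<oplus>\<^bsub>TW\<^esub> f)"
  shows "P f"
proof -
  have "\<forall>f \<in> carrier TW. {i. f i \<noteq> \<zero>} \<subseteq> S \<longrightarrow> P f" if "finite S" for S
    using that
  proof (induction S)
    case empty
    have "f = \<zero>\<^bsub>TW\<^esub>" if "{i. f i \<noteq> \<zero>} \<subseteq> {}" for f
      using that by (auto simp: fun_eq_iff TW_zero_apply)
    then show ?case
      using assms(2) by blast
  next
    case (insert i S)
    show ?case
    proof (intro ballI impI)
      fix f assume f: "f \<in> carrier TW" "{j. f j \<noteq> \<zero>} \<subseteq> insert i S"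
      let ?g = "\<lambda>j. if j = i then \<zero> else f j"
      have g: "?g \<in> carrier TW"
      proof (rule TW_carrierI)
        have "{j. ?g j \<noteq> \<zero>} \<subseteq> {i. f i \<noteq> \<zero>}"
          by auto
        then show "finite {j. ?g j \<noteq> \<zero>}"
          using f(1) TW_finite finite_subset by blast
      qed (use f(1) in simp)
      have "{j. ?g j \<noteq> \<zero>} \<subseteq> S"
        using f(2) by auto
      then have "P ?g"
        by (rule insert.IH[rule_format, OF g])
      then have "P (tmono (f i) i \<oplus>\<^bsub>TW\<^esub> ?g)"
        by (rule assms(3)[OF TW_coeff[OF f(1)] g])
      also have "tmono (f i) i \<oplus>\<^bsub>TW\<^esub> ?g = f"
        using f(1) by (auto simp: fun_eq_iff tmono_apply TW_add_apply)
      finally show "P f" .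
    qed
  qed
  from this[OF TW_finite[OF assms(1)]] assms(1) show ?thesis
    by simp
qed

lemma TW_zero_closed [simp]: "\<zero>\<^bsub>TW\<^esub> \<in> carrier TW"
  by (rule TW_carrierI) (simp_all add: TW_zero_apply)

lemma TW_abelian_group: "abelian_group TW"
proof (rule abelian_groupI)
  fix f assume f: "f \<in> carrier TW"
  have "{i. \<ominus> f i \<noteq> \<zero>} \<subseteq> {i. f i \<noteq> \<zero>}"
    by auto
  then have "(\<lambda>i. \<ominus> f i) \<in> carrier TW"
    using f by (intro TW_carrierI finite_subset[OF _ TW_finite[OF f]]) simp_all
  moreover have "(\<lambda>i. \<ominus> f i) \<oplus>\<^bsub>TW\<^esub> f = \<zero>\<^bsub>TW\<^esub>"
    by (rule ext) (simp add: l_neg f TW_zero_apply TW_add_apply)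
  ultimately show "\<exists>g\<in>carrier TW. g \<oplus>\<^bsub>TW\<^esub> f = \<zero>\<^bsub>TW\<^esub>"
    by blast
next
  fix f g h assume fgh: "f \<in> carrier TW" "g \<in> carrier TW" "h \<in> carrier TW"
  show "f \<oplus>\<^bsub>TW\<^esub> g \<oplus>\<^bsub>TW\<^esub> h = f \<oplus>\<^bsub>TW\<^esub> (g \<oplus>\<^bsub>TW\<^esub> h)"
    by (rule ext) (simp only: TW_add_apply a_assoc[OF TW_coeff TW_coeff TW_coeff, OF fgh])
next
  fix f g assume fg: "f \<in> carrier TW" "g \<in> carrier TW"
  show "f \<oplus>\<^bsub>TW\<^esub> g = g \<oplus>\<^bsub>TW\<^esub> f"
    by (rule ext) (simp only: TW_add_apply a_comm[OF TW_coeff TW_coeff, OF fg])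
next
  fix f assume f: "f \<in> carrier TW"
  show "\<zero>\<^bsub>TW\<^esub> \<oplus>\<^bsub>TW\<^esub> f = f"
    by (rule ext) (simp add: f TW_zero_apply TW_add_apply)
qed (simp_all add: TW_add_closed)

lemma TW_mult_zero:
  assumes "f \<in> carrier TW"
  shows "\<zero>\<^bsub>TW\<^esub> \<otimes>\<^bsub>TW\<^esub> f = \<zero>\<^bsub>TW\<^esub>" "f \<otimes>\<^bsub>TW\<^esub> \<zero>\<^bsub>TW\<^esub> = \<zero>\<^bsub>TW\<^esub>"
  using TW_mult_support[OF TW_zero_closed assms] TW_mult_support[OF assms TW_zero_closed]
  by (metis TW_zero_apply ext)+

text \<open>All three arguments enter additively, so three inductions reduce the identity to
  monomials, where it is \<open>coc_cocycle\<close>.\<close>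

lemma TW_assoc:
  assumes f: "f \<in> carrier TW" and g: "g \<in> carrier TW" and h: "h \<in> carrier TW"
  shows "(f \<otimes>\<^bsub>TW\<^esub> g) \<otimes>\<^bsub>TW\<^esub> h = f \<otimes>\<^bsub>TW\<^esub> (g \<otimes>\<^bsub>TW\<^esub> h)"
proof -
  note [simp] = TW_mult_closed TW_add_closed TW_mult_zero TW_l_distr TW_r_distr
  have tmonos: "(tmono a i \<otimes>\<^bsub>TW\<^esub> tmono b j) \<otimes>\<^bsub>TW\<^esub> tmono c k
      = tmono a i \<otimes>\<^bsub>TW\<^esub> (tmono b j \<otimes>\<^bsub>TW\<^esub> tmono c k)"
    if abc: "a \<in> carrier K" "b \<in> carrier K" "c \<in> carrier K" for a b c i j k
  proof -
    have "a \<otimes> b \<otimes> coc i j \<otimes> c \<otimes> coc (\<tau> (e i + e j)) k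
        = a \<otimes> b \<otimes> c \<otimes> (coc i j \<otimes> coc (\<tau> (e i + e j)) k)"
      using abc by (simp add: m_ac)
    also have "\<dots> = a \<otimes> (b \<otimes> c \<otimes> coc j k) \<otimes> coc i (\<tau> (e j + e k))"
      unfolding coc_cocycle using abc by (simp add: m_ac)
    finally show ?thesis
      using abc by (simp add: tmono_mult_tmono add.assoc)
  qed
  have *: "(tmono a i \<otimes>\<^bsub>TW\<^esub> tmono b j) \<otimes>\<^bsub>TW\<^esub> h = tmono a i \<otimes>\<^bsub>TW\<^esub> (tmono b j \<otimes>\<^bsub>TW\<^esub> h)"
    if "a \<in> carrier K" "b \<in> carrier K" for a b i j
    using h by (induction h rule: TW_induct) (simp_all add: that tmonos)
  have **: "(tmono a i \<otimes>\<^bsub>TW\<^esub> g) \<otimes>\<^bsub>TW\<^esub> h = tmono a i \<otimes>\<^bsub>TW\<^esub> (g \<otimes>\<^bsub>TW\<^esub> h)"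
    if "a \<in> carrier K" for a i
    using g by (induction g rule: TW_induct) (simp_all add: that h *)
  show ?thesis
    using f by (induction f rule: TW_induct) (simp_all add: g h **)
qed

lemma TW_one_mult:
  assumes "f \<in> carrier TW"
  shows "\<one>\<^bsub>TW\<^esub> \<otimes>\<^bsub>TW\<^esub> f = f" "f \<otimes>\<^bsub>TW\<^esub> \<one>\<^bsub>TW\<^esub> = f"
proof -
  show "\<one>\<^bsub>TW\<^esub> \<otimes>\<^bsub>TW\<^esub> f = f"
    using assms by (simp add: fun_eq_iff TW_one TW_tmono_mult_apply)
  show "f \<otimes>\<^bsub>TW\<^esub> \<one>\<^bsub>TW\<^esub> = f"
    using assms
    by (induction f rule: TW_induct)
      (auto simp: TW_one TW_mult_zero TW_l_distr tmono_mult_tmono)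
qed

lemma TW_ring: "ring TW"
proof (rule ringI)
  show "abelian_group TW"
    by (rule TW_abelian_group)
  show "Group.monoid TW"
    by (rule monoidI) (auto simp: TW_mult_closed TW_one TW_assoc TW_one_mult[unfolded TW_one])
qed (simp_all add: TW_l_distr TW_r_distr)

sublocale TW: ring TW
  by (rule TW_ring)

end


section \<open>The valuation of a twisted group algebra\<close>

context twisted_group
begin

lemma TW_nonzero_iff: "f \<noteq> \<zero>\<^bsub>TW\<^esub> \<longleftrightarrow> (\<exists>i. f i \<noteq> \<zero>)"
  by (auto simp: TW_zero fun_eq_iff)

lemma TW_minus_apply:
  assumes "f \<in> carrier TW"
  shows "(\<ominus>\<^bsub>TW\<^esub> f) i = \<ominus> f i"
proof -
  have "(\<ominus>\<^bsub>TW\<^esub> f) i \<oplus> f i = \<zero>"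
    using assms TW.l_neg[OF assms] TW_add_apply[of "\<ominus>\<^bsub>TW\<^esub> f" f i] by (simp add: TW_zero_apply)
  then show ?thesis
    using assms by (simp add: minus_equality TW.a_inv_closed)
qed

lemma TW_diff_apply:
  "\<lbrakk>f \<in> carrier TW; g \<in> carrier TW\<rbrakk> \<Longrightarrow> (f \<ominus>\<^bsub>TW\<^esub> g) i = f i \<ominus> g i"
  by (simp add: TW.minus_eq minus_eq TW_add_apply TW_minus_apply)

section \<open>Scalars and the trace\<close>

definition emb :: "'a \<Rightarrow> nat \<Rightarrow> 'a" where
  "emb a = tmono a (\<tau> 0)"

lemma emb_closed [simp, intro]: "a \<in> carrier K \<Longrightarrow> emb a \<in> carrier TW"
  by (simp add: emb_def)

lemma emb_mult_apply: "\<lbrakk>a \<in> carrier K; f \<in> carrier TW\<rbrakk> \<Longrightarrow> (emb a \<otimes>\<^bsub>TW\<^esub> f) i = a \<otimes> f i"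
  by (simp add: emb_def TW_tmono_mult_apply)

lemma emb_comm:
  assumes a: "a \<in> carrier K" and f: "f \<in> carrier TW"
  shows "f \<otimes>\<^bsub>TW\<^esub> emb a = emb a \<otimes>\<^bsub>TW\<^esub> f"
  using f
proof (induction f rule: TW_induct)
  case (tmono_add b i f)
  have "tmono b i \<otimes>\<^bsub>TW\<^esub> emb a = emb a \<otimes>\<^bsub>TW\<^esub> tmono b i"
    using a tmono_add by (simp add: emb_def tmono_mult_tmono m_comm)
  then show ?case
    using a tmono_add by (simp add: TW.l_distr TW.r_distr)
qed (use a in simp)

lemma emb_one: "emb \<one> = \<one>\<^bsub>TW\<^esub>"
  by (simp add: emb_def TW_one)

lemma emb_add: "\<lbrakk>a \<in> carrier K; b \<in> carrier K\<rbrakk> \<Longrightarrow> emb (a \<oplus> b) = emb a \<oplus>\<^bsub>TW\<^esub> emb b"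
  by (auto simp: emb_def fun_eq_iff TW_add_apply tmono_apply)

lemma emb_mult: "\<lbrakk>a \<in> carrier K; b \<in> carrier K\<rbrakk> \<Longrightarrow> emb (a \<otimes> b) = emb a \<otimes>\<^bsub>TW\<^esub> emb b"
  by (simp add: emb_def tmono_mult_tmono)

lemma emb_apply: "emb a i = (if i = \<tau> 0 then a else \<zero>)"
  by (simp add: emb_def tmono_apply)

lemma emb_ring_hom: "emb \<in> ring_hom K TW"
  by (rule ring_hom_memI) (simp_all add: emb_add emb_mult emb_one)

lemma emb_central: "emb ` carrier K \<subseteq> centre TW"
  by (auto simp: centre_def emb_comm)

definition tr :: "(nat \<Rightarrow> 'a) \<Rightarrow> 'a" where
  "tr f = f (\<tau> 0)"

lemma tr_closed [simp, intro]: "f \<in> carrier TW \<Longrightarrow> tr f \<in> carrier K"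
  by (simp add: tr_def)

lemma tr_add: "tr (f \<oplus>\<^bsub>TW\<^esub> g) = tr f \<oplus> tr g"
  by (simp add: tr_def TW_add_apply)

lemma tr_zero: "tr \<zero>\<^bsub>TW\<^esub> = \<zero>"
  by (simp add: tr_def TW_zero_apply)

lemma tr_diff: "\<lbrakk>f \<in> carrier TW; g \<in> carrier TW\<rbrakk> \<Longrightarrow> tr (f \<ominus>\<^bsub>TW\<^esub> g) = tr f \<ominus> tr g"
  by (simp add: tr_def TW_diff_apply)

lemma tr_emb_mult: "\<lbrakk>a \<in> carrier K; f \<in> carrier TW\<rbrakk> \<Longrightarrow> tr (emb a \<otimes>\<^bsub>TW\<^esub> f) = a \<otimes> tr f"
  by (simp add: tr_def emb_mult_apply)

lemma coc_comm:
  assumes "\<beta> (e i) (e j) = \<beta> (e j) (e i)"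
  shows "coc i j = coc j i"
  using assms by (simp add: coc_def add.commute)

text \<open>Only pairs of opposite classes contribute to the trace, and on those
  \<open>\<beta>\<close> is symmetric by \<open>\<beta>_self_minus\<close>, so that the cocycle is
  symmetric too.\<close>

lemma tr_comm:
  assumes f: "f \<in> carrier TW" and g: "g \<in> carrier TW"
  shows "tr (f \<otimes>\<^bsub>TW\<^esub> g) = tr (g \<otimes>\<^bsub>TW\<^esub> f)"
proof -
  have tmonos: "tr (tmono a i \<otimes>\<^bsub>TW\<^esub> tmono b j) = tr (tmono b j \<otimes>\<^bsub>TW\<^esub> tmono a i)"
    if ab: "a \<in> carrier K" "b \<in> carrier K" for a b i j
  proof (cases "\<tau> (e i + e j) = \<tau> 0")
    case True
    then have D: "e j - (- e i) \<in> D"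
      using \<tau>_eq_iff[of "e i + e j" 0] by (simp add: add.commute)
    have "\<beta> (e i) (e j) = \<beta> (e j) (e i)"
      using \<beta>_cong_left[OF D] \<beta>_cong_right[OF D] \<beta>_self_minus[of "e i"] by simp
    then have "coc i j = coc j i"
      by (rule coc_comm)
    then show ?thesis
      using ab by (simp add: tmono_mult_tmono m_comm add.commute)
  next
    case False
    then show ?thesis
      using ab by (simp add: tmono_mult_tmono tr_def tmono_apply add.commute)
  qed
  have *: "tr (tmono a i \<otimes>\<^bsub>TW\<^esub> g) = tr (g \<otimes>\<^bsub>TW\<^esub> tmono a i)" if "a \<in> carrier K" for a i
    using g by (induction g rule: TW_induct) (simp_all add: that tmonos TW.l_distr TW.r_distr tr_add)
  show ?thesis
    using f by (induction f rule: TW_induct) (simp_all add: g * TW.l_distr TW.r_distr tr_add)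
qed

end

text \<open>The valuation measures leading terms, hence a sum is bounded by the maximum. Its value
  group is exactly \<open>D\<close> and \<open>\<chi>\<close> is a multiplicative section of
  \<open>v\<close>, so multiplication by scalars moves a value to any other point of its coset of
  \<open>D\<close>.\<close>

locale valued_twisted_group = twisted_group K e \<tau> D \<chi> \<beta>
  for K (structure) and e :: "nat \<Rightarrow> 'g::linordered_ab_group_add" and \<tau> D \<chi> \<beta> +
  fixes v :: "'a \<Rightarrow> 'g"
  assumes v_D: "\<lbrakk>a \<in> carrier K; a \<noteq> \<zero>\<rbrakk> \<Longrightarrow> v a \<in> D"
    and v_mult: "\<lbrakk>a \<in> carrier K; a \<noteq> \<zero>; b \<in> carrier K; b \<noteq> \<zero>\<rbrakk> \<Longrightarrow> v (a \<otimes> b) = v a + v b"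
    and v_add: "\<lbrakk>a \<in> carrier K; a \<noteq> \<zero>; b \<in> carrier K; b \<noteq> \<zero>; a \<oplus> b \<noteq> \<zero>\<rbrakk>
      \<Longrightarrow> v (a \<oplus> b) \<le> max (v a) (v b)"
    and v_\<chi>: "d \<in> D \<Longrightarrow> v (\<chi> d) = d"
    and v_\<beta>: "v (\<beta> s t) = 0"
begin

lemma v_one [simp]: "v \<one> = 0"
  using v_mult[of \<one> \<one>] by simp

lemma v_minus:
  assumes "a \<in> carrier K" "a \<noteq> \<zero>"
  shows "v (\<ominus> a) = v a"
proof -
  have m: "\<ominus> \<one> \<noteq> \<zero>"
    using one_not_zero by (metis add.inv_equality l_zero one_closed r_neg zero_closed minus_minus)
  have "v (\<ominus> \<one>) + v (\<ominus> \<one>) = 0"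
    using v_mult[of "\<ominus> \<one>" "\<ominus> \<one>"] m by (simp add: l_minus)
  \<comment> \<open>A linearly ordered group has no 2-torsion.\<close>
  then have "v (\<ominus> \<one>) = 0"
    by (metis add_neg_neg add_pos_pos less_irrefl linorder_neqE)
  moreover have "\<ominus> a = \<ominus> \<one> \<otimes> a"
    using assms by (simp add: l_minus)
  ultimately show ?thesis
    using v_mult[of "\<ominus> \<one>" a] m assms by simp
qed

text \<open>When the basis element of index \<open>i\<close> is given the value \<open>e i\<close>,
  the product of two basis elements has exactly the value \<open>e i + e j\<close>. This is what
  makes \<open>w\<close> additive on products.\<close>

lemma v_coc: "v (coc i j) = e i + e j - e (\<tau> (e i + e j))"
  unfolding coc_def by (subst v_mult) (simp_all add: e_\<tau> v_\<beta> v_\<chi>)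

text \<open>Zero has no value in \<open>'g\<close>; in these bounds it behaves like an element of
  value minus infinity.\<close>

definition klt :: "'a \<Rightarrow> 'g \<Rightarrow> bool" where
  "klt a \<gamma> \<longleftrightarrow> a = \<zero> \<or> v a < \<gamma>"

definition kle :: "'a \<Rightarrow> 'g \<Rightarrow> bool" where
  "kle a \<gamma> \<longleftrightarrow> a = \<zero> \<or> v a \<le> \<gamma>"

lemma klt_add: "\<lbrakk>klt a \<gamma>; klt b \<gamma>; a \<in> carrier K; b \<in> carrier K\<rbrakk> \<Longrightarrow> klt (a \<oplus> b) \<gamma>"
  by (cases "a = \<zero> \<or> b = \<zero>") (auto simp: klt_def intro: le_less_trans[OF v_add])

lemma kle_add: "\<lbrakk>kle a \<gamma>; kle b \<gamma>; a \<in> carrier K; b \<in> carrier K\<rbrakk> \<Longrightarrow> kle (a \<oplus> b) \<gamma>"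
  by (cases "a = \<zero> \<or> b = \<zero>") (auto simp: kle_def intro: order_trans[OF v_add])

lemma klt_zero [simp]: "klt \<zero> \<gamma>" and kle_zero [simp]: "kle \<zero> \<gamma>"
  by (simp_all add: klt_def kle_def)

lemma klt_finsum:
  assumes "finite A" "\<And>x. x \<in> A \<Longrightarrow> f x \<in> carrier K" "\<And>x. x \<in> A \<Longrightarrow> klt (f x) \<gamma>"
  shows "klt (finsum K f A) \<gamma>"
  using assms by (induction A) (simp_all add: Pi_iff klt_add)

lemma kle_finsum:
  assumes "finite A" "\<And>x. x \<in> A \<Longrightarrow> f x \<in> carrier K" "\<And>x. x \<in> A \<Longrightarrow> kle (f x) \<gamma>"
  shows "kle (finsum K f A) \<gamma>"
  using assms by (induction A) (simp_all add: Pi_iff kle_add)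

section \<open>Bounds and values for elements of the algebra\<close>

definition tlt :: "(nat \<Rightarrow> 'a) \<Rightarrow> 'g \<Rightarrow> bool" where
  "tlt f \<gamma> \<longleftrightarrow> (\<forall>i. klt (f i) (\<gamma> - e i))"

definition tle :: "(nat \<Rightarrow> 'a) \<Rightarrow> 'g \<Rightarrow> bool" where
  "tle f \<gamma> \<longleftrightarrow> (\<forall>i. kle (f i) (\<gamma> - e i))"

lemma tlt_imp_tle: "tlt f \<gamma> \<Longrightarrow> tle f \<gamma>"
  by (auto simp: tlt_def tle_def klt_def kle_def less_imp_le)

lemma tlt_add: "\<lbrakk>tlt f \<gamma>; tlt g \<gamma>; f \<in> carrier TW; g \<in> carrier TW\<rbrakk> \<Longrightarrow> tlt (f \<oplus>\<^bsub>TW\<^esub> g) \<gamma>"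
  by (simp add: tlt_def TW_add_apply klt_add)

lemma tle_add: "\<lbrakk>tle f \<gamma>; tle g \<gamma>; f \<in> carrier TW; g \<in> carrier TW\<rbrakk> \<Longrightarrow> tle (f \<oplus>\<^bsub>TW\<^esub> g) \<gamma>"
  by (simp add: tle_def TW_add_apply kle_add)

lemma klt_minus: "a \<in> carrier K \<Longrightarrow> klt (\<ominus> a) \<gamma> \<longleftrightarrow> klt a \<gamma>"
  by (cases "a = \<zero>") (auto simp: klt_def v_minus)

lemma kle_minus: "a \<in> carrier K \<Longrightarrow> kle (\<ominus> a) \<gamma> \<longleftrightarrow> kle a \<gamma>"
  by (cases "a = \<zero>") (auto simp: kle_def v_minus)

lemma tlt_minus: "\<lbrakk>tlt f \<gamma>; f \<in> carrier TW\<rbrakk> \<Longrightarrow> tlt (\<ominus>\<^bsub>TW\<^esub> f) \<gamma>"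
  by (simp add: tlt_def TW_minus_apply klt_minus)

lemma tle_minus: "\<lbrakk>tle f \<gamma>; f \<in> carrier TW\<rbrakk> \<Longrightarrow> tle (\<ominus>\<^bsub>TW\<^esub> f) \<gamma>"
  by (simp add: tle_def TW_minus_apply kle_minus)

lemma tlt_diff: "\<lbrakk>tlt f \<gamma>; tlt g \<gamma>; f \<in> carrier TW; g \<in> carrier TW\<rbrakk> \<Longrightarrow> tlt (f \<ominus>\<^bsub>TW\<^esub> g) \<gamma>"
  by (simp add: TW.minus_eq tlt_add tlt_minus)

lemma tle_diff: "\<lbrakk>tle f \<gamma>; tle g \<gamma>; f \<in> carrier TW; g \<in> carrier TW\<rbrakk> \<Longrightarrow> tle (f \<ominus>\<^bsub>TW\<^esub> g) \<gamma>"
  by (simp add: TW.minus_eq tle_add tle_minus)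

lemma v_coc_term:
  assumes "a \<in> carrier K" "a \<noteq> \<zero>" "b \<in> carrier K" "b \<noteq> \<zero>"
  shows "v (a \<otimes> b \<otimes> coc i j) + e (\<tau> (e i + e j)) = (v a + e i) + (v b + e j)"
proof -
  have "a \<otimes> b \<noteq> \<zero>"
    using assms integral_iff by simp
  then have "v (a \<otimes> b \<otimes> coc i j) = v a + v b + v (coc i j)"
    using assms by (simp add: v_mult)
  then show ?thesis
    by (simp add: v_coc)
qed

lemma klt_term:
  assumes "a \<in> carrier K" "b \<in> carrier K"
    and "kle a (\<gamma> - e i)" "klt b (\<delta> - e j) \<or> klt a (\<gamma> - e i) \<and> kle b (\<delta> - e j)" "\<tau> (e i + e j) = k"
  shows "klt (a \<otimes> b \<otimes> coc i j) (\<gamma> + \<delta> - e k)"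
proof (cases "a = \<zero> \<or> b = \<zero>")
  case False
  then have "v a + e i \<le> \<gamma>" "v a + e i < \<gamma> \<and> v b + e j \<le> \<delta> \<or> v b + e j < \<delta>"
    using assms(3,4) by (auto simp: klt_def kle_def le_diff_eq less_diff_eq)
  then have "(v a + e i) + (v b + e j) < \<gamma> + \<delta>"
    using add_less_le_mono add_le_less_mono by blast
  then have "v (a \<otimes> b \<otimes> coc i j) + e k < \<gamma> + \<delta>"
    using v_coc_term[of a b i j] False assms by simp
  then show ?thesis
    by (simp add: klt_def less_diff_eq)
qed (use assms in auto)

lemma kle_term:
  assumes "a \<in> carrier K" "b \<in> carrier K"
    and "kle a (\<gamma> - e i)" "kle b (\<delta> - e j)" "\<tau> (e i + e j) = k"
  shows "kle (a \<otimes> b \<otimes> coc i j) (\<gamma> + \<delta> - e k)"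
proof (cases "a = \<zero> \<or> b = \<zero>")
  case False
  then have "v a + e i \<le> \<gamma>" "v b + e j \<le> \<delta>"
    using assms(3,4) by (auto simp: klt_def kle_def le_diff_eq less_diff_eq)
  then have "(v a + e i) + (v b + e j) \<le> \<gamma> + \<delta>"
    by (rule add_mono)
  then have "v (a \<otimes> b \<otimes> coc i j) + e k \<le> \<gamma> + \<delta>"
    using v_coc_term[of a b i j] False assms by simp
  then show ?thesis
    by (simp add: kle_def le_diff_eq)
qed (use assms in auto)

lemma tle_mult:
  assumes "f \<in> carrier TW" "g \<in> carrier TW" "tle f \<gamma>" "tle g \<delta>"
  shows "tle (f \<otimes>\<^bsub>TW\<^esub> g) (\<gamma> + \<delta>)"
  unfolding tle_def TW_mult
  by (intro allI kle_finsum kle_term) (use assms in \<open>simp_all add: tle_def\<close>)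

lemma tlt_mult_right:
  assumes "f \<in> carrier TW" "g \<in> carrier TW" "tle f \<gamma>" "tlt g \<delta>"
  shows "tlt (f \<otimes>\<^bsub>TW\<^esub> g) (\<gamma> + \<delta>)"
  unfolding tlt_def TW_mult
  by (intro allI klt_finsum klt_term) (use assms in \<open>simp_all add: tle_def tlt_def\<close>)

lemma tlt_mult_left:
  assumes "f \<in> carrier TW" "g \<in> carrier TW" "tlt f \<gamma>" "tle g \<delta>"
  shows "tlt (f \<otimes>\<^bsub>TW\<^esub> g) (\<gamma> + \<delta>)"
  unfolding tlt_def TW_mult
  by (intro allI klt_finsum klt_term) (use assms tlt_imp_tle[of f \<gamma>] in \<open>simp_all add: tle_def tlt_def\<close>)

text \<open>The maximum is attained at one index only, namely \<open>\<tau> (w f)\<close>, because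
  scalars have values in \<open>D\<close> and distinct indices lie in distinct cosets. For zero the
  set is empty and the value carries no meaning.\<close>

definition w :: "(nat \<Rightarrow> 'a) \<Rightarrow> 'g" where
  "w f = Max ((\<lambda>i. v (f i) + e i) ` {i. f i \<noteq> \<zero>})"

lemma \<tau>_v_add: "\<lbrakk>a \<in> carrier K; a \<noteq> \<zero>\<rbrakk> \<Longrightarrow> \<tau> (v a + e i) = i"
  using \<tau>_shift(1)[OF v_D] by simp

lemma w_lead:
  assumes f: "f \<in> carrier TW" "f \<noteq> \<zero>\<^bsub>TW\<^esub>"
  shows "f (\<tau> (w f)) \<noteq> \<zero>" "v (f (\<tau> (w f))) + e (\<tau> (w f)) = w f"
proof -
  have "w f \<in> (\<lambda>i. v (f i) + e i) ` {i. f i \<noteq> \<zero>}"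
    unfolding w_def using f by (intro Max_in) (auto simp: TW_nonzero_iff)
  then obtain i where i: "f i \<noteq> \<zero>" "w f = v (f i) + e i"
    by auto
  then have "\<tau> (w f) = i"
    using \<tau>_v_add f(1) by simp
  with i show "f (\<tau> (w f)) \<noteq> \<zero>" "v (f (\<tau> (w f))) + e (\<tau> (w f)) = w f"
    by auto
qed

lemma tle_w: "f \<in> carrier TW \<Longrightarrow> tle f (w f)"
  unfolding tle_def kle_def w_def le_diff_eq by (auto intro!: Max_ge)

lemma tle_iff_w:
  assumes "f \<in> carrier TW" "f \<noteq> \<zero>\<^bsub>TW\<^esub>"
  shows "tle f \<gamma> \<longleftrightarrow> w f \<le> \<gamma>"
proof
  assume "tle f \<gamma>"
  then have "v (f (\<tau> (w f))) + e (\<tau> (w f)) \<le> \<gamma>"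
    using w_lead(1)[OF assms] by (auto simp: tle_def kle_def le_diff_eq)
  then show "w f \<le> \<gamma>"
    using w_lead(2)[OF assms] by simp
next
  assume "w f \<le> \<gamma>"
  then show "tle f \<gamma>"
    using tle_w[OF assms(1)] by (auto simp: tle_def kle_def le_diff_eq intro: order_trans)
qed

text \<open>A coefficient that attains the bound \<open>\<gamma>\<close> can only sit at the index
  \<open>\<tau> \<gamma>\<close>.\<close>

lemma tltI:
  assumes "f \<in> carrier TW" "tle f \<gamma>" "f (\<tau> \<gamma>) = \<zero>"
  shows "tlt f \<gamma>"
  unfolding tlt_def klt_def
proof (intro allI disjCI)
  fix i assume i: "\<not> v (f i) < \<gamma> - e i"
  show "f i = \<zero>"
  proof (rule ccontr)
    assume nz: "f i \<noteq> \<zero>"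
    then have "v (f i) + e i = \<gamma>"
      using assms(2) i by (force simp: tle_def kle_def)
    then have "\<tau> \<gamma> = i"
      using \<tau>_v_add[of "f i" i] assms(1) nz by simp
    then show False
      using assms(3) nz by simp
  qed
qed

lemma w_eqI:
  assumes "f \<in> carrier TW" "tle f \<gamma>" "f (\<tau> \<gamma>) \<noteq> \<zero>" "v (f (\<tau> \<gamma>)) + e (\<tau> \<gamma>) = \<gamma>"
  shows "f \<noteq> \<zero>\<^bsub>TW\<^esub>" "w f = \<gamma>"
proof -
  show nz: "f \<noteq> \<zero>\<^bsub>TW\<^esub>"
    using assms(3) TW_nonzero_iff by blast
  have "\<gamma> \<le> w f"
    using tle_w[OF assms(1)] assms(3,4) by (auto simp: tle_def kle_def le_diff_eq dest!: spec[of _ "\<tau> \<gamma>"])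
  moreover have "w f \<le> \<gamma>"
    using tle_iff_w[OF assms(1) nz] assms(2) by simp
  ultimately show "w f = \<gamma>"
    by simp
qed

lemma w_tmono:
  assumes "a \<in> carrier K" "a \<noteq> \<zero>"
  shows "tmono a i \<noteq> \<zero>\<^bsub>TW\<^esub>" "w (tmono a i) = v a + e i"
proof -
  have "tle (tmono a i) (v a + e i)"
    by (simp add: tle_def kle_def tmono_apply)
  then show "tmono a i \<noteq> \<zero>\<^bsub>TW\<^esub>" "w (tmono a i) = v a + e i"
    using w_eqI[of "tmono a i" "v a + e i"] assms by (simp_all add: \<tau>_v_add tmono_apply)
qed

lemma v_add_lt:
  assumes "a \<in> carrier K" "a \<noteq> \<zero>" "b \<in> carrier K" "klt b (v a)"
  shows "a \<oplus> b \<noteq> \<zero>" "v (a \<oplus> b) = v a"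
proof -
  have "a \<oplus> b \<noteq> \<zero> \<and> v (a \<oplus> b) = v a"
  proof (cases "b = \<zero>")
    case False
    then have lt: "v b < v a"
      using assms(4) by (simp add: klt_def)
    have nz: "a \<oplus> b \<noteq> \<zero>"
    proof
      assume "a \<oplus> b = \<zero>"
      then have "a = \<ominus> b"
        using assms by (simp add: minus_equality)
      then show False
        using lt v_minus[of b] assms False by simp
    qed
    have "v (a \<oplus> b) \<le> v a"
      using v_add[OF assms(1,2,3) False nz] lt by simp
    \<comment> \<open>The ultrametric inequality for
      \<open>a = (a \<oplus> b) \<oplus> \<ominus> b\<close>; as \<open>b\<close> is smaller than
      \<open>a\<close>, the maximum must be \<open>v (a \<oplus> b)\<close>.\<close>
    moreover have "v a \<le> max (v (a \<oplus> b)) (v (\<ominus> b))"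
      using v_add[OF _ nz, of "\<ominus> b"] assms False by (simp add: a_assoc r_neg)
    ultimately show ?thesis
      using nz lt v_minus[of b] assms False by (auto simp: max_def split: if_splits)
  qed (use assms in simp)
  then show "a \<oplus> b \<noteq> \<zero>" "v (a \<oplus> b) = v a"
    by auto
qed

lemma w_add_tlt:
  assumes "f \<in> carrier TW" "f \<noteq> \<zero>\<^bsub>TW\<^esub>" "g \<in> carrier TW" "tlt g (w f)"
  shows "f \<oplus>\<^bsub>TW\<^esub> g \<noteq> \<zero>\<^bsub>TW\<^esub>" "w (f \<oplus>\<^bsub>TW\<^esub> g) = w f"
proof -
  let ?l = "\<tau> (w f)"
  have "tle (f \<oplus>\<^bsub>TW\<^esub> g) (w f)"
    using assms by (intro tle_add tle_w tlt_imp_tle)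
  moreover have "klt (g ?l) (v (f ?l))"
    using assms(4) w_lead(2)[OF assms(1,2)] by (metis add_diff_cancel_right' tlt_def)
  then have "f ?l \<oplus> g ?l \<noteq> \<zero>" "v (f ?l \<oplus> g ?l) = v (f ?l)"
    using v_add_lt[of "f ?l" "g ?l"] assms w_lead(1)[OF assms(1,2)] by auto
  ultimately show "f \<oplus>\<^bsub>TW\<^esub> g \<noteq> \<zero>\<^bsub>TW\<^esub>" "w (f \<oplus>\<^bsub>TW\<^esub> g) = w f"
    using w_eqI[of "f \<oplus>\<^bsub>TW\<^esub> g" "w f"] assms w_lead(2)[OF assms(1,2)] by (auto simp: TW_add_apply)
qed

section \<open>Leading monomials and products\<close>

definition lead :: "(nat \<Rightarrow> 'a) \<Rightarrow> nat \<Rightarrow> 'a" where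
  "lead f = tmono (f (\<tau> (w f))) (\<tau> (w f))"

lemma lead_closed [simp]: "f \<in> carrier TW \<Longrightarrow> lead f \<in> carrier TW"
  by (simp add: lead_def)

lemma lead_nonzero:
  assumes "f \<in> carrier TW" "f \<noteq> \<zero>\<^bsub>TW\<^esub>"
  shows "lead f \<noteq> \<zero>\<^bsub>TW\<^esub>" "w (lead f) = w f"
  using w_tmono[of "f (\<tau> (w f))" "\<tau> (w f)"] w_lead[OF assms] assms by (simp_all add: lead_def)

lemma tlt_sub_lead:
  assumes "f \<in> carrier TW" "f \<noteq> \<zero>\<^bsub>TW\<^esub>"
  shows "tlt (f \<ominus>\<^bsub>TW\<^esub> lead f) (w f)"
proof (rule tltI)
  show "tle (f \<ominus>\<^bsub>TW\<^esub> lead f) (w f)"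
    using assms tle_w[of f] tle_w[of "lead f"] lead_nonzero[OF assms] by (intro tle_diff) auto
qed (use assms in \<open>simp_all add: TW_diff_apply lead_def tmono_apply\<close>)

text \<open>The difference is \<open>(f - lead f) g + lead f (g - lead g)\<close>, and in each
  product one factor lies strictly below its bound.\<close>

lemma tlt_mult_sub_lead:
  assumes f: "f \<in> carrier TW" "f \<noteq> \<zero>\<^bsub>TW\<^esub>" and g: "g \<in> carrier TW" "g \<noteq> \<zero>\<^bsub>TW\<^esub>"
  shows "tlt (f \<otimes>\<^bsub>TW\<^esub> g \<ominus>\<^bsub>TW\<^esub> lead f \<otimes>\<^bsub>TW\<^esub> lead g) (w f + w g)"
proof -
  have "tlt ((f \<ominus>\<^bsub>TW\<^esub> lead f) \<otimes>\<^bsub>TW\<^esub> g) (w f + w g)"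
    using f g tlt_sub_lead tle_w by (intro tlt_mult_left) auto
  moreover have "tlt (lead f \<otimes>\<^bsub>TW\<^esub> (g \<ominus>\<^bsub>TW\<^esub> lead g)) (w f + w g)"
    using f g tlt_sub_lead tle_w[of "lead f"] lead_nonzero by (intro tlt_mult_right) auto
  ultimately have "tlt ((f \<ominus>\<^bsub>TW\<^esub> lead f) \<otimes>\<^bsub>TW\<^esub> g \<oplus>\<^bsub>TW\<^esub> lead f \<otimes>\<^bsub>TW\<^esub> (g \<ominus>\<^bsub>TW\<^esub> lead g)) (w f + w g)"
    using f g by (intro tlt_add) auto
  also have "(f \<ominus>\<^bsub>TW\<^esub> lead f) \<otimes>\<^bsub>TW\<^esub> g \<oplus>\<^bsub>TW\<^esub> lead f \<otimes>\<^bsub>TW\<^esub> (g \<ominus>\<^bsub>TW\<^esub> lead g)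
      = f \<otimes>\<^bsub>TW\<^esub> g \<ominus>\<^bsub>TW\<^esub> lead f \<otimes>\<^bsub>TW\<^esub> lead g"
    using f g lead_closed[of f] lead_closed[of g]
    by (simp add: TW.minus_eq TW.l_distr TW.r_distr TW.l_minus TW.r_minus TW.a_assoc TW.r_neg1)
  finally show ?thesis .
qed

lemma lead_mult_lead:
  assumes f: "f \<in> carrier TW" "f \<noteq> \<zero>\<^bsub>TW\<^esub>" and g: "g \<in> carrier TW" "g \<noteq> \<zero>\<^bsub>TW\<^esub>"
  shows "lead f \<otimes>\<^bsub>TW\<^esub> lead g \<noteq> \<zero>\<^bsub>TW\<^esub>" "w (lead f \<otimes>\<^bsub>TW\<^esub> lead g) = w f + w g"
proof -
  let ?a = "f (\<tau> (w f))" and ?b = "g (\<tau> (w g))"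
  let ?c = "?a \<otimes> ?b \<otimes> coc (\<tau> (w f)) (\<tau> (w g))"
  have "?c \<in> carrier K" "?c \<noteq> \<zero>"
    using f g w_lead(1)[OF f] w_lead(1)[OF g] by (simp_all add: integral_iff)
  moreover have "v ?c + e (\<tau> (e (\<tau> (w f)) + e (\<tau> (w g)))) = w f + w g"
    using v_coc_term[of ?a ?b "\<tau> (w f)" "\<tau> (w g)"] f g w_lead[OF f] w_lead[OF g] by simp
  ultimately show "lead f \<otimes>\<^bsub>TW\<^esub> lead g \<noteq> \<zero>\<^bsub>TW\<^esub>" "w (lead f \<otimes>\<^bsub>TW\<^esub> lead g) = w f + w g"
    using f g w_tmono[of ?c "\<tau> (e (\<tau> (w f)) + e (\<tau> (w g)))"]
    by (simp_all add: lead_def tmono_mult_tmono)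
qed

text \<open>The product of the leading monomials is a nonzero monomial of the expected value, and
  the rest is smaller. In particular there are no zero divisors.\<close>

lemma w_mult:
  assumes f: "f \<in> carrier TW" "f \<noteq> \<zero>\<^bsub>TW\<^esub>" and g: "g \<in> carrier TW" "g \<noteq> \<zero>\<^bsub>TW\<^esub>"
  shows "f \<otimes>\<^bsub>TW\<^esub> g \<noteq> \<zero>\<^bsub>TW\<^esub>" "w (f \<otimes>\<^bsub>TW\<^esub> g) = w f + w g"
proof -
  let ?m = "lead f \<otimes>\<^bsub>TW\<^esub> lead g"
  have "f \<otimes>\<^bsub>TW\<^esub> g = ?m \<oplus>\<^bsub>TW\<^esub> (f \<otimes>\<^bsub>TW\<^esub> g \<ominus>\<^bsub>TW\<^esub> ?m)"
    using f g by (simp add: TW.minus_eq TW.a_lcomm[of ?m] TW.r_neg)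
  then show "f \<otimes>\<^bsub>TW\<^esub> g \<noteq> \<zero>\<^bsub>TW\<^esub>" "w (f \<otimes>\<^bsub>TW\<^esub> g) = w f + w g"
    using w_add_tlt[of ?m "f \<otimes>\<^bsub>TW\<^esub> g \<ominus>\<^bsub>TW\<^esub> ?m"] lead_mult_lead[OF f g] tlt_mult_sub_lead[OF f g] f g
    by auto
qed

text \<open>Under \<open>comm\<close> the two leading monomials commute, so their product cancels in
  the commutator and only the smaller remainders are left.\<close>

lemma tlt_commutator:
  assumes f: "f \<in> carrier TW" "f \<noteq> \<zero>\<^bsub>TW\<^esub>" and g: "g \<in> carrier TW" "g \<noteq> \<zero>\<^bsub>TW\<^esub>"
    and comm: "\<beta> (w f) (w g) = \<beta> (w g) (w f)"
  shows "tlt (f \<otimes>\<^bsub>TW\<^esub> g \<ominus>\<^bsub>TW\<^esub> g \<otimes>\<^bsub>TW\<^esub> f) (w f + w g)"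
proof -
  have "coc (\<tau> (w f)) (\<tau> (w g)) = coc (\<tau> (w g)) (\<tau> (w f))"
    using comm by (intro coc_comm) simp
  then have eq: "lead g \<otimes>\<^bsub>TW\<^esub> lead f = lead f \<otimes>\<^bsub>TW\<^esub> lead g"
    using f g by (simp add: lead_def tmono_mult_tmono m_comm add.commute)
  have "tlt ((f \<otimes>\<^bsub>TW\<^esub> g \<ominus>\<^bsub>TW\<^esub> lead f \<otimes>\<^bsub>TW\<^esub> lead g)
      \<ominus>\<^bsub>TW\<^esub> (g \<otimes>\<^bsub>TW\<^esub> f \<ominus>\<^bsub>TW\<^esub> lead f \<otimes>\<^bsub>TW\<^esub> lead g)) (w f + w g)"
    using tlt_mult_sub_lead[OF f g] tlt_mult_sub_lead[OF g f] f g
    by (intro tlt_diff[of "f \<otimes>\<^bsub>TW\<^esub> g \<ominus>\<^bsub>TW\<^esub> lead f \<otimes>\<^bsub>TW\<^esub> lead g"]) (simp_all add: eq add.commute)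
  also have "(f \<otimes>\<^bsub>TW\<^esub> g \<ominus>\<^bsub>TW\<^esub> lead f \<otimes>\<^bsub>TW\<^esub> lead g)
      \<ominus>\<^bsub>TW\<^esub> (g \<otimes>\<^bsub>TW\<^esub> f \<ominus>\<^bsub>TW\<^esub> lead f \<otimes>\<^bsub>TW\<^esub> lead g) = f \<otimes>\<^bsub>TW\<^esub> g \<ominus>\<^bsub>TW\<^esub> g \<otimes>\<^bsub>TW\<^esub> f"
    using f g lead_closed[of f] lead_closed[of g]
    by (simp add: TW.minus_eq TW.minus_add TW.a_ac TW.r_neg)
  finally show ?thesis .
qed

lemma w_emb_mult:
  assumes "a \<in> carrier K" "a \<noteq> \<zero>" "f \<in> carrier TW" "f \<noteq> \<zero>\<^bsub>TW\<^esub>"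
  shows "emb a \<otimes>\<^bsub>TW\<^esub> f \<noteq> \<zero>\<^bsub>TW\<^esub>" "w (emb a \<otimes>\<^bsub>TW\<^esub> f) = v a + w f"
  using w_mult[of "emb a" f] w_tmono[of a "\<tau> 0"] assms by (auto simp: emb_def)

end


section \<open>Orthogonal bases for the trace form\<close>

lemma (in abelian_monoid) finsum_swap:
  assumes "finite A" "finite B" "\<And>i j. \<lbrakk>i \<in> A; j \<in> B\<rbrakk> \<Longrightarrow> f i j \<in> carrier G"
  shows "(\<Oplus>i\<in>A. \<Oplus>j\<in>B. f i j) = (\<Oplus>j\<in>B. \<Oplus>i\<in>A. f i j)"
  using assms(1,3)
proof (induction A)
  case (insert a A)
  have "(\<Oplus>i\<in>insert a A. \<Oplus>j\<in>B. f i j) = (\<Oplus>j\<in>B. f a j) \<oplus> (\<Oplus>i\<in>A. \<Oplus>j\<in>B. f i j)"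
    using insert by (intro finsum_insert) (auto intro!: finsum_closed)
  also have "\<dots> = (\<Oplus>j\<in>B. f a j) \<oplus> (\<Oplus>j\<in>B. \<Oplus>i\<in>A. f i j)"
    using insert by simp
  also have "\<dots> = (\<Oplus>j\<in>B. f a j \<oplus> (\<Oplus>i\<in>A. f i j))"
    using insert by (intro finsum_addf[symmetric]) (auto intro!: finsum_closed)
  also have "\<dots> = (\<Oplus>j\<in>B. \<Oplus>i\<in>insert a A. f i j)"
    using insert by (intro finsum_cong') (auto intro!: finsum_closed)
  finally show ?case .
qed simp

lemma (in ring) subalgebra_finsum:
  assumes V: "subalgebra k V R" and "finite A" "\<And>i. i \<in> A \<Longrightarrow> f i \<in> V"
  shows "finsum R f A \<in> V"
  using assms(2,3)
proof (induction A)
  case empty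
  then show ?case
    using subgroup.one_closed[OF subalgebra.axioms(1)[OF V]] by simp
next
  case (insert a A)
  have "V \<subseteq> carrier R"
    by (rule subalgebra_in_carrier[OF V])
  then have "finsum R f (insert a A) = f a \<oplus> finsum R f A"
    using insert by (intro finsum_insert) auto
  then show ?case
    using insert subgroup.m_closed[OF subalgebra.axioms(1)[OF V]] by simp
qed

lemma (in ring) subalgebra_diff:
  assumes V: "subalgebra k V R" and "a \<in> V" "b \<in> V"
  shows "a \<ominus> b \<in> V"
  using assms(2,3) subgroup.m_closed[OF subalgebra.axioms(1)[OF V]]
    subgroup.m_inv_closed[OF subalgebra.axioms(1)[OF V]]
  by (simp add: minus_eq a_inv_def)

context twisted_group
begin

abbreviation scalars :: "(nat \<Rightarrow> 'a) set" where
  "scalars \<equiv> emb ` carrier K"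

lemma tr_mult_emb_mult:
  assumes "a \<in> carrier K" "f \<in> carrier TW" "g \<in> carrier TW"
  shows "tr (f \<otimes>\<^bsub>TW\<^esub> (emb a \<otimes>\<^bsub>TW\<^esub> g)) = a \<otimes> tr (f \<otimes>\<^bsub>TW\<^esub> g)"
    and "tr ((emb a \<otimes>\<^bsub>TW\<^esub> f) \<otimes>\<^bsub>TW\<^esub> g) = a \<otimes> tr (f \<otimes>\<^bsub>TW\<^esub> g)"
proof -
  have "f \<otimes>\<^bsub>TW\<^esub> (emb a \<otimes>\<^bsub>TW\<^esub> g) = emb a \<otimes>\<^bsub>TW\<^esub> (f \<otimes>\<^bsub>TW\<^esub> g)"
    using assms by (simp add: TW.m_assoc[symmetric] emb_comm)
  then show "tr (f \<otimes>\<^bsub>TW\<^esub> (emb a \<otimes>\<^bsub>TW\<^esub> g)) = a \<otimes> tr (f \<otimes>\<^bsub>TW\<^esub> g)"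
    using assms by (simp add: tr_emb_mult)
  show "tr ((emb a \<otimes>\<^bsub>TW\<^esub> f) \<otimes>\<^bsub>TW\<^esub> g) = a \<otimes> tr (f \<otimes>\<^bsub>TW\<^esub> g)"
    using assms by (simp add: TW.m_assoc tr_emb_mult)
qed

lemma tr_finsum:
  assumes "finite J" "\<And>i. i \<in> J \<Longrightarrow> f i \<in> carrier TW"
  shows "tr (finsum TW f J) = (\<Oplus>i\<in>J. tr (f i))"
  using assms by (induction J) (simp_all add: tr_zero tr_add Pi_iff)

lemma finsum_single_term:
  assumes "finite J" "j \<in> J" "\<And>i. i \<in> J \<Longrightarrow> c i \<in> carrier K"
    and "\<And>i. i \<in> J \<Longrightarrow> d i = (if i = j then \<one> else \<zero>)"
  shows "(\<Oplus>i\<in>J. c i \<otimes> d i) = c j"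
proof -
  have "(\<Oplus>i\<in>J. c i \<otimes> d i) = (\<Oplus>i\<in>J. if j = i then c i else \<zero>)"
    using assms by (intro finsum_cong') auto
  also have "\<dots> = c j"
    using assms by (intro finsum_singleton) auto
  finally show ?thesis .
qed

section \<open>Dual families for the trace form\<close>

definition biorth :: "nat set \<Rightarrow> (nat \<Rightarrow> nat \<Rightarrow> 'a) \<Rightarrow> (nat \<Rightarrow> nat \<Rightarrow> 'a) \<Rightarrow> bool" where
  "biorth J A B \<longleftrightarrow> finite J \<and> A ` J \<subseteq> carrier TW \<and> B ` J \<subseteq> carrier TW \<and>
     (\<forall>i\<in>J. \<forall>j\<in>J. tr (A i \<otimes>\<^bsub>TW\<^esub> B j) = (if i = j then \<one> else \<zero>))"

text \<open>The projection onto the span of \<open>A\<close> along the elements orthogonal to all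
  \<open>B i\<close>. On the span of \<open>A\<close> it is the expansion of an element in that
  basis.\<close>

definition proj :: "nat set \<Rightarrow> (nat \<Rightarrow> nat \<Rightarrow> 'a) \<Rightarrow> (nat \<Rightarrow> nat \<Rightarrow> 'a) \<Rightarrow> (nat \<Rightarrow> 'a) \<Rightarrow> nat \<Rightarrow> 'a" where
  "proj J A B z = (\<Oplus>\<^bsub>TW\<^esub>i\<in>J. emb (tr (z \<otimes>\<^bsub>TW\<^esub> B i)) \<otimes>\<^bsub>TW\<^esub> A i)"

lemma biorth_closed:
  assumes "biorth J A B" "i \<in> J"
  shows "A i \<in> carrier TW" "B i \<in> carrier TW"
  using assms by (auto simp: biorth_def)

lemma biorth_sym: "biorth J A B \<Longrightarrow> biorth J B A"
  unfolding biorth_def by (auto simp: tr_comm image_subset_iff)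

lemma proj_closed [simp]: "\<lbrakk>biorth J A B; z \<in> carrier TW\<rbrakk> \<Longrightarrow> proj J A B z \<in> carrier TW"
  unfolding proj_def by (intro TW.finsum_closed) (auto simp: biorth_closed)

lemma tr_proj:
  assumes J: "biorth J A B" "j \<in> J" and z: "z \<in> carrier TW"
  shows "tr (proj J A B z \<otimes>\<^bsub>TW\<^esub> B j) = tr (z \<otimes>\<^bsub>TW\<^esub> B j)"
proof -
  have fin: "finite J"
    using J by (simp add: biorth_def)
  note [simp] = biorth_closed[OF J(1)]
  have "proj J A B z \<otimes>\<^bsub>TW\<^esub> B j
      = (\<Oplus>\<^bsub>TW\<^esub>i\<in>J. (emb (tr (z \<otimes>\<^bsub>TW\<^esub> B i)) \<otimes>\<^bsub>TW\<^esub> A i) \<otimes>\<^bsub>TW\<^esub> B j)"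
    unfolding proj_def using fin J z by (intro TW.finsum_ldistr) auto
  then have "tr (proj J A B z \<otimes>\<^bsub>TW\<^esub> B j)
      = (\<Oplus>i\<in>J. tr ((emb (tr (z \<otimes>\<^bsub>TW\<^esub> B i)) \<otimes>\<^bsub>TW\<^esub> A i) \<otimes>\<^bsub>TW\<^esub> B j))"
    using fin J z by (simp add: tr_finsum)
  also have "\<dots> = (\<Oplus>i\<in>J. tr (z \<otimes>\<^bsub>TW\<^esub> B i) \<otimes> tr (A i \<otimes>\<^bsub>TW\<^esub> B j))"
    using J z by (intro finsum_cong') (auto simp: tr_mult_emb_mult)
  also have "\<dots> = tr (z \<otimes>\<^bsub>TW\<^esub> B j)"
    using J fin z by (intro finsum_single_term) (auto simp: biorth_def)
  finally show ?thesis .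
qed

lemma tr_sub_proj:
  assumes "biorth J A B" "j \<in> J" "z \<in> carrier TW"
  shows "tr ((z \<ominus>\<^bsub>TW\<^esub> proj J A B z) \<otimes>\<^bsub>TW\<^esub> B j) = \<zero>"
proof -
  note c = biorth_closed[OF assms(1,2)]
  have "(z \<ominus>\<^bsub>TW\<^esub> proj J A B z) \<otimes>\<^bsub>TW\<^esub> B j = z \<otimes>\<^bsub>TW\<^esub> B j \<ominus>\<^bsub>TW\<^esub> proj J A B z \<otimes>\<^bsub>TW\<^esub> B j"
    using assms c by (simp add: TW.minus_eq TW.l_distr TW.l_minus)
  then show ?thesis
    using assms c tr_proj[OF assms] by (simp add: tr_diff r_neg minus_eq)
qed

lemma proj_in_subalgebra:
  assumes "biorth J A B" "subalgebra scalars V TW" "A ` J \<subseteq> V" "z \<in> carrier TW"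
  shows "proj J A B z \<in> V"
  unfolding proj_def
proof (rule TW.subalgebra_finsum[OF assms(2)])
  show "finite J"
    using assms by (simp add: biorth_def)
  fix i assume "i \<in> J"
  then show "emb (tr (z \<otimes>\<^bsub>TW\<^esub> B i)) \<otimes>\<^bsub>TW\<^esub> A i \<in> V"
    using assms by (intro subalgebra.smult_closed[OF assms(2)]) (auto simp: biorth_closed)
qed

text \<open>The Casimir element \<open>\<Sum>\<^sub>i A\<^sub>i \<otimes> B\<^sub>i\<close> of the trace form commutes with the subalgebra, so that
  applying it to an element produces a central one.\<close>

lemma casimir_central:
  assumes bi: "biorth J A B" and V: "V \<subseteq> carrier TW" "A ` J \<subseteq> V" "B ` J \<subseteq> V"
    and mult: "\<And>x y. \<lbrakk>x \<in> V; y \<in> V\<rbrakk> \<Longrightarrow> x \<otimes>\<^bsub>TW\<^esub> y \<in> V"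
    and expA: "\<And>z. z \<in> V \<Longrightarrow> proj J A B z = z" and expB: "\<And>z. z \<in> V \<Longrightarrow> proj J B A z = z"
    and x: "x \<in> V" and y: "y \<in> V"
  shows "y \<otimes>\<^bsub>TW\<^esub> (\<Oplus>\<^bsub>TW\<^esub>i\<in>J. A i \<otimes>\<^bsub>TW\<^esub> x \<otimes>\<^bsub>TW\<^esub> B i) = (\<Oplus>\<^bsub>TW\<^esub>i\<in>J. A i \<otimes>\<^bsub>TW\<^esub> x \<otimes>\<^bsub>TW\<^esub> B i) \<otimes>\<^bsub>TW\<^esub> y"
proof -
  have fin: "finite J"
    using bi by (simp add: biorth_def)
  have [simp]: "A i \<in> carrier TW" "B i \<in> carrier TW" if "i \<in> J" for i
    using biorth_closed[OF bi that] by auto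
  have [simp]: "x \<in> carrier TW" "y \<in> carrier TW"
    using x y V by auto
  \<comment> \<open>The common term of two expansions: \<open>y A_i\<close> in the
    \<open>A_j\<close> and \<open>B_j y\<close> in the \<open>B_i\<close> have the same coefficients
    \<open>tr (y A_i B_j)\<close>, by symmetry of the trace.\<close>
  let ?t = "\<lambda>i j. emb (tr (y \<otimes>\<^bsub>TW\<^esub> A i \<otimes>\<^bsub>TW\<^esub> B j)) \<otimes>\<^bsub>TW\<^esub> (A j \<otimes>\<^bsub>TW\<^esub> x \<otimes>\<^bsub>TW\<^esub> B i)"
  have "y \<otimes>\<^bsub>TW\<^esub> (\<Oplus>\<^bsub>TW\<^esub>i\<in>J. A i \<otimes>\<^bsub>TW\<^esub> x \<otimes>\<^bsub>TW\<^esub> B i) = (\<Oplus>\<^bsub>TW\<^esub>i\<in>J. y \<otimes>\<^bsub>TW\<^esub> (A i \<otimes>\<^bsub>TW\<^esub> x \<otimes>\<^bsub>TW\<^esub> B i))"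
    using fin by (intro TW.finsum_rdistr) auto
  also have "\<dots> = (\<Oplus>\<^bsub>TW\<^esub>i\<in>J. \<Oplus>\<^bsub>TW\<^esub>j\<in>J. ?t i j)"
  proof (rule TW.finsum_cong')
    fix i assume i: "i \<in> J"
    have "y \<otimes>\<^bsub>TW\<^esub> (A i \<otimes>\<^bsub>TW\<^esub> x \<otimes>\<^bsub>TW\<^esub> B i) = (y \<otimes>\<^bsub>TW\<^esub> A i) \<otimes>\<^bsub>TW\<^esub> (x \<otimes>\<^bsub>TW\<^esub> B i)"
      using i by (simp add: TW.m_assoc)
    also have "y \<otimes>\<^bsub>TW\<^esub> A i = proj J A B (y \<otimes>\<^bsub>TW\<^esub> A i)"
      using i V y by (intro expA[symmetric] mult) auto
    also have "proj J A B (y \<otimes>\<^bsub>TW\<^esub> A i) \<otimes>\<^bsub>TW\<^esub> (x \<otimes>\<^bsub>TW\<^esub> B i)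
        = (\<Oplus>\<^bsub>TW\<^esub>j\<in>J. (emb (tr (y \<otimes>\<^bsub>TW\<^esub> A i \<otimes>\<^bsub>TW\<^esub> B j)) \<otimes>\<^bsub>TW\<^esub> A j) \<otimes>\<^bsub>TW\<^esub> (x \<otimes>\<^bsub>TW\<^esub> B i))"
      unfolding proj_def using i fin by (intro TW.finsum_ldistr) auto
    also have "\<dots> = (\<Oplus>\<^bsub>TW\<^esub>j\<in>J. ?t i j)"
      using i by (intro TW.finsum_cong') (auto simp: TW.m_assoc)
    finally show "y \<otimes>\<^bsub>TW\<^esub> (A i \<otimes>\<^bsub>TW\<^esub> x \<otimes>\<^bsub>TW\<^esub> B i) = (\<Oplus>\<^bsub>TW\<^esub>j\<in>J. ?t i j)" .
  qed (auto intro!: TW.finsum_closed)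
  also have "\<dots> = (\<Oplus>\<^bsub>TW\<^esub>j\<in>J. \<Oplus>\<^bsub>TW\<^esub>i\<in>J. ?t i j)"
    using fin by (intro TW.finsum_swap) auto
  also have "\<dots> = (\<Oplus>\<^bsub>TW\<^esub>j\<in>J. A j \<otimes>\<^bsub>TW\<^esub> x \<otimes>\<^bsub>TW\<^esub> B j \<otimes>\<^bsub>TW\<^esub> y)"
  proof (rule TW.finsum_cong')
    fix j assume j: "j \<in> J"
    have "A j \<otimes>\<^bsub>TW\<^esub> x \<otimes>\<^bsub>TW\<^esub> B j \<otimes>\<^bsub>TW\<^esub> y = (A j \<otimes>\<^bsub>TW\<^esub> x) \<otimes>\<^bsub>TW\<^esub> (B j \<otimes>\<^bsub>TW\<^esub> y)"
      using j by (simp add: TW.m_assoc)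
    also have "B j \<otimes>\<^bsub>TW\<^esub> y = proj J B A (B j \<otimes>\<^bsub>TW\<^esub> y)"
      using j V y by (intro expB[symmetric] mult) auto
    also have "(A j \<otimes>\<^bsub>TW\<^esub> x) \<otimes>\<^bsub>TW\<^esub> proj J B A (B j \<otimes>\<^bsub>TW\<^esub> y)
        = (\<Oplus>\<^bsub>TW\<^esub>i\<in>J. (A j \<otimes>\<^bsub>TW\<^esub> x) \<otimes>\<^bsub>TW\<^esub> (emb (tr (B j \<otimes>\<^bsub>TW\<^esub> y \<otimes>\<^bsub>TW\<^esub> A i)) \<otimes>\<^bsub>TW\<^esub> B i))"
      unfolding proj_def using j fin by (intro TW.finsum_rdistr) auto
    also have "\<dots> = (\<Oplus>\<^bsub>TW\<^esub>i\<in>J. ?t i j)"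
    proof (rule TW.finsum_cong')
      fix i assume i: "i \<in> J"
      have "tr (B j \<otimes>\<^bsub>TW\<^esub> y \<otimes>\<^bsub>TW\<^esub> A i) = tr (y \<otimes>\<^bsub>TW\<^esub> A i \<otimes>\<^bsub>TW\<^esub> B j)"
        using i j tr_comm[of "B j" "y \<otimes>\<^bsub>TW\<^esub> A i"] by (simp add: TW.m_assoc)
      moreover have "(A j \<otimes>\<^bsub>TW\<^esub> x) \<otimes>\<^bsub>TW\<^esub> (emb c \<otimes>\<^bsub>TW\<^esub> B i) = emb c \<otimes>\<^bsub>TW\<^esub> (A j \<otimes>\<^bsub>TW\<^esub> x \<otimes>\<^bsub>TW\<^esub> B i)"
        if "c \<in> carrier K" for c
        using that i j emb_comm[of c "A j \<otimes>\<^bsub>TW\<^esub> x"] by (simp add: TW.m_assoc[symmetric])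
      ultimately show "(A j \<otimes>\<^bsub>TW\<^esub> x) \<otimes>\<^bsub>TW\<^esub> (emb (tr (B j \<otimes>\<^bsub>TW\<^esub> y \<otimes>\<^bsub>TW\<^esub> A i)) \<otimes>\<^bsub>TW\<^esub> B i) = ?t i j"
        using i j by simp
    qed (use j in auto)
    finally show "(\<Oplus>\<^bsub>TW\<^esub>i\<in>J. ?t i j) = A j \<otimes>\<^bsub>TW\<^esub> x \<otimes>\<^bsub>TW\<^esub> B j \<otimes>\<^bsub>TW\<^esub> y"
      by simp
  qed auto
  also have "\<dots> = (\<Oplus>\<^bsub>TW\<^esub>j\<in>J. A j \<otimes>\<^bsub>TW\<^esub> x \<otimes>\<^bsub>TW\<^esub> B j) \<otimes>\<^bsub>TW\<^esub> y"
    using fin by (intro TW.finsum_ldistr[symmetric]) auto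
  finally show ?thesis .
qed

end

context valued_twisted_group
begin

text \<open>A value in \<open>D\<close> places the leading monomial at the index
  \<open>\<tau> 0\<close>, which is the one that the trace reads.\<close>

lemma tr_lead:
  assumes "f \<in> carrier TW" "f \<noteq> \<zero>\<^bsub>TW\<^esub>" "w f \<in> D"
  shows "tr f \<noteq> \<zero>" "v (tr f) = w f"
proof -
  have "\<tau> (w f) = \<tau> 0"
    using assms(3) by (simp add: \<tau>_eq_iff)
  then show "tr f \<noteq> \<zero>" "v (tr f) = w f"
    using w_lead[OF assms(1,2)] by (simp_all add: tr_def)
qed

lemma tlt_emb_mult:
  assumes "a \<in> carrier K" "klt a \<gamma>" "f \<in> carrier TW" "tle f \<delta>"
  shows "tlt (emb a \<otimes>\<^bsub>TW\<^esub> f) (\<gamma> + \<delta>)"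
proof -
  have "tlt (emb a) \<gamma>"
    using assms(2) by (simp add: tlt_def emb_apply)
  then show ?thesis
    using assms by (intro tlt_mult_left) auto
qed

text \<open>A nonzero scalar has its value in \<open>D\<close>, so the trace cannot attain a bound
  outside \<open>D\<close>.\<close>

lemma klt_tr:
  assumes "f \<in> carrier TW" "tle f \<gamma>" "\<gamma> \<notin> D"
  shows "klt (tr f) \<gamma>"
proof (cases "tr f = \<zero>")
  case False
  have "kle (tr f) \<gamma>"
    using assms(2) by (auto simp: tle_def tr_def dest: spec[of _ "\<tau> 0"])
  moreover have "v (tr f) \<noteq> \<gamma>"
    using False assms v_D[of "tr f"] by auto
  ultimately show ?thesis
    using False by (simp add: kle_def klt_def)
qed simp

lemma tlt_finsum:
  assumes "finite J" "\<And>i. i \<in> J \<Longrightarrow> f i \<in> carrier TW" "\<And>i. i \<in> J \<Longrightarrow> tlt (f i) \<gamma>"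
  shows "tlt (finsum TW f J) \<gamma>"
  using assms
proof (induction J)
  case empty
  then show ?case
    by (simp add: tlt_def TW_zero_apply)
qed (simp add: Pi_iff tlt_add)

lemma w_sub_tlt:
  assumes "f \<in> carrier TW" "f \<noteq> \<zero>\<^bsub>TW\<^esub>" "g \<in> carrier TW" "tlt g (w f)"
  shows "f \<ominus>\<^bsub>TW\<^esub> g \<noteq> \<zero>\<^bsub>TW\<^esub>" "w (f \<ominus>\<^bsub>TW\<^esub> g) = w f"
  using w_add_tlt[of f "\<ominus>\<^bsub>TW\<^esub> g"] assms by (simp_all add: TW.minus_eq tlt_minus)

definition normed :: "nat set \<Rightarrow> (nat \<Rightarrow> nat \<Rightarrow> 'a) \<Rightarrow> (nat \<Rightarrow> nat \<Rightarrow> 'a) \<Rightarrow> bool" where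
  "normed J A B \<longleftrightarrow>
     (\<forall>i\<in>J. A i \<noteq> \<zero>\<^bsub>TW\<^esub> \<and> B i \<noteq> \<zero>\<^bsub>TW\<^esub> \<and> w (B i) = - w (A i))"

lemma normed_sym: "normed J A B \<Longrightarrow> normed J B A"
  by (auto simp: normed_def)

text \<open>The coefficient at \<open>A i\<close> is the trace of an element of value
  \<open>w z - w (A i)\<close>; this lies outside \<open>D\<close>, so the trace is strictly
  smaller. Subtracting the projection therefore keeps the leading term of \<open>z\<close>.\<close>

lemma tlt_proj:
  assumes J: "biorth J A B" "normed J A B"
    and z: "z \<in> carrier TW" "z \<noteq> \<zero>\<^bsub>TW\<^esub>" "\<And>j. j \<in> J \<Longrightarrow> w z - w (A j) \<notin> D"
  shows "tlt (proj J A B z) (w z)"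
  unfolding proj_def
proof (rule tlt_finsum)
  show "finite J"
    using J(1) by (simp add: biorth_def)
  fix i assume i: "i \<in> J"
  note c = biorth_closed[OF J(1) i]
  show "emb (tr (z \<otimes>\<^bsub>TW\<^esub> B i)) \<otimes>\<^bsub>TW\<^esub> A i \<in> carrier TW"
    using c z by auto
  have "w (z \<otimes>\<^bsub>TW\<^esub> B i) = w z - w (A i)"
    using w_mult[OF z(1,2)] c i J(2) by (simp add: normed_def)
  then have "tle (z \<otimes>\<^bsub>TW\<^esub> B i) (w z - w (A i))"
    using tle_w[of "z \<otimes>\<^bsub>TW\<^esub> B i"] c z by simp
  then have "klt (tr (z \<otimes>\<^bsub>TW\<^esub> B i)) (w z - w (A i))"
    using c z i by (intro klt_tr) auto
  then have "tlt (emb (tr (z \<otimes>\<^bsub>TW\<^esub> B i)) \<otimes>\<^bsub>TW\<^esub> A i) (w z - w (A i) + w (A i))"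
    using c z by (intro tlt_emb_mult tle_w) auto
  then show "tlt (emb (tr (z \<otimes>\<^bsub>TW\<^esub> B i)) \<otimes>\<^bsub>TW\<^esub> A i) (w z)"
    by simp
qed

text \<open>The residue is orthogonal to \<open>B j\<close>. If it shared the class of
  \<open>A j\<close>, its product with \<open>B j\<close> would have a value in \<open>D\<close> and
  hence a nonzero trace. So a residue whose class occurs among the \<open>A j\<close> must
  vanish.\<close>

lemma sub_proj_class:
  assumes J: "biorth J A B" "normed J A B" "j \<in> J" and z: "z \<in> carrier TW"
    and nz: "z \<ominus>\<^bsub>TW\<^esub> proj J A B z \<noteq> \<zero>\<^bsub>TW\<^esub>"
  shows "w (z \<ominus>\<^bsub>TW\<^esub> proj J A B z) - w (A j) \<notin> D"
proof
  let ?z = "z \<ominus>\<^bsub>TW\<^esub> proj J A B z"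
  assume D: "w ?z - w (A j) \<in> D"
  note c = biorth_closed[OF J(1,3)]
  have zc: "?z \<in> carrier TW"
    using z J by simp
  have "?z \<otimes>\<^bsub>TW\<^esub> B j \<noteq> \<zero>\<^bsub>TW\<^esub>" "w (?z \<otimes>\<^bsub>TW\<^esub> B j) = w ?z - w (A j)"
    using w_mult[OF zc nz, of "B j"] c J by (auto simp: normed_def)
  then have "tr (?z \<otimes>\<^bsub>TW\<^esub> B j) \<noteq> \<zero>"
    using tr_lead(1)[of "?z \<otimes>\<^bsub>TW\<^esub> B j"] D zc c by auto
  then show False
    using tr_sub_proj[OF J(1,3) z] by simp
qed

text \<open>Gram--Schmidt for the trace form. The correction terms do not affect the leading terms,
  because traces of elements whose leading class is nonzero are small.\<close>

lemma biorth_exists: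
  assumes "finite J" and W: "subalgebra scalars W TW" and W': "subalgebra scalars W' TW"
    and "\<And>j. j \<in> J \<Longrightarrow> \<exists>a\<in>W. a \<noteq> \<zero>\<^bsub>TW\<^esub> \<and> w a = e j"
    and "\<And>j. j \<in> J \<Longrightarrow> \<exists>b\<in>W'. b \<noteq> \<zero>\<^bsub>TW\<^esub> \<and> w b = - e j"
  shows "\<exists>A B. biorth J A B \<and> normed J A B \<and> A ` J \<subseteq> W \<and> B ` J \<subseteq> W' \<and> (\<forall>j\<in>J. w (A j) = e j)"
  using assms(1,4,5)
proof (induction J)
  case empty
  then show ?case
    by (auto simp: biorth_def normed_def)
next
  case (insert h J)
  have "\<exists>A B. biorth J A B \<and> normed J A B \<and> A ` J \<subseteq> W \<and> B ` J \<subseteq> W' \<and> (\<forall>j\<in>J. w (A j) = e j)"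
    using insert.prems by (intro insert.IH) simp_all
  then obtain A B where bi: "biorth J A B" and no: "normed J A B"
    and AW: "A ` J \<subseteq> W" and BW: "B ` J \<subseteq> W'" and wA: "\<And>j. j \<in> J \<Longrightarrow> w (A j) = e j"
    by blast
  have wB: "w (B j) = - e j" if "j \<in> J" for j
    using no wA that by (simp add: normed_def)
  obtain a where a: "a \<in> W" "a \<noteq> \<zero>\<^bsub>TW\<^esub>" "w a = e h"
    using insert.prems(1) by blast
  obtain b where b: "b \<in> W'" "b \<noteq> \<zero>\<^bsub>TW\<^esub>" "w b = - e h"
    using insert.prems(2) by blast
  have cW: "W \<subseteq> carrier TW" "W' \<subseteq> carrier TW"
    using TW.subalgebra_in_carrier W W' by auto
  note ac = subsetD[OF cW(1) a(1)] and bc = subsetD[OF cW(2) b(1)]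
  note bi' = biorth_sym[OF bi]
  have hj: "e h - e j \<notin> D" "e j - e h \<notin> D" if "j \<in> J" for j
    using that insert.hyps(2) \<tau>_eq_iff[of "e h" "e j"] \<tau>_eq_iff[of "e j" "e h"] by auto
  \<comment> \<open>Both candidates lose their components along the earlier vectors:
    \<open>a'\<close> becomes orthogonal to the \<open>B j\<close> and \<open>b0\<close> to the
    \<open>A j\<close>. By \<open>tlt_proj\<close> their leading terms survive.\<close>
  define a' where "a' = a \<ominus>\<^bsub>TW\<^esub> proj J A B a"
  define b0 where "b0 = b \<ominus>\<^bsub>TW\<^esub> proj J B A b"
  have a'W: "a' \<in> W"
    unfolding a'_def using a(1) ac bi AW W by (intro TW.subalgebra_diff[OF W] proj_in_subalgebra) auto
  have b0W: "b0 \<in> W'"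
    unfolding b0_def using b(1) bc bi' BW W' by (intro TW.subalgebra_diff[OF W'] proj_in_subalgebra) auto
  have a'c: "a' \<in> carrier TW" and b0c: "b0 \<in> carrier TW"
    using a'W b0W cW by auto
  have "tlt (proj J A B a) (w a)"
    using bi no ac a wA hj by (intro tlt_proj) auto
  then have a': "a' \<noteq> \<zero>\<^bsub>TW\<^esub>" "w a' = e h"
    unfolding a'_def using w_sub_tlt[OF ac a(2)] ac bi a(3) by auto
  have "tlt (proj J B A b) (w b)"
    using bi' normed_sym[OF no] bc b wB hj by (intro tlt_proj) auto
  then have b0: "b0 \<noteq> \<zero>\<^bsub>TW\<^esub>" "w b0 = - e h"
    unfolding b0_def using w_sub_tlt[OF bc b(2)] bc bi' b(3) by auto
  \<comment> \<open>\<open>a'\<close> and \<open>b0\<close> have opposite values, so their trace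
    pairing is a nonzero scalar of value 0; dividing by it normalises the pair without changing the
    value of \<open>b0\<close>.\<close>
  define c where "c = inv (tr (a' \<otimes>\<^bsub>TW\<^esub> b0))"
  have "a' \<otimes>\<^bsub>TW\<^esub> b0 \<noteq> \<zero>\<^bsub>TW\<^esub>" "w (a' \<otimes>\<^bsub>TW\<^esub> b0) = 0"
    using w_mult[OF a'c a'(1) b0c b0(1)] a'(2) b0(2) by auto
  then have t: "tr (a' \<otimes>\<^bsub>TW\<^esub> b0) \<noteq> \<zero>" "v (tr (a' \<otimes>\<^bsub>TW\<^esub> b0)) = 0"
    using tr_lead[of "a' \<otimes>\<^bsub>TW\<^esub> b0"] a'c b0c by auto
  have tc: "tr (a' \<otimes>\<^bsub>TW\<^esub> b0) \<in> Units K"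
    using t(1) a'c b0c by (simp add: field_Units)
  have c: "c \<in> carrier K" "c \<otimes> tr (a' \<otimes>\<^bsub>TW\<^esub> b0) = \<one>"
    unfolding c_def using tc by auto
  then have cnz: "c \<noteq> \<zero>"
    using a'c b0c by auto
  have vc: "v c = 0"
    using v_mult[OF c(1) cnz _ t(1)] c(2) t(2) a'c b0c by simp
  define b' where "b' = emb c \<otimes>\<^bsub>TW\<^esub> b0"
  have b'W: "b' \<in> W'"
    unfolding b'_def using c(1) b0W by (intro subalgebra.smult_closed[OF W']) auto
  have b'c: "b' \<in> carrier TW"
    using b'W cW by auto
  have b': "b' \<noteq> \<zero>\<^bsub>TW\<^esub>" "w b' = - e h"
    unfolding b'_def using w_emb_mult[OF c(1) cnz b0c b0(1)] vc b0(2) by auto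
  have t1: "tr (a' \<otimes>\<^bsub>TW\<^esub> b') = \<one>"
    unfolding b'_def using c a'c b0c by (simp add: tr_mult_emb_mult)
  have t2: "tr (a' \<otimes>\<^bsub>TW\<^esub> B j) = \<zero>" if "j \<in> J" for j
    unfolding a'_def using tr_sub_proj[OF bi that ac] .
  have t3: "tr (A j \<otimes>\<^bsub>TW\<^esub> b') = \<zero>" if "j \<in> J" for j
  proof -
    have "tr (A j \<otimes>\<^bsub>TW\<^esub> b0) = tr (b0 \<otimes>\<^bsub>TW\<^esub> A j)"
      using biorth_closed[OF bi that] b0c by (intro tr_comm)
    also have "\<dots> = \<zero>"
      unfolding b0_def using tr_sub_proj[OF bi' that bc] .
    finally show ?thesis
      unfolding b'_def using c(1) biorth_closed[OF bi that] b0c by (simp add: tr_mult_emb_mult)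
  qed
  let ?A = "A(h := a')" and ?B = "B(h := b')"
  have "biorth (insert h J) ?A ?B"
    using bi insert.hyps t1 t2 t3 a'c b'c by (auto simp: biorth_def)
  moreover have "normed (insert h J) ?A ?B"
    using no insert.hyps a' b' by (auto simp: normed_def)
  moreover have "?A ` insert h J \<subseteq> W" "?B ` insert h J \<subseteq> W'"
    using AW BW a'W b'W insert.hyps(2) by auto
  moreover have "\<forall>j\<in>insert h J. w (?A j) = e j"
    using wA a'(2) by auto
  ultimately show ?case
    by blast
qed

text \<open>Modulo smaller terms every summand of the Casimir sum is \<open>x\<close>, as the leading term of \<open>x\<close>
  commutes with those of all the \<open>A\<^sub>i\<close>.\<close>

lemma casimir_lead:
  assumes J: "biorth J A B" "normed J A B" and x: "x \<in> carrier TW" "x \<noteq> \<zero>\<^bsub>TW\<^esub>"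
    and comm: "\<And>i. i \<in> J \<Longrightarrow> \<beta> (w (A i)) (w x) = \<beta> (w x) (w (A i))"
  shows "tlt ((\<Oplus>\<^bsub>TW\<^esub>i\<in>J. A i \<otimes>\<^bsub>TW\<^esub> x \<otimes>\<^bsub>TW\<^esub> B i) \<ominus>\<^bsub>TW\<^esub> (\<Oplus>\<^bsub>TW\<^esub>i\<in>J. x)) (w x)"
proof -
  have fin: "finite J"
    using J(1) by (simp add: biorth_def)
  have [simp]: "A i \<in> carrier TW" "B i \<in> carrier TW" if "i \<in> J" for i
    using biorth_closed[OF J(1) that] by auto
  note [simp] = x(1)
  have summand: "tlt (A i \<otimes>\<^bsub>TW\<^esub> x \<otimes>\<^bsub>TW\<^esub> B i \<ominus>\<^bsub>TW\<^esub> x) (w x)" if i: "i \<in> J" for i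
  proof -
    have nz: "A i \<noteq> \<zero>\<^bsub>TW\<^esub>" "B i \<noteq> \<zero>\<^bsub>TW\<^esub>" "w (B i) = - w (A i)"
      using J(2) i by (auto simp: normed_def)
    \<comment> \<open>\<open>A i x B i - x\<close> splits as
      \<open>(A i x - x A i) B i + x (A i B i - 1)\<close>. The first part is small because the
      leading monomials of \<open>A i\<close> and \<open>x\<close> commute.\<close>
    have "tlt (A i \<otimes>\<^bsub>TW\<^esub> x \<ominus>\<^bsub>TW\<^esub> x \<otimes>\<^bsub>TW\<^esub> A i) (w (A i) + w x)"
      using i nz comm x by (intro tlt_commutator) auto
    then have "tlt ((A i \<otimes>\<^bsub>TW\<^esub> x \<ominus>\<^bsub>TW\<^esub> x \<otimes>\<^bsub>TW\<^esub> A i) \<otimes>\<^bsub>TW\<^esub> B i) (w (A i) + w x + w (B i))"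
      using i tle_w[of "B i"] by (intro tlt_mult_left) auto
    then have 1: "tlt ((A i \<otimes>\<^bsub>TW\<^esub> x \<ominus>\<^bsub>TW\<^esub> x \<otimes>\<^bsub>TW\<^esub> A i) \<otimes>\<^bsub>TW\<^esub> B i) (w x)"
      using nz(3) by simp
    \<comment> \<open>For the second part: \<open>A i B i\<close> has value at most 0 and trace 1,
      so subtracting the unit removes the only coefficient that can attain the bound 0.\<close>
    have "tlt (A i \<otimes>\<^bsub>TW\<^esub> B i \<ominus>\<^bsub>TW\<^esub> \<one>\<^bsub>TW\<^esub>) 0"
    proof (rule tltI)
      have "tle (A i \<otimes>\<^bsub>TW\<^esub> B i) (w (A i) + w (B i))"
        using i by (intro tle_mult tle_w) auto
      then have "tle (A i \<otimes>\<^bsub>TW\<^esub> B i) 0"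
        using nz(3) by simp
      moreover have "tle \<one>\<^bsub>TW\<^esub> 0"
        using tle_w[of "\<one>\<^bsub>TW\<^esub>"] w_tmono[of \<one> "\<tau> 0"] by (simp add: TW_one)
      ultimately show "tle (A i \<otimes>\<^bsub>TW\<^esub> B i \<ominus>\<^bsub>TW\<^esub> \<one>\<^bsub>TW\<^esub>) 0"
        using i by (intro tle_diff) auto
      have "tr (A i \<otimes>\<^bsub>TW\<^esub> B i) = \<one>"
        using J(1) i by (simp add: biorth_def)
      then show "(A i \<otimes>\<^bsub>TW\<^esub> B i \<ominus>\<^bsub>TW\<^esub> \<one>\<^bsub>TW\<^esub>) (\<tau> 0) = \<zero>"
        using i by (simp add: TW_diff_apply tr_def TW_one tmono_apply r_neg minus_eq)
    qed (use i in simp)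
    then have "tlt (x \<otimes>\<^bsub>TW\<^esub> (A i \<otimes>\<^bsub>TW\<^esub> B i \<ominus>\<^bsub>TW\<^esub> \<one>\<^bsub>TW\<^esub>)) (w x + 0)"
      using i by (intro tlt_mult_right tle_w) auto
    then have "tlt ((A i \<otimes>\<^bsub>TW\<^esub> x \<ominus>\<^bsub>TW\<^esub> x \<otimes>\<^bsub>TW\<^esub> A i) \<otimes>\<^bsub>TW\<^esub> B i
        \<oplus>\<^bsub>TW\<^esub> x \<otimes>\<^bsub>TW\<^esub> (A i \<otimes>\<^bsub>TW\<^esub> B i \<ominus>\<^bsub>TW\<^esub> \<one>\<^bsub>TW\<^esub>)) (w x)"
      using 1 i by (intro tlt_add) auto
    also have "(A i \<otimes>\<^bsub>TW\<^esub> x \<ominus>\<^bsub>TW\<^esub> x \<otimes>\<^bsub>TW\<^esub> A i) \<otimes>\<^bsub>TW\<^esub> B i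
        \<oplus>\<^bsub>TW\<^esub> x \<otimes>\<^bsub>TW\<^esub> (A i \<otimes>\<^bsub>TW\<^esub> B i \<ominus>\<^bsub>TW\<^esub> \<one>\<^bsub>TW\<^esub>) = A i \<otimes>\<^bsub>TW\<^esub> x \<otimes>\<^bsub>TW\<^esub> B i \<ominus>\<^bsub>TW\<^esub> x"
      using i by (simp add: TW.minus_eq TW.l_distr TW.r_distr TW.l_minus TW.r_minus TW.m_assoc
          TW.a_assoc TW.r_neg1)
    finally show ?thesis .
  qed
  have "tlt (\<Oplus>\<^bsub>TW\<^esub>i\<in>J. A i \<otimes>\<^bsub>TW\<^esub> x \<otimes>\<^bsub>TW\<^esub> B i \<ominus>\<^bsub>TW\<^esub> x) (w x)"
    using fin summand by (intro tlt_finsum) auto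
  also have "(\<Oplus>\<^bsub>TW\<^esub>i\<in>J. A i \<otimes>\<^bsub>TW\<^esub> x \<otimes>\<^bsub>TW\<^esub> B i \<ominus>\<^bsub>TW\<^esub> x)
      = (\<Oplus>\<^bsub>TW\<^esub>i\<in>J. A i \<otimes>\<^bsub>TW\<^esub> x \<otimes>\<^bsub>TW\<^esub> B i) \<ominus>\<^bsub>TW\<^esub> (\<Oplus>\<^bsub>TW\<^esub>i\<in>J. x)"
  proof -
    have "(\<Oplus>\<^bsub>TW\<^esub>i\<in>J. A i \<otimes>\<^bsub>TW\<^esub> x \<otimes>\<^bsub>TW\<^esub> B i)
        = (\<Oplus>\<^bsub>TW\<^esub>i\<in>J. (A i \<otimes>\<^bsub>TW\<^esub> x \<otimes>\<^bsub>TW\<^esub> B i \<ominus>\<^bsub>TW\<^esub> x) \<oplus>\<^bsub>TW\<^esub> x)"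
      by (intro TW.finsum_cong') (auto simp: TW.minus_eq TW.a_assoc TW.l_neg)
    also have "\<dots> = (\<Oplus>\<^bsub>TW\<^esub>i\<in>J. A i \<otimes>\<^bsub>TW\<^esub> x \<otimes>\<^bsub>TW\<^esub> B i \<ominus>\<^bsub>TW\<^esub> x) \<oplus>\<^bsub>TW\<^esub> (\<Oplus>\<^bsub>TW\<^esub>i\<in>J. x)"
      by (intro TW.finsum_addf) auto
    finally have eq: "(\<Oplus>\<^bsub>TW\<^esub>i\<in>J. A i \<otimes>\<^bsub>TW\<^esub> x \<otimes>\<^bsub>TW\<^esub> B i)
        = (\<Oplus>\<^bsub>TW\<^esub>i\<in>J. A i \<otimes>\<^bsub>TW\<^esub> x \<otimes>\<^bsub>TW\<^esub> B i \<ominus>\<^bsub>TW\<^esub> x) \<oplus>\<^bsub>TW\<^esub> (\<Oplus>\<^bsub>TW\<^esub>i\<in>J. x)" .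
    have "b = a \<ominus>\<^bsub>TW\<^esub> c" if "a = b \<oplus>\<^bsub>TW\<^esub> c" "b \<in> carrier TW" "c \<in> carrier TW" for a b c
      using that by (simp add: TW.minus_eq TW.a_assoc TW.r_neg)
    from this[OF eq] show ?thesis
      by (simp add: Pi_iff)
  qed
  finally show ?thesis .
qed

end


section \<open>Finite-dimensional subalgebras\<close>

definition gmul :: "nat \<Rightarrow> 'g::comm_monoid_add \<Rightarrow> 'g" where
  "gmul n s = (\<Sum>i<n. s)"

lemma gmul_0 [simp]: "gmul 0 s = 0"
  and gmul_Suc [simp]: "gmul (Suc n) s = gmul n s + s"
  by (simp_all add: gmul_def)

lemma gmul_add: "gmul (m + n) s = gmul m s + gmul n s"
  by (induction n) (simp_all add: add.assoc)

lemma gmul_mult: "gmul (m * n) s = gmul m (gmul n s)"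
  by (induction m) (simp_all add: gmul_add add.commute)

lemma gmul_diff: "gmul n (s - t) = gmul n s - gmul n (t :: 'g::ab_group_add)"
  by (simp add: gmul_def sum_subtractf)

context twisted_group
begin

lemma gmul_D: "s \<in> D \<Longrightarrow> gmul n s \<in> D"
  by (induction n) (simp_all add: D_add)

lemma \<beta>_gmul: "\<beta> (gmul n s) t = \<beta> s t [^] n" "\<beta> t (gmul n s) = \<beta> t s [^] n"
  by (induction n) (simp_all add: \<beta>_add_left \<beta>_add_right)

text \<open>Describes a subgroup of the index group: closure under inverses follows once every class
  is torsion, see \<open>ix_closed_minus\<close>.\<close>

definition ix_closed :: "nat set \<Rightarrow> bool" where
  "ix_closed H \<longleftrightarrow> \<tau> 0 \<in> H \<and> (\<forall>i\<in>H. \<forall>j\<in>H. \<tau> (e i + e j) \<in> H)"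

lemma ix_closed_gmul:
  assumes "ix_closed H" "\<tau> s \<in> H"
  shows "\<tau> (gmul n s) \<in> H"
proof (induction n)
  case (Suc n)
  then have "\<tau> (e (\<tau> (gmul n s)) + e (\<tau> s)) \<in> H"
    using assms unfolding ix_closed_def by blast
  then show ?case
    by simp
qed (use assms in \<open>simp add: ix_closed_def\<close>)

definition supp_in :: "nat set \<Rightarrow> (nat \<Rightarrow> 'a) set" where
  "supp_in H = {f \<in> carrier TW. \<forall>i. f i \<noteq> \<zero> \<longrightarrow> i \<in> H}"

lemma supp_in_subalgebra: "subalgebra scalars (supp_in H) TW"
proof -
  have "subgroup (supp_in H) (add_monoid TW)"
  proof (rule TW.add.subgroupI)
    fix f assume f: "f \<in> supp_in H"
    then show "\<ominus>\<^bsub>TW\<^esub> f \<in> supp_in H"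
      by (auto simp: supp_in_def TW_minus_apply)
    fix g assume g: "g \<in> supp_in H"
    show "f \<oplus>\<^bsub>TW\<^esub> g \<in> supp_in H"
      using f g by (force simp: supp_in_def TW_add_apply)
  next
    have "\<zero>\<^bsub>TW\<^esub> \<in> supp_in H"
      by (simp add: supp_in_def TW_zero_apply)
    then show "supp_in H \<noteq> {}"
      by auto
  qed (auto simp: supp_in_def)
  moreover have "emb a \<otimes>\<^bsub>TW\<^esub> f \<in> supp_in H" if "a \<in> carrier K" "f \<in> supp_in H" for a f
    using that by (auto simp: supp_in_def emb_mult_apply) (metis r_null)
  ultimately show ?thesis
    by (auto simp: subalgebra_def subalgebra_axioms_def)
qed

lemma supp_in_subring:
  assumes "ix_closed H"
  shows "subring (supp_in H) TW"
proof (rule TW.subringI)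
  note sg = subalgebra.axioms(1)[OF supp_in_subalgebra[of H]]
  show "supp_in H \<subseteq> carrier TW"
    by (auto simp: supp_in_def)
  show "\<one>\<^bsub>TW\<^esub> \<in> supp_in H"
    using assms by (auto simp: supp_in_def TW_one tmono_apply ix_closed_def split: if_splits)
  fix f assume f: "f \<in> supp_in H"
  then show "\<ominus>\<^bsub>TW\<^esub> f \<in> supp_in H"
    by (auto simp: supp_in_def TW_minus_apply)
  fix g assume g: "g \<in> supp_in H"
  show "f \<oplus>\<^bsub>TW\<^esub> g \<in> supp_in H"
    using subgroup.m_closed[OF sg f g] by simp
  have fg: "f \<in> carrier TW" "g \<in> carrier TW"
    using f g by (auto simp: supp_in_def)
  have "k \<in> H" if nz: "(f \<otimes>\<^bsub>TW\<^esub> g) k \<noteq> \<zero>" for k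
  proof -
    obtain i j where "f i \<noteq> \<zero>" "g j \<noteq> \<zero>" "k = \<tau> (e i + e j)"
      using TW_mult_support[OF fg nz] by blast
    then show ?thesis
      using f g assms by (auto simp: supp_in_def ix_closed_def)
  qed
  then show "f \<otimes>\<^bsub>TW\<^esub> g \<in> supp_in H"
    using fg by (simp add: supp_in_def)
qed

lemma TW_one_not_zero: "\<one>\<^bsub>TW\<^esub> \<noteq> \<zero>\<^bsub>TW\<^esub>"
  using one_not_zero by (auto simp: TW_one TW_nonzero_iff tmono_apply)

lemma emb_hom_ring: "ring_hom_ring K TW emb"
  by (rule ring_hom_ringI2) (auto intro: ring_axioms TW.ring_axioms emb_ring_hom)

lemma scalars_subfield: "subfield scalars TW"
  using ring_hom_ring.img_is_subfield(2)[OF emb_hom_ring carrier_is_subfield TW_one_not_zero] .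

text \<open>Pairing with \<open>B j\<close> under the trace gives 1 on \<open>A j\<close> and 0 on
  the other members, hence 0 on their span.\<close>

lemma biorth_independent:
  assumes bi: "biorth J A B" and "distinct js" "set js \<subseteq> J"
  shows "TW.independent scalars (map A js)"
  using assms(2,3)
proof (induction js)
  case (Cons j js)
  have V: "subalgebra scalars {x \<in> carrier TW. tr (x \<otimes>\<^bsub>TW\<^esub> B j) = \<zero>} TW"
  proof -
    have Bj [simp]: "B j \<in> carrier TW"
      using Cons.prems biorth_closed[OF bi] by auto
    have "subgroup {x \<in> carrier TW. tr (x \<otimes>\<^bsub>TW\<^esub> B j) = \<zero>} (add_monoid TW)"
    proof (rule TW.add.subgroupI)
      have "\<zero>\<^bsub>TW\<^esub> \<in> {x \<in> carrier TW. tr (x \<otimes>\<^bsub>TW\<^esub> B j) = \<zero>}"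
        by (simp add: tr_zero)
      then show "{x \<in> carrier TW. tr (x \<otimes>\<^bsub>TW\<^esub> B j) = \<zero>} \<noteq> {}"
        by blast
    next
      fix x assume x: "x \<in> {x \<in> carrier TW. tr (x \<otimes>\<^bsub>TW\<^esub> B j) = \<zero>}"
      then have "tr (\<ominus>\<^bsub>TW\<^esub> x \<otimes>\<^bsub>TW\<^esub> B j) = \<ominus> tr (x \<otimes>\<^bsub>TW\<^esub> B j)"
        by (simp add: TW.l_minus tr_def TW_minus_apply)
      with x show "\<ominus>\<^bsub>TW\<^esub> x \<in> {x \<in> carrier TW. tr (x \<otimes>\<^bsub>TW\<^esub> B j) = \<zero>}"
        by simp
    qed (auto simp: TW.l_distr tr_add)
    then show ?thesis
      by (auto simp: subalgebra_def subalgebra_axioms_def tr_mult_emb_mult)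
  qed
  have "set (map A js) \<subseteq> {x \<in> carrier TW. tr (x \<otimes>\<^bsub>TW\<^esub> B j) = \<zero>}"
    using Cons.prems biorth_closed(1)[OF bi] bi by (auto simp: biorth_def)
  then have "TW.Span scalars (map A js) \<subseteq> {x \<in> carrier TW. tr (x \<otimes>\<^bsub>TW\<^esub> B j) = \<zero>}"
    by (rule TW.subalgebra_Span_incl[OF scalars_subfield V])
  moreover have "tr (A j \<otimes>\<^bsub>TW\<^esub> B j) = \<one>"
    using bi Cons.prems by (auto simp: biorth_def)
  ultimately have "A j \<notin> TW.Span scalars (map A js)"
    by auto
  then show ?case
    using Cons biorth_closed(1)[OF bi] by (auto intro!: TW.independent.li_Cons)
qed simp

lemma biorth_dimension:
  assumes bi: "biorth J A B" and V: "subalgebra scalars V TW" "A ` J \<subseteq> V"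
    and ex: "\<And>z. z \<in> V \<Longrightarrow> proj J A B z = z"
  shows "TW.dimension (card J) scalars V"
proof -
  have fin: "finite J"
    using bi by (simp add: biorth_def)
  let ?us = "map A (sorted_list_of_set J)"
  have us: "set ?us = A ` J" "length ?us = card J"
    using fin by auto
  have usc: "set ?us \<subseteq> carrier TW"
    using us biorth_closed(1)[OF bi] by auto
  have "TW.independent scalars ?us"
    using fin by (intro biorth_independent[OF bi]) auto
  then have "TW.dimension (card J) scalars (TW.Span scalars ?us)"
    using TW.dimension_independent us(2) by metis
  moreover have "TW.Span scalars ?us = V"
  proof
    show "TW.Span scalars ?us \<subseteq> V"
      using V us(1) by (intro TW.subalgebra_Span_incl[OF scalars_subfield]) auto
    show "V \<subseteq> TW.Span scalars ?us"
    proof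
      fix z assume z: "z \<in> V"
      have "A ` J \<subseteq> TW.Span scalars ?us"
        using TW.Span_base_incl[OF scalars_subfield usc] us(1) by simp
      then have "proj J A B z \<in> TW.Span scalars ?us"
        using z TW.subalgebra_in_carrier[OF V(1)] TW.Span_is_subalgebra[OF scalars_subfield usc]
        by (intro proj_in_subalgebra[OF bi]) auto
      then show "z \<in> TW.Span scalars ?us"
        using ex z by simp
    qed
  qed
  ultimately show ?thesis
    by simp
qed

lemma finite_dimension_supp:
  assumes "TW.finite_dimension scalars V"
  obtains I where "finite I" "V \<subseteq> supp_in I"
proof -
  obtain n where n: "TW.dimension n scalars V"
    using assms by (auto simp: TW.finite_dimension_def)
  obtain us where us: "set us \<subseteq> carrier TW" "TW.Span scalars us = V"
    using TW.exists_base[OF scalars_subfield n] by blast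
  define I where "I = (\<Union>u\<in>set us. {i. u i \<noteq> \<zero>})"
  have "finite I"
    unfolding I_def using us(1) by auto
  moreover have "set us \<subseteq> supp_in I"
    using us(1) by (auto simp: supp_in_def I_def)
  then have "V \<subseteq> supp_in I"
    using TW.subalgebra_Span_incl[OF scalars_subfield supp_in_subalgebra] us(2) by blast
  ultimately show ?thesis
    by (rule that)
qed

lemma tmono_mult_unit:
  "\<lbrakk>a \<in> carrier K\<rbrakk> \<Longrightarrow> tmono a i = emb a \<otimes>\<^bsub>TW\<^esub> tmono \<one> i"
  by (simp add: emb_def tmono_mult_tmono)

lemma countable_dimension_TW: "countable_dimension scalars TW"
proof -
  let ?B = "range (tmono \<one>)"
  have sub: "?B \<subseteq> carrier TW"
    by auto
  have inj: "inj (tmono \<one>)"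
    using one_not_zero by (auto simp: inj_on_def fun_eq_iff tmono_apply split: if_splits)
  have ind: "TW.independent scalars us" if "distinct us" "set us \<subseteq> ?B" for us
    using that
  proof (induction us)
    case (Cons u us)
    then obtain i where u: "u = tmono \<one> i"
      by auto
    \<comment> \<open>The elements without the index \<open>i\<close> form a subspace that contains
      the other monomials but not \<open>u\<close>.\<close>
    have "set us \<subseteq> supp_in (- {i})"
    proof
      fix f assume f: "f \<in> set us"
      then obtain k where k: "f = tmono \<one> k"
        using Cons.prems by auto
      then have "k \<noteq> i"
        using f u Cons.prems by auto
      then show "f \<in> supp_in (- {i})"
        by (simp add: k supp_in_def tmono_apply)
    qed
    then have "TW.Span scalars us \<subseteq> supp_in (- {i})"
      by (rule TW.subalgebra_Span_incl[OF scalars_subfield supp_in_subalgebra])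
    moreover have "u \<notin> supp_in (- {i})"
      using one_not_zero by (auto simp: u supp_in_def tmono_apply)
    ultimately have "u \<notin> TW.Span scalars us"
      by blast
    then show ?case
      using Cons u by (auto intro!: TW.independent.li_Cons)
  qed simp
  have "\<exists>us. set us \<subseteq> ?B \<and> f \<in> TW.Span scalars us" if "f \<in> carrier TW" for f
    using that
  proof (induction f rule: TW_induct)
    case zero
    have "\<zero>\<^bsub>TW\<^esub> \<in> TW.Span scalars []"
      by simp
    then show ?case
      by (metis empty_set empty_subsetI)
  next
    case (tmono_add a i f)
    then obtain us where us: "set us \<subseteq> ?B" "f \<in> TW.Span scalars us"
      by auto
    have us': "set (tmono \<one> i # us) \<subseteq> ?B" "set (tmono \<one> i # us) \<subseteq> carrier TW"
      using us(1) by auto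
    have "f \<in> TW.Span scalars (tmono \<one> i # us)"
      using TW.mono_Span_sublist[OF scalars_subfield, of us "tmono \<one> i # us"] us(2) us'(2) by auto
    moreover have "tmono a i \<in> TW.Span scalars (tmono \<one> i # us)"
    proof -
      have "tmono \<one> i \<in> TW.Span scalars (tmono \<one> i # us)"
        using TW.Span_base_incl[OF scalars_subfield us'(2)] by auto
      then show ?thesis
        using TW.Span_smult_closed[OF scalars_subfield us'(2), of "emb a"] tmono_add(1)
        by (simp add: tmono_mult_unit[of a] del: TW.Span.simps)
    qed
    ultimately have "tmono a i \<oplus>\<^bsub>TW\<^esub> f \<in> TW.Span scalars (tmono \<one> i # us)"
      using TW.Span_subgroup_props(3)[OF scalars_subfield us'(2)] by blast
    then show ?case
      using us'(1) by blast
  qed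
  then have "linear_basis scalars TW ?B"
    using sub ind by (simp add: linear_basis_def)
  moreover have "countable ?B" "infinite ?B"
    using inj range_inj_infinite by auto
  ultimately show ?thesis
    unfolding countable_dimension_def by blast
qed

end

section \<open>Leading classes of a subalgebra\<close>

context valued_twisted_group
begin

definition lead_classes :: "(nat \<Rightarrow> 'a) set \<Rightarrow> nat set" where
  "lead_classes V = {\<tau> (w f) | f. f \<in> V \<and> f \<noteq> \<zero>\<^bsub>TW\<^esub>}"

lemma lead_classes_supp_in: "V \<subseteq> supp_in I \<Longrightarrow> lead_classes V \<subseteq> I"
  using w_lead(1) by (force simp: lead_classes_def supp_in_def)

text \<open>Multiplication by \<open>\<chi> (s - w f)\<close> shifts the value of \<open>f\<close>
  inside its coset of \<open>D\<close> onto \<open>s\<close>.\<close>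

lemma lead_classes_rep:
  assumes V: "subalgebra scalars V TW" and s: "\<tau> s \<in> lead_classes V"
  shows "\<exists>f\<in>V. f \<noteq> \<zero>\<^bsub>TW\<^esub> \<and> w f = s"
proof -
  obtain f where f: "f \<in> V" "f \<noteq> \<zero>\<^bsub>TW\<^esub>" "\<tau> s = \<tau> (w f)"
    using s by (auto simp: lead_classes_def)
  have fc: "f \<in> carrier TW"
    using f(1) TW.subalgebra_in_carrier[OF V] by auto
  have D: "s - w f \<in> D"
    using f(3) by (simp add: \<tau>_eq_iff)
  have "emb (\<chi> (s - w f)) \<otimes>\<^bsub>TW\<^esub> f \<in> V"
    using D f(1) by (intro subalgebra.smult_closed[OF V]) auto
  moreover have "emb (\<chi> (s - w f)) \<otimes>\<^bsub>TW\<^esub> f \<noteq> \<zero>\<^bsub>TW\<^esub>" "w (emb (\<chi> (s - w f)) \<otimes>\<^bsub>TW\<^esub> f) = s"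
    using w_emb_mult[OF \<chi>_carrier[OF D] \<chi>_nz[OF D] fc f(2)] by (auto simp: v_\<chi>[OF D])
  ultimately show ?thesis
    by blast
qed

lemma lead_classes_closed:
  assumes V: "unital_subalgebra scalars V TW"
  shows "ix_closed (lead_classes V)"
  unfolding ix_closed_def
proof (intro conjI ballI)
  have V': "subring V TW"
    using V by (simp add: unital_subalgebra_def)
  have "w \<one>\<^bsub>TW\<^esub> = 0"
    using w_tmono(2)[of \<one> "\<tau> 0"] by (simp add: TW_one)
  then show "\<tau> 0 \<in> lead_classes V"
    using subringE(3)[OF V'] TW_one_not_zero by (auto simp: lead_classes_def intro!: exI[of _ "\<one>\<^bsub>TW\<^esub>"])
  fix i j assume "i \<in> lead_classes V" "j \<in> lead_classes V"
  then obtain f g where fg: "f \<in> V" "f \<noteq> \<zero>\<^bsub>TW\<^esub>" "i = \<tau> (w f)" "g \<in> V" "g \<noteq> \<zero>\<^bsub>TW\<^esub>" "j = \<tau> (w g)"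
    by (auto simp: lead_classes_def)
  then have "f \<in> carrier TW" "g \<in> carrier TW"
    using subringE(1)[OF V'] by auto
  then have "f \<otimes>\<^bsub>TW\<^esub> g \<noteq> \<zero>\<^bsub>TW\<^esub>" "w (f \<otimes>\<^bsub>TW\<^esub> g) = w f + w g"
    using w_mult fg by auto
  then show "\<tau> (e i + e j) \<in> lead_classes V"
    using subringE(6)[OF V' fg(1,4)] fg(3,6) by (auto simp: lead_classes_def intro!: exI[of _ "f \<otimes>\<^bsub>TW\<^esub> g"])
qed

end

text \<open>Two opposing conditions on the commutator pairing: \<open>nondegenerate\<close> makes
  the centre of the whole algebra trivial, while by \<open>exponent\<close> the pairing loses one
  power of \<open>p\<close> on torsion of exponent \<open>p^(m+1)\<close> and so degenerates on
  every nontrivial finite subgroup. \<open>v_p\<close> keeps the order of such a subgroup, read as a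
  scalar, at value 0.\<close>

locale p_twisted_group = valued_twisted_group K e \<tau> D \<chi> \<beta> v
  for K (structure) and e :: "nat \<Rightarrow> 'g::linordered_ab_group_add" and \<tau> D \<chi> \<beta> v +
  fixes p :: nat
  assumes p_prime: "Factorial_Ring.prime p"
    and torsion: "\<exists>m. gmul (p ^ m) s \<in> D"
    and p_not_zero: "[p] \<cdot>\<^bsub>K\<^esub> \<one> \<noteq> \<zero>"
    and v_p: "v ([p] \<cdot>\<^bsub>K\<^esub> \<one>) = 0"
    and nondegenerate: "s \<notin> D \<Longrightarrow> \<exists>t. \<beta> s t \<noteq> \<beta> t s"
    and exponent: "\<lbrakk>gmul (p ^ Suc m) s \<in> D; gmul (p ^ Suc m) t \<in> D\<rbrakk>
      \<Longrightarrow> \<beta> s t [^] (p ^ m) = \<beta> t s [^] (p ^ m)"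
begin

text \<open>Modulo \<open>D\<close> the inverse of \<open>s\<close> is the multiple of
  \<open>s\<close> by \<open>p^m - 1\<close>.\<close>

lemma ix_closed_minus:
  assumes "ix_closed H" "\<tau> s \<in> H"
  shows "\<tau> (- s) \<in> H"
proof -
  obtain m where m: "gmul (p ^ m) s \<in> D"
    using torsion by blast
  have "p ^ m > 0"
    using p_prime prime_gt_0_nat by simp
  then have "gmul (p ^ m) s = gmul (p ^ m - 1) s + s"
    using gmul_Suc[of "p ^ m - 1" s] by simp
  then have "\<tau> (gmul (p ^ m - 1) s) = \<tau> (- s)"
    using m by (simp add: \<tau>_eq_iff)
  then show ?thesis
    using ix_closed_gmul[OF assms] by metis
qed

text \<open>Generators are adjoined one by one; each is torsion modulo \<open>D\<close>, so finitely
  many of its multiples suffice.\<close>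

lemma finite_ix_closed:
  assumes "finite I"
  shows "\<exists>H. finite H \<and> I \<subseteq> H \<and> ix_closed H"
  using assms
proof (induction I)
  case empty
  then show ?case
    by (intro exI[of _ "{\<tau> 0}"]) (auto simp: ix_closed_def)
next
  case (insert i I)
  then obtain H where H: "finite H" "I \<subseteq> H" "ix_closed H"
    by blast
  obtain m where m: "gmul (p ^ m) (e i) \<in> D"
    using torsion by blast
  have pos: "p ^ m > 0"
    using p_prime prime_gt_0_nat by simp
  let ?f = "\<lambda>(h, k). \<tau> (e h + gmul k (e i))"
  let ?H = "?f ` (H \<times> {..<p ^ m})"
  have reduce: "\<tau> (e h + gmul k (e i)) \<in> ?H" if h: "h \<in> H" for h k
  proof -
    have "gmul k (e i) = gmul (k div p ^ m) (gmul (p ^ m) (e i)) + gmul (k mod p ^ m) (e i)"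
      by (metis div_mult_mod_eq gmul_add gmul_mult)
    then have "\<tau> (e h + gmul k (e i)) = \<tau> (e h + gmul (k mod p ^ m) (e i))"
      using gmul_D[OF m] by (simp add: \<tau>_eq_iff)
    then show ?thesis
      using h pos by (intro image_eqI[of _ _ "(h, k mod p ^ m)"]) auto
  qed
  have "ix_closed ?H"
    unfolding ix_closed_def
  proof (intro conjI ballI)
    show "\<tau> 0 \<in> ?H"
      using reduce[of "\<tau> 0" 0] H(3) by (simp add: ix_closed_def)
    fix a b assume "a \<in> ?H" "b \<in> ?H"
    then obtain h k h' k' where ab: "h \<in> H" "h' \<in> H" "a = \<tau> (e h + gmul k (e i))" "b = \<tau> (e h' + gmul k' (e i))"
      by auto
    have "\<tau> (e a + e b) = \<tau> (e h + gmul k (e i) + (e h' + gmul k' (e i)))"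
      using ab by simp
    also have "\<dots> = \<tau> ((e h + e h') + gmul (k + k') (e i))"
      by (simp add: gmul_add algebra_simps)
    also have "\<dots> = \<tau> (e (\<tau> (e h + e h')) + gmul (k + k') (e i))"
      by simp
    also have "\<dots> \<in> ?H"
      using ab H(3) by (intro reduce) (auto simp: ix_closed_def)
    finally show "\<tau> (e a + e b) \<in> ?H" .
  qed
  moreover have "insert i I \<subseteq> ?H"
  proof
    fix j assume j: "j \<in> insert i I"
    show "j \<in> ?H"
    proof (cases "j = i")
      case True
      have "\<tau> (e (\<tau> 0) + gmul 1 (e i)) \<in> ?H"
        using H(3) by (intro reduce) (simp add: ix_closed_def)
      moreover have "\<tau> (e (\<tau> 0) + gmul 1 (e i)) = j"
        by (simp add: True)
      ultimately show ?thesis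
        by (simp only:)
    next
      case False
      have "\<tau> (e j + gmul 0 (e i)) \<in> ?H"
        using False j H(2) by (intro reduce) blast
      moreover have "\<tau> (e j + gmul 0 (e i)) = j"
        by simp
      ultimately show ?thesis
        by (simp only:)
    qed
  qed
  moreover have "finite ?H"
    using H(1) by (intro finite_imageI finite_cartesian_product) simp_all
  ultimately show ?case
    by (intro exI[of _ ?H] conjI)
qed

text \<open>Every element has \<open>p\<close>-power order, whereas another prime \<open>q\<close>
  dividing the cardinality would give a subgroup of order \<open>q\<close> by Sylow's theorem with
  exponent 1, and with it an element of order \<open>q\<close>.\<close>

lemma card_ix_closed:
  assumes H: "finite H" "ix_closed H"
  shows "\<exists>m. card H = p ^ m"
proof -
  define G where "G = \<lparr>carrier = H, monoid.mult = (\<lambda>i j. \<tau> (e i + e j)), monoid.one = \<tau> 0\<rparr>"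
  have G: "group G"
  proof (rule groupI)
    fix i assume i: "i \<in> carrier G"
    then have "\<tau> (- e i) \<in> carrier G"
      using ix_closed_minus[OF H(2), of "e i"] by (simp add: G_def)
    then show "\<exists>j\<in>carrier G. j \<otimes>\<^bsub>G\<^esub> i = \<one>\<^bsub>G\<^esub>"
      by (rule bexI[rotated]) (simp add: G_def)
  qed (use H in \<open>auto simp: G_def ix_closed_def add.assoc\<close>)
  interpret G: group G
    by (rule G)
  have pow: "i [^]\<^bsub>G\<^esub> n = \<tau> (gmul n (e i))" if "i \<in> H" for i and n :: nat
    by (induction n) (simp_all add: G_def)
  have "card H > 0"
    using H by (auto simp: card_gt_0_iff ix_closed_def)
  then obtain a b where ab: "card H = p ^ a * b" "\<not> p dvd b"
    using multiplicity_decompose'[of "card H" p] p_prime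
    by (metis mult.commute not_prime_unit nat_neq_iff)
  have "b = 1"
  proof (rule ccontr)
    assume "b \<noteq> 1"
    then obtain q where q: "Factorial_Ring.prime q" "q dvd b"
      using prime_factor_nat by blast
    then obtain c where c: "b = q * c"
      by auto
    have "order G = q ^ 1 * (p ^ a * c)"
      using ab(1) c by (simp add: order_def G_def)
    then obtain S where S: "subgroup S G" "card S = q ^ 1"
      using sylow_thm[OF q(1) G, of 1] H(1) by (auto simp: G_def)
    then have "card S > 1"
      using q(1) prime_gt_1_nat by simp
    then obtain i where i: "i \<in> S" "i \<noteq> \<one>\<^bsub>G\<^esub>"
      using subgroup.one_closed[OF S(1)]
      by (metis One_nat_def card_1_singleton_iff is_singletonI' is_singleton_altdef less_irrefl empty_iff)
    have iH: "i \<in> carrier G"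
      using subgroup.mem_carrier[OF S(1) i(1)] .
    have "group.ord (G\<lparr>carrier := S\<rparr>) i dvd order (G\<lparr>carrier := S\<rparr>)"
      using i(1) by (intro group.ord_dvd_group_order subgroup.subgroup_is_group[OF S(1) G]) simp
    then have "i [^]\<^bsub>G\<^esub> q = \<one>\<^bsub>G\<^esub>"
      using group.pow_order_eq_1[OF subgroup.subgroup_is_group[OF S(1) G], of i] i(1) S(2)
      by (simp add: order_def G.nat_pow_consistent[symmetric])
    then have 1: "G.ord i dvd q"
      using G.pow_eq_id[OF iH] by blast
    obtain m where "gmul (p ^ m) (e i) \<in> D"
      using torsion by blast
    then have "i [^]\<^bsub>G\<^esub> (p ^ m) = \<one>\<^bsub>G\<^esub>"
      using pow[of i "p ^ m"] iH by (simp add: G_def \<tau>_eq_iff)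
    then have "G.ord i dvd p ^ m"
      using G.pow_eq_id[OF iH] by blast
    moreover have "coprime q (p ^ m)"
      using q p_prime ab(2) primes_coprime[OF q(1) p_prime] by auto
    ultimately have "G.ord i = 1"
      using 1 by (meson coprime_def nat_dvd_1_iff_1 dvd_trans)
    then show False
      using i(2) G.ord_eq_1[OF iH] by simp
  qed
  then show ?thesis
    using ab(1) by auto
qed

text \<open>The classes of \<open>V\<close> form a subgroup, so both families can be found inside
  \<open>V\<close>. The residue of an expansion again lies in \<open>V\<close>, its class occurs in
  the family, and \<open>sub_proj_class\<close> forces it to vanish.\<close>

lemma subalgebra_biorth:
  assumes V: "unital_subalgebra scalars V TW" and I: "finite I" "V \<subseteq> supp_in I"
  obtains A B where "biorth (lead_classes V) A B" "normed (lead_classes V) A B"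
    "A ` lead_classes V \<subseteq> V" "B ` lead_classes V \<subseteq> V" "\<And>j. j \<in> lead_classes V \<Longrightarrow> w (A j) = e j"
    "\<And>z. z \<in> V \<Longrightarrow> proj (lead_classes V) A B z = z" "\<And>z. z \<in> V \<Longrightarrow> proj (lead_classes V) B A z = z"
proof -
  let ?J = "lead_classes V"
  have Vs: "subalgebra scalars V TW"
    using V by (simp add: unital_subalgebra_def)
  have Vc: "V \<subseteq> carrier TW"
    by (rule TW.subalgebra_in_carrier[OF Vs])
  have fin: "finite ?J"
    using lead_classes_supp_in[OF I(2)] I(1) finite_subset by blast
  have "\<exists>b\<in>V. b \<noteq> \<zero>\<^bsub>TW\<^esub> \<and> w b = - e j" if "j \<in> ?J" for j
    using that ix_closed_minus[OF lead_classes_closed[OF V], of "e j"] by (intro lead_classes_rep[OF Vs]) simp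
  moreover have "\<exists>a\<in>V. a \<noteq> \<zero>\<^bsub>TW\<^esub> \<and> w a = e j" if "j \<in> ?J" for j
    using that by (intro lead_classes_rep[OF Vs]) simp
  ultimately obtain A B where AB: "biorth ?J A B" "normed ?J A B" "A ` ?J \<subseteq> V" "B ` ?J \<subseteq> V"
    "\<forall>j\<in>?J. w (A j) = e j"
    using biorth_exists[OF fin Vs Vs] by blast
  \<comment> \<open>Stated for a general pair, because it is applied to \<open>A\<close> and
    \<open>B\<close> in both orders.\<close>
  have *: "proj ?J A' B' z = z" if bi: "biorth ?J A' B'" and no: "normed ?J A' B'" and A': "A' ` ?J \<subseteq> V"
    and cl: "\<And>i. i \<in> ?J \<Longrightarrow> \<exists>j\<in>?J. e i - w (A' j) \<in> D" and z: "z \<in> V" for A' B' z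
  proof (rule ccontr)
    assume ne: "proj ?J A' B' z \<noteq> z"
    have zc: "z \<in> carrier TW"
      using z Vc by auto
    let ?z = "z \<ominus>\<^bsub>TW\<^esub> proj ?J A' B' z"
    have zV: "?z \<in> V"
      using z zc A' by (intro TW.subalgebra_diff[OF Vs] proj_in_subalgebra[OF bi Vs]) auto
    have nz: "?z \<noteq> \<zero>\<^bsub>TW\<^esub>"
      using ne zc bi by (metis TW.r_right_minus_eq proj_closed)
    then have "\<tau> (w ?z) \<in> ?J"
      using zV by (auto simp: lead_classes_def)
    then obtain j where j: "j \<in> ?J" "e (\<tau> (w ?z)) - w (A' j) \<in> D"
      using cl by blast
    have "w ?z - w (A' j) \<in> D"
      using D_add[OF e_\<tau>(2)[of "w ?z"] j(2)] by simp
    then show False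
      using sub_proj_class[OF bi no j(1) zc nz] by simp
  qed
  show ?thesis
  proof (rule that[OF AB(1-4)])
    show "w (A j) = e j" if "j \<in> ?J" for j
      using AB(5) that by simp
    show "proj ?J A B z = z" if "z \<in> V" for z
    proof (rule *[OF AB(1-3) _ that])
      show "\<exists>j\<in>?J. e i - w (A j) \<in> D" if "i \<in> ?J" for i
        using AB(5) that by (intro bexI[of _ i]) simp_all
    qed
    show "proj ?J B A z = z" if "z \<in> V" for z
    proof (rule *[OF biorth_sym[OF AB(1)] normed_sym[OF AB(2)] AB(4) _ that])
      fix i assume i: "i \<in> ?J"
      \<comment> \<open>Since \<open>w (B j) = - e j\<close>, the class \<open>i\<close> is
        represented in the family \<open>B\<close> at the inverse index.\<close>
      have j: "\<tau> (- e i) \<in> ?J"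
        using i ix_closed_minus[OF lead_classes_closed[OF V], of "e i"] by simp
      have "w (B (\<tau> (- e i))) = - e (\<tau> (- e i))"
        using AB(2,5) j by (simp add: normed_def)
      then have "e i - w (B (\<tau> (- e i))) \<in> D"
        using e_\<tau>(1)[of "- e i"] by (simp add: algebra_simps)
      then show "\<exists>j\<in>?J. e i - w (B j) \<in> D"
        using j by blast
    qed
  qed
qed

lemma subalgebra_dimension:
  assumes "unital_subalgebra scalars V TW" "finite I" "V \<subseteq> supp_in I"
  shows "TW.dimension (card (lead_classes V)) scalars V"
proof -
  have "subalgebra scalars V TW"
    using assms(1) by (simp add: unital_subalgebra_def)
  then show ?thesis
    using subalgebra_biorth[OF assms] biorth_dimension by metis
qed

lemma dimension_p_power:
  assumes V: "unital_subalgebra scalars V TW" and n: "TW.dimension n scalars V"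
  shows "\<exists>m. n = p ^ m"
proof -
  obtain I where I: "finite I" "V \<subseteq> supp_in I"
    using finite_dimension_supp[OF TW.finite_dimensionI[OF n]] by blast
  have "n = card (lead_classes V)"
    using TW.dimension_is_inj[OF scalars_subfield n subalgebra_dimension[OF V I]] .
  moreover have "finite (lead_classes V)"
    using lead_classes_supp_in[OF I(2)] I(1) finite_subset by blast
  ultimately show ?thesis
    using card_ix_closed[OF _ lead_classes_closed[OF V]] by blast
qed

text \<open>The finitely many supports lie in a finite subgroup \<open>H\<close>. The generated ring
  is then a unital subalgebra supported in \<open>H\<close>, and its dimension is the number of its
  leading classes.\<close>

lemma LFD_TW: "LFD scalars TW"
  unfolding LFD_def
proof (intro allI impI)
  fix F assume F: "finite F \<and> F \<subseteq> carrier TW"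
  define I where "I = (\<Union>f\<in>F. {i. f i \<noteq> \<zero>})"
  have "finite I"
    using F by (auto simp: I_def)
  then obtain H where H: "finite H" "I \<subseteq> H" "ix_closed H"
    using finite_ix_closed by blast
  have c: "scalars \<union> F \<subseteq> carrier TW"
    using F by auto
  have "scalars \<union> F \<subseteq> supp_in H"
    using F H by (auto simp: supp_in_def I_def emb_apply ix_closed_def split: if_splits)
  then have sub: "generate_ring TW (scalars \<union> F) \<subseteq> supp_in H"
    using TW.generate_ring_min_subring1[OF c supp_in_subring[OF H(3)]] by blast
  have sr: "subring (generate_ring TW (scalars \<union> F)) TW"
    by (rule TW.generate_ring_is_subring[OF c])
  moreover have "subalgebra scalars (generate_ring TW (scalars \<union> F)) TW"
    using subring.axioms(1)[OF sr] subringE(6)[OF sr] generate_ring.incl[of _ "scalars \<union> F" TW]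
    unfolding subalgebra_def subalgebra_axioms_def by blast
  ultimately have "unital_subalgebra scalars (generate_ring TW (scalars \<union> F)) TW"
    by (simp add: unital_subalgebra_def)
  then show "TW.finite_dimension scalars (generate_ring TW (scalars \<union> F))"
    using subalgebra_dimension[OF _ H(1) sub] TW.finite_dimensionI by blast
qed

text \<open>Let \<open>H\<close> be a finite subgroup that contains the support of \<open>x\<close>
  and \<open>V = supp_in H\<close>. Multiplicativity of \<open>w\<close> shows that
  \<open>x V\<close> meets every class of \<open>H\<close>, just as \<open>V\<close> does.
  Gram-Schmidt with \<open>A\<close> in \<open>x V\<close> and \<open>B\<close> in \<open>V\<close>
  then leaves no residue of the unit, so the unit lies in \<open>x V\<close>.\<close>

lemma right_inverse:
  assumes x: "x \<in> carrier TW" "x \<noteq> \<zero>\<^bsub>TW\<^esub>"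
  shows "\<exists>y\<in>carrier TW. x \<otimes>\<^bsub>TW\<^esub> y = \<one>\<^bsub>TW\<^esub>"
proof -
  obtain H where H: "finite H" "{i. x i \<noteq> \<zero>} \<subseteq> H" "ix_closed H"
    using finite_ix_closed[of "{i. x i \<noteq> \<zero>}"] x by auto
  let ?V = "supp_in H" and ?W = "(\<lambda>y. x \<otimes>\<^bsub>TW\<^esub> y) ` supp_in H"
  note V = supp_in_subalgebra[of H] and Vr = supp_in_subring[OF H(3)]
  have xV: "x \<in> ?V"
    using x H by (auto simp: supp_in_def)
  have Vc: "?V \<subseteq> carrier TW"
    by (rule TW.subalgebra_in_carrier[OF V])
  have W: "subalgebra scalars ?W TW"
  proof -
    have "subgroup ?W (add_monoid TW)"
    proof (rule TW.add.subgroupI)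
      show "?W \<noteq> {}"
        using xV by auto
      show "?W \<subseteq> carrier TW"
        using Vc x by auto
    next
      fix a assume "a \<in> ?W"
      then obtain y where "y \<in> ?V" "a = x \<otimes>\<^bsub>TW\<^esub> y"
        by auto
      then show "\<ominus>\<^bsub>TW\<^esub> a \<in> ?W"
        using subringE(5)[OF Vr] Vc x by (intro image_eqI[of _ _ "\<ominus>\<^bsub>TW\<^esub> y"]) (auto simp: TW.r_minus)
    next
      fix a b assume "a \<in> ?W" "b \<in> ?W"
      then obtain y z where yz: "y \<in> ?V" "a = x \<otimes>\<^bsub>TW\<^esub> y" "z \<in> ?V" "b = x \<otimes>\<^bsub>TW\<^esub> z"
        by auto
      then have "a \<oplus>\<^bsub>TW\<^esub> b = x \<otimes>\<^bsub>TW\<^esub> (y \<oplus>\<^bsub>TW\<^esub> z)"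
        using TW.r_distr[of y z x] subsetD[OF Vc] x by simp
      then show "a \<oplus>\<^bsub>TW\<^esub> b \<in> ?W"
        using subringE(7)[OF Vr yz(1,3)] by (rule image_eqI)
    qed
    moreover have "k \<otimes>\<^bsub>TW\<^esub> a \<in> ?W" if ka: "k \<in> scalars" "a \<in> ?W" for k a
    proof -
      obtain c y where cy: "k = emb c" "c \<in> carrier K" "y \<in> ?V" "a = x \<otimes>\<^bsub>TW\<^esub> y"
        using ka by auto
      have "k \<otimes>\<^bsub>TW\<^esub> a = x \<otimes>\<^bsub>TW\<^esub> (k \<otimes>\<^bsub>TW\<^esub> y)"
        using cy x Vc emb_comm[of c x] by (simp add: TW.m_assoc[symmetric] subset_iff)
      moreover have "k \<otimes>\<^bsub>TW\<^esub> y \<in> ?V"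
        using cy by (intro subalgebra.smult_closed[OF V]) auto
      ultimately show ?thesis
        by blast
    qed
    ultimately show ?thesis
      by (auto simp: subalgebra_def subalgebra_axioms_def)
  qed
  have "\<exists>a\<in>?W. a \<noteq> \<zero>\<^bsub>TW\<^esub> \<and> w a = e j" if j: "j \<in> H" for j
  proof -
    \<comment> \<open>The monomial is to have value exactly \<open>e j - w x\<close>:
      \<open>?i\<close> is the class of that value and \<open>\<chi> ?d\<close> corrects for the
      representative.\<close>
    let ?i = "\<tau> (e j - w x)"
    let ?d = "e j - w x - e ?i"
    have D: "?d \<in> D"
      by (rule e_\<tau>(2))
    have "\<tau> (w x) \<in> H"
      using H(2) w_lead(1)[OF x] by auto
    then have "\<tau> (- w x) \<in> H"
      using ix_closed_minus[OF H(3)] by simp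
    then have "\<tau> (e j + e (\<tau> (- w x))) \<in> H"
      using j H(3) by (simp only: ix_closed_def)
    then have i: "?i \<in> H"
      by simp
    then have mV: "tmono (\<chi> ?d) ?i \<in> ?V"
      using D by (auto simp: supp_in_def tmono_apply split: if_splits)
    have m: "tmono (\<chi> ?d) ?i \<noteq> \<zero>\<^bsub>TW\<^esub>" "w (tmono (\<chi> ?d) ?i) = e j - w x"
      using w_tmono[OF \<chi>_carrier[OF D] \<chi>_nz[OF D], of ?i] by (auto simp: v_\<chi>[OF D])
    show ?thesis
    proof (intro bexI conjI)
      show "x \<otimes>\<^bsub>TW\<^esub> tmono (\<chi> ?d) ?i \<noteq> \<zero>\<^bsub>TW\<^esub>" "w (x \<otimes>\<^bsub>TW\<^esub> tmono (\<chi> ?d) ?i) = e j"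
        using w_mult[OF x subsetD[OF Vc mV] m(1)] m(2) by auto
      show "x \<otimes>\<^bsub>TW\<^esub> tmono (\<chi> ?d) ?i \<in> ?W"
        using mV by blast
    qed
  qed
  moreover have "\<exists>b\<in>?V. b \<noteq> \<zero>\<^bsub>TW\<^esub> \<and> w b = - e j" if j: "j \<in> H" for j
  proof -
    let ?i = "\<tau> (- e j)"
    let ?d = "- e j - e ?i"
    have D: "?d \<in> D"
      by (rule e_\<tau>(2))
    have "?i \<in> H"
      using ix_closed_minus[OF H(3), of "e j"] j by simp
    then have "tmono (\<chi> ?d) ?i \<in> ?V"
      using D by (auto simp: supp_in_def tmono_apply split: if_splits)
    moreover have "tmono (\<chi> ?d) ?i \<noteq> \<zero>\<^bsub>TW\<^esub>" "w (tmono (\<chi> ?d) ?i) = - e j"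
      using w_tmono[OF \<chi>_carrier[OF D] \<chi>_nz[OF D], of ?i] by (auto simp: v_\<chi>[OF D])
    ultimately show ?thesis
      by blast
  qed
  ultimately obtain A B where AB: "biorth H A B" "normed H A B" "A ` H \<subseteq> ?W" "B ` H \<subseteq> ?V"
    "\<forall>j\<in>H. w (A j) = e j"
    using biorth_exists[OF H(1) W V] by blast
  have one: "\<one>\<^bsub>TW\<^esub> \<in> ?V"
    by (rule subringE(3)[OF Vr])
  have "?W \<subseteq> ?V"
    using subringE(6)[OF Vr xV] by auto
  let ?z = "\<one>\<^bsub>TW\<^esub> \<ominus>\<^bsub>TW\<^esub> proj H A B \<one>\<^bsub>TW\<^esub>"
  have zV: "?z \<in> ?V"
    using AB(1,3) \<open>?W \<subseteq> ?V\<close> one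
    by (intro TW.subalgebra_diff[OF V] proj_in_subalgebra[OF AB(1) V]) auto
  have "?z = \<zero>\<^bsub>TW\<^esub>"
  proof (rule ccontr)
    assume nz: "?z \<noteq> \<zero>\<^bsub>TW\<^esub>"
    then have j: "\<tau> (w ?z) \<in> H"
      using zV w_lead(1)[OF subsetD[OF Vc zV] nz] by (auto simp: supp_in_def)
    have "w ?z - w (A (\<tau> (w ?z))) \<in> D"
      using AB(5) j e_\<tau>(2)[of "w ?z"] by simp
    then show False
      using sub_proj_class[OF AB(1,2) j _ nz] by simp
  qed
  then have "proj H A B \<one>\<^bsub>TW\<^esub> = \<one>\<^bsub>TW\<^esub>"
    using AB(1) by (metis TW.one_closed TW.r_right_minus_eq proj_closed)
  moreover have "proj H A B \<one>\<^bsub>TW\<^esub> \<in> ?W"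
    using AB by (intro proj_in_subalgebra[OF AB(1) W]) auto
  ultimately show ?thesis
    using Vc by force
qed

lemma skew_field_TW: "skew_field TW"
proof
  show "\<one>\<^bsub>TW\<^esub> \<noteq> \<zero>\<^bsub>TW\<^esub>"
    by (rule TW_one_not_zero)
  show "Units TW = carrier TW - {\<zero>\<^bsub>TW\<^esub>}"
  proof
    show "Units TW \<subseteq> carrier TW - {\<zero>\<^bsub>TW\<^esub>}"
      using TW_one_not_zero by (auto simp: Units_def)
    show "carrier TW - {\<zero>\<^bsub>TW\<^esub>} \<subseteq> Units TW"
    proof
      fix x assume x: "x \<in> carrier TW - {\<zero>\<^bsub>TW\<^esub>}"
      then obtain y where y: "y \<in> carrier TW" "x \<otimes>\<^bsub>TW\<^esub> y = \<one>\<^bsub>TW\<^esub>"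
        using right_inverse by blast
      then have "y \<noteq> \<zero>\<^bsub>TW\<^esub>"
        using x TW_one_not_zero by auto
      then obtain z where z: "z \<in> carrier TW" "y \<otimes>\<^bsub>TW\<^esub> z = \<one>\<^bsub>TW\<^esub>"
        using right_inverse y by blast
      have "z = x \<otimes>\<^bsub>TW\<^esub> y \<otimes>\<^bsub>TW\<^esub> z"
        using y z by simp
      also have "\<dots> = x"
        using x y(1) z by (simp add: TW.m_assoc)
      finally show "x \<in> Units TW"
        using x y z by (auto simp: Units_def)
    qed
  qed
qed

text \<open>If \<open>f\<close> has a coefficient at an index \<open>i\<close> other than
  \<open>\<tau> 0\<close>, nondegeneracy yields a monomial of some index \<open>j\<close> that does
  not commute with the one of index \<open>i\<close>. Comparing a single coefficient of the two
  products gives \<open>coc j i = coc i j\<close>, a contradiction.\<close>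

lemma centre_TW: "centre TW = scalars"
proof
  show "scalars \<subseteq> centre TW"
    by (rule emb_central)
  show "centre TW \<subseteq> scalars"
  proof
    fix f assume f: "f \<in> centre TW"
    then have fc: "f \<in> carrier TW"
      by (simp add: centre_def)
    have "f i = \<zero>" if i: "i \<noteq> \<tau> 0" for i
    proof (rule ccontr)
      assume nz: "f i \<noteq> \<zero>"
      have "e i \<notin> D"
        using i \<tau>_eq_iff[of "e i" 0] by simp
      then obtain t where t: "\<beta> (e i) t \<noteq> \<beta> t (e i)"
        using nondegenerate by blast
      define j where "j = \<tau> t"
      have t': "\<beta> (e i) (e j) \<noteq> \<beta> (e j) (e i)"
        using t by (simp add: j_def)
      have "tmono \<one> j \<otimes>\<^bsub>TW\<^esub> f = f \<otimes>\<^bsub>TW\<^esub> tmono \<one> j"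
        using f by (simp add: centre_def)
      moreover have "(tmono \<one> j \<otimes>\<^bsub>TW\<^esub> f) (\<tau> (e j + e i)) = f i \<otimes> coc j i"
        using fc by (simp add: TW_tmono_mult_apply)
      moreover have "(f \<otimes>\<^bsub>TW\<^esub> tmono \<one> j) (\<tau> (e j + e i)) = f i \<otimes> coc i j"
      proof -
        have "(f \<otimes>\<^bsub>TW\<^esub> tmono \<one> j) (\<tau> (e j + e i))
            = (\<Oplus>k\<in>{k. f k \<noteq> \<zero>}. if i = k then f k \<otimes> coc k j else \<zero>)"
          unfolding TW_mult
        proof (rule finsum_cong')
          fix k
          \<comment> \<open>Only the summand \<open>k = i\<close> contributes to this
            coefficient.\<close>
          have "\<tau> (e (\<tau> (e j + e i)) - e k) = j \<longleftrightarrow> i = k"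
          proof
            assume "\<tau> (e (\<tau> (e j + e i)) - e k) = j"
            then have "\<tau> (e j + e i - e k) = \<tau> (e j)"
              by simp
            then have "e i - e k \<in> D"
              unfolding \<tau>_eq_iff by simp
            then have "\<tau> (e i) = \<tau> (e k)"
              by (rule \<tau>_eqI)
            then show "i = k"
              by simp
          qed simp
          then show "f k \<otimes> tmono \<one> j (\<tau> (e (\<tau> (e j + e i)) - e k))
              \<otimes> coc k (\<tau> (e (\<tau> (e j + e i)) - e k)) = (if i = k then f k \<otimes> coc k j else \<zero>)"
            using fc by (auto simp: tmono_apply)
        qed (use fc in auto)
        also have "\<dots> = f i \<otimes> coc i j"
          using fc nz by (intro finsum_singleton) auto
        finally show ?thesis .
      qed
      ultimately have "f i \<otimes> coc j i = f i \<otimes> coc i j"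
        by simp
      then have "coc j i = coc i j"
        using m_lcancel[OF nz] fc by simp
      then have "\<beta> (e j) (e i) \<otimes> \<chi> (e i + e j - e (\<tau> (e i + e j)))
          = \<beta> (e i) (e j) \<otimes> \<chi> (e i + e j - e (\<tau> (e i + e j)))"
        by (simp add: coc_def add.commute)
      then show False
        using m_rcancel[OF \<chi>_nz[OF e_\<tau>(2)]] t' e_\<tau>(2) by auto
    qed
    then have "f = emb (f (\<tau> 0))"
      by (auto simp: fun_eq_iff emb_apply)
    then show "f \<in> scalars"
      using fc by (intro image_eqI[of _ _ "f (\<tau> 0)"]) auto
  qed
qed

lemma v_p_power_mult:
  assumes "c \<in> carrier K" "c \<noteq> \<zero>"
  shows "[(p ^ n)] \<cdot>\<^bsub>K\<^esub> c \<noteq> \<zero> \<and> v ([(p ^ n)] \<cdot>\<^bsub>K\<^esub> c) = v c"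
proof (induction n)
  case (Suc n)
  have "[(p ^ Suc n)] \<cdot>\<^bsub>K\<^esub> c = [p] \<cdot>\<^bsub>K\<^esub> ([(p ^ n)] \<cdot>\<^bsub>K\<^esub> c)"
    using assms by (simp add: add.nat_pow_pow mult.commute)
  also have "\<dots> = ([p] \<cdot>\<^bsub>K\<^esub> \<one>) \<otimes> ([(p ^ n)] \<cdot>\<^bsub>K\<^esub> c)"
    using assms by (simp add: add_pow_ldistr)
  finally have eq: "[(p ^ Suc n)] \<cdot>\<^bsub>K\<^esub> c = ([p] \<cdot>\<^bsub>K\<^esub> \<one>) \<otimes> ([(p ^ n)] \<cdot>\<^bsub>K\<^esub> c)" .
  show ?case
    unfolding eq using Suc assms p_not_zero v_p by (simp add: v_mult integral_iff)
qed (use assms in simp)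

lemma finsum_TW_apply:
  assumes "finite J" "\<And>i. i \<in> J \<Longrightarrow> f i \<in> carrier TW"
  shows "finsum TW f J l = (\<Oplus>i\<in>J. f i l)"
  using assms by (induction J) (simp_all add: TW_zero_apply TW_add_apply Pi_iff)

lemma central_subalgebra_trivial:
  assumes cen: "central_subalgebra scalars V TW" and fd: "TW.finite_dimension scalars V"
  shows "V = scalars"
proof -
  have V: "unital_subalgebra scalars V TW" and ceq: "centre (TW\<lparr>carrier := V\<rparr>) = scalars"
    using cen by (auto simp: central_subalgebra_def)
  have Vr: "subring V TW" and Vs: "subalgebra scalars V TW"
    using V by (auto simp: unital_subalgebra_def)
  have Vc: "V \<subseteq> carrier TW"
    by (rule TW.subalgebra_in_carrier[OF Vs])
  have kV: "scalars \<subseteq> V"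
    using ceq by (auto simp: centre_def)
  obtain I where I: "finite I" "V \<subseteq> supp_in I"
    using finite_dimension_supp[OF fd] by blast
  let ?J = "lead_classes V"
  have fin: "finite ?J"
    using lead_classes_supp_in[OF I(2)] I(1) finite_subset by blast
  have ixJ: "ix_closed ?J"
    by (rule lead_classes_closed[OF V])
  obtain A B where bi: "biorth ?J A B" and no: "normed ?J A B" and AB: "A ` ?J \<subseteq> V" "B ` ?J \<subseteq> V"
    and wA: "\<And>j. j \<in> ?J \<Longrightarrow> w (A j) = e j"
    and ex: "\<And>z. z \<in> V \<Longrightarrow> proj ?J A B z = z" "\<And>z. z \<in> V \<Longrightarrow> proj ?J B A z = z"
    using subalgebra_biorth[OF V I] by metis
  \<comment> \<open>A finite set of torsion classes has a common exponent; afterwards the least such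
    \<open>m\<close> is taken.\<close>
  have "\<exists>m. \<forall>j\<in>?J. gmul (p ^ m) (e j) \<in> D"
  proof -
    have "\<forall>j. \<exists>m. gmul (p ^ m) (e j) \<in> D"
      using torsion by blast
    from choice[OF this] obtain m where m: "\<forall>j. gmul (p ^ m j) (e j) \<in> D"
      by blast
    have "gmul (p ^ Max (m ` ?J)) (e j) \<in> D" if "j \<in> ?J" for j
    proof -
      have "m j \<le> Max (m ` ?J)"
        using fin that by simp
      then have "p ^ Max (m ` ?J) = p ^ (Max (m ` ?J) - m j) * p ^ m j"
        by (simp flip: power_add)
      then show ?thesis
        using gmul_D m by (simp add: gmul_mult)
    qed
    then show ?thesis
      by blast
  qed
  then obtain m where m: "\<forall>j\<in>?J. gmul (p ^ m) (e j) \<in> D"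
    and min: "\<And>n. n < m \<Longrightarrow> \<not> (\<forall>j\<in>?J. gmul (p ^ n) (e j) \<in> D)"
    using exists_least_iff[of "\<lambda>m. \<forall>j\<in>?J. gmul (p ^ m) (e j) \<in> D"] by blast
  show ?thesis
  proof (cases m)
    case 0
    \<comment> \<open>Only the trivial class is left. An element of \<open>V\<close> minus the
      scalar formed by its coefficient at \<open>\<tau> 0\<close> then has no possible leading
      index, so it is zero.\<close>
    have J0: "?J \<subseteq> {\<tau> 0}"
    proof
      fix j assume "j \<in> ?J"
      then have "e j \<in> D"
        using m 0 by simp
      then have "\<tau> (e j) = \<tau> 0"
        by (intro \<tau>_eqI) simp
      then show "j \<in> {\<tau> 0}"
        by simp
    qed
    have "V \<subseteq> scalars"
    proof
      fix a assume a: "a \<in> V"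
      then have ac: "a \<in> carrier TW"
        using Vc by auto
      let ?b = "a \<ominus>\<^bsub>TW\<^esub> emb (a (\<tau> 0))"
      have bV: "?b \<in> V"
        using a kV ac by (intro TW.subalgebra_diff[OF Vs]) auto
      have "?b = \<zero>\<^bsub>TW\<^esub>"
      proof (rule ccontr)
        assume nz: "?b \<noteq> \<zero>\<^bsub>TW\<^esub>"
        then have "\<tau> (w ?b) = \<tau> 0"
          using bV J0 by (auto simp: lead_classes_def)
        then have "?b (\<tau> 0) \<noteq> \<zero>"
          using w_lead(1)[OF subsetD[OF Vc bV] nz] by simp
        then show False
          using ac by (simp add: TW_diff_apply emb_apply r_neg minus_eq)
      qed
      then have "a = emb (a (\<tau> 0))"
        using ac by (metis TW.r_right_minus_eq emb_closed TW_coeff)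
      then show "a \<in> scalars"
        using ac by (intro image_eqI[of _ _ "a (\<tau> 0)"]) auto
    qed
    then show ?thesis
      using kV by blast
  next
    case (Suc n)
    then obtain j where j: "j \<in> ?J" "gmul (p ^ n) (e j) \<notin> D"
      using min[of n] by auto
    \<comment> \<open>The exponent \<open>n = m - 1\<close> is the last one for which some class
      survives. By \<open>exponent\<close>, \<open>g\<close> pairs symmetrically with all of
      \<open>?J\<close>.\<close>
    define g where "g = gmul (p ^ n) (e j)"
    have gJ: "\<tau> g \<in> ?J"
      unfolding g_def using ix_closed_gmul[OF ixJ, of "e j"] j(1) by simp
    have comm: "\<beta> (e i) g = \<beta> g (e i)" if "i \<in> ?J" for i
      unfolding g_def \<beta>_gmul using exponent[of n "e i" "e j"] m Suc that j(1) by simp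
    define x where "x = A (\<tau> g)"
    have xV: "x \<in> V"
      using AB gJ by (auto simp: x_def)
    have xc: "x \<in> carrier TW"
      using xV Vc by auto
    have xnz: "x \<noteq> \<zero>\<^bsub>TW\<^esub>"
      using no gJ by (simp add: x_def normed_def)
    have wx: "w x = e (\<tau> g)"
      using wA gJ by (simp add: x_def)
    let ?P = "\<Oplus>\<^bsub>TW\<^esub>i\<in>?J. A i \<otimes>\<^bsub>TW\<^esub> x \<otimes>\<^bsub>TW\<^esub> B i"
    note c = biorth_closed[OF bi]
    have PV: "?P \<in> V"
    proof (rule TW.subalgebra_finsum[OF Vs fin])
      fix i assume "i \<in> ?J"
      then have "A i \<in> V" "B i \<in> V"
        using AB by auto
      then show "A i \<otimes>\<^bsub>TW\<^esub> x \<otimes>\<^bsub>TW\<^esub> B i \<in> V"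
        by (intro subringE(6)[OF Vr] xV)
    qed
    have "?P \<in> centre (TW\<lparr>carrier := V\<rparr>)"
    proof -
      have "?P \<otimes>\<^bsub>TW\<^esub> y = y \<otimes>\<^bsub>TW\<^esub> ?P" if "y \<in> V" for y
        using casimir_central[OF bi Vc AB subringE(6)[OF Vr] ex xV that] by simp
      then show ?thesis
        using PV by (simp add: centre_def)
    qed
    then obtain a where a: "?P = emb a"
      using ceq by auto
    let ?l = "\<tau> g"
    have "?l \<noteq> \<tau> 0"
      using j(2) \<tau>_eq_iff[of g 0] by (auto simp: g_def)
    \<comment> \<open>A scalar has no coefficient at the nontrivial index of \<open>g\<close>,
      whereas \<open>?N\<close> is \<open>|J|\<close> times \<open>x\<close> and has there a
      coefficient of value exactly 0. The estimate of \<open>casimir_lead\<close>, whose bound at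
      this index is \<open>w x - e ?l = 0\<close>, makes the two incompatible.\<close>
    then have P0: "?P ?l = \<zero>"
      by (simp add: a emb_apply)
    let ?N = "\<Oplus>\<^bsub>TW\<^esub>i\<in>?J. x"
    have Nc: "?N \<in> carrier TW" and Pc: "?P \<in> carrier TW"
      using PV Vc xc by auto
    have "tlt (?P \<ominus>\<^bsub>TW\<^esub> ?N) (w x)"
      using comm wA wx by (intro casimir_lead[OF bi no xc xnz]) auto
    then have "klt (?P ?l \<ominus> ?N ?l) (w x - e ?l)"
      using Nc Pc by (simp add: tlt_def TW_diff_apply)
    then have k: "klt (?N ?l) 0"
      using P0 wx Nc by (simp add: minus_eq klt_minus)
    obtain r where r: "card ?J = p ^ r"
      using card_ix_closed[OF fin ixJ] by blast
    have xl: "x ?l \<noteq> \<zero>" "v (x ?l) = 0"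
      using w_lead[OF xc xnz] wx by auto
    have "?N ?l = [(p ^ r)] \<cdot>\<^bsub>K\<^esub> (x ?l)"
      using fin xc r by (simp add: finsum_TW_apply add.finprod_const)
    then have "?N ?l \<noteq> \<zero>" "v (?N ?l) = 0"
      using v_p_power_mult[OF _ xl(1), of r] xl xc by auto
    then show ?thesis
      using k by (simp add: klt_def)
  qed
qed

lemma exists_noncentral: "\<exists>s. s \<notin> D \<Longrightarrow> \<exists>f\<in>carrier TW. f \<notin> scalars"
proof -
  assume "\<exists>s. s \<notin> D"
  then obtain s where "s \<notin> D"
    by blast
  then have ne: "\<tau> s \<noteq> \<tau> 0"
    by (simp add: \<tau>_eq_iff)
  have "tmono \<one> (\<tau> s) \<notin> scalars"
    using ne one_not_zero by (auto simp: emb_apply tmono_apply dest!: fun_cong[of _ _ "\<tau> s"])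
  then show ?thesis
    by blast
qed

lemma not_NLF_TW:
  assumes "\<exists>s. s \<notin> D"
  shows "\<not> NLF scalars TW"
proof
  assume N: "NLF scalars TW"
  obtain f where f: "f \<in> carrier TW" "f \<notin> scalars"
    using exists_noncentral[OF assms] by blast
  then obtain V where "central_subalgebra scalars V TW" "TW.finite_dimension scalars V" "{f} \<subseteq> V"
    using N unfolding NLF_def by (metis empty_subsetI finite.emptyI finite.insertI insert_subset)
  then show False
    using central_subalgebra_trivial f(2) by blast
qed

end


section \<open>Leading monomials in a field of fractions\<close>

text \<open>Finite linear combinations of a possibly infinite family, with coefficients in a subring
  that need not be a field. Building them term by term, repetitions allowed, makes closure
  properties provable by induction.\<close>

inductive_set (in ring) span_over :: "'a set \<Rightarrow> ('i \<Rightarrow> 'a) \<Rightarrow> 'i set \<Rightarrow> 'a set"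
  for F :: "'a set" and \<phi> :: "'i \<Rightarrow> 'a" and S :: "'i set" where
    zero: "\<zero> \<in> span_over F \<phi> S"
  | add: "\<lbrakk>c \<in> F; i \<in> S; x \<in> span_over F \<phi> S\<rbrakk> \<Longrightarrow> c \<otimes> \<phi> i \<oplus> x \<in> span_over F \<phi> S"

context ring
begin

lemma span_over_closed:
  assumes "F \<subseteq> carrier R" "\<And>i. i \<in> S \<Longrightarrow> \<phi> i \<in> carrier R" "x \<in> span_over F \<phi> S"
  shows "x \<in> carrier R"
  using assms(3) by induction (use assms(1,2) in auto)

lemma span_over_mono:
  assumes "S \<subseteq> T" "x \<in> span_over F \<phi> S"
  shows "x \<in> span_over F \<phi> T"
  using assms(2)
proof induction
  case (add c i x)
  then show ?case
    using assms(1) by (intro span_over.add) auto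
qed (rule span_over.zero)

lemma span_over_add:
  assumes F: "F \<subseteq> carrier R" and \<phi>: "\<And>i. i \<in> S \<Longrightarrow> \<phi> i \<in> carrier R"
    and "x \<in> span_over F \<phi> S" and y: "y \<in> span_over F \<phi> S"
  shows "x \<oplus> y \<in> span_over F \<phi> S"
  using assms(3)
proof induction
  case zero
  then show ?case
    using y span_over_closed[OF F \<phi> y] by simp
next
  case (add c i x)
  have "c \<otimes> \<phi> i \<oplus> (x \<oplus> y) \<in> span_over F \<phi> S"
    using add by (intro span_over.add)
  moreover have "c \<otimes> \<phi> i \<in> carrier R" "x \<in> carrier R" "y \<in> carrier R"
    using add F \<phi> span_over_closed[OF F \<phi>] y by auto
  ultimately show ?case
    by (simp add: a_assoc)
qed

lemma span_over_single:
  assumes "F \<subseteq> carrier R" "\<phi> i \<in> carrier R" "c \<in> F" "i \<in> S"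
  shows "c \<otimes> \<phi> i \<in> span_over F \<phi> S"
  using span_over.add[where \<phi> = \<phi>, OF assms(3,4) span_over.zero] assms by auto

lemma span_over_smult:
  assumes F: "subring F R" and \<phi>: "\<And>i. i \<in> S \<Longrightarrow> \<phi> i \<in> carrier R"
    and "x \<in> span_over F \<phi> S" and a: "a \<in> F"
  shows "a \<otimes> x \<in> span_over F \<phi> S"
  using assms(3)
proof induction
  case zero
  then show ?case
    using a subringE(1)[OF F] by (simp add: span_over.zero subset_iff)
next
  case (add c i x)
  have "(a \<otimes> c) \<otimes> \<phi> i \<oplus> a \<otimes> x \<in> span_over F \<phi> S"
    using add a subringE(6)[OF F] by (intro span_over.add)
  moreover have "c \<in> carrier R" "\<phi> i \<in> carrier R" "x \<in> carrier R" "a \<in> carrier R"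
    using add \<phi> subringE(1)[OF F] span_over_closed[OF subringE(1)[OF F] \<phi>] a by auto
  ultimately show ?case
    by (simp add: m_assoc r_distr)
qed

lemma span_over_minus:
  assumes F: "subring F R" and \<phi>: "\<And>i. i \<in> S \<Longrightarrow> \<phi> i \<in> carrier R" and x: "x \<in> span_over F \<phi> S"
  shows "\<ominus> x \<in> span_over F \<phi> S"
proof -
  have "(\<ominus> \<one>) \<otimes> x \<in> span_over F \<phi> S"
    using subringE(3,5)[OF F] by (intro span_over_smult[OF F \<phi> x]) auto
  then show ?thesis
    using span_over_closed[OF subringE(1)[OF F] \<phi> x] by (simp add: l_minus)
qed

lemma span_over_diff:
  assumes F: "subring F R" and \<phi>: "\<And>i. i \<in> S \<Longrightarrow> \<phi> i \<in> carrier R"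
    and x: "x \<in> span_over F \<phi> S" and y: "y \<in> span_over F \<phi> S"
  shows "x \<ominus> y \<in> span_over F \<phi> S"
  using span_over_add[OF subringE(1)[OF F] \<phi> x span_over_minus[OF F \<phi> y]] by (simp add: minus_eq)

lemma span_over_finsum:
  assumes F: "subring F R" and \<phi>: "\<And>i. i \<in> S \<Longrightarrow> \<phi> i \<in> carrier R"
    and "finite T" "\<And>j. j \<in> T \<Longrightarrow> f j \<in> span_over F \<phi> S"
  shows "finsum R f T \<in> span_over F \<phi> S"
  using assms(3,4)
proof (induction T)
  case (insert j T)
  have c: "f i \<in> carrier R" if "i \<in> insert j T" for i
    using span_over_closed[OF subringE(1)[OF F] \<phi> insert.prems[OF that]] .
  then have "finsum R f (insert j T) = f j \<oplus> finsum R f T"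
    using insert.hyps by (intro finsum_insert) auto
  moreover have "f j \<oplus> finsum R f T \<in> span_over F \<phi> S"
    by (rule span_over_add[OF subringE(1)[OF F] \<phi>]) (use insert in auto)
  ultimately show ?case
    by simp
qed (simp add: span_over.zero)

lemma span_over_subset_span:
  assumes F: "subring F R" and \<phi>: "\<And>i. i \<in> S \<Longrightarrow> \<phi> i \<in> carrier R"
    and \<psi>: "\<And>i. i \<in> T \<Longrightarrow> \<psi> i \<in> span_over F \<phi> S" and x: "x \<in> span_over F \<psi> T"
  shows "x \<in> span_over F \<phi> S"
  using x
proof induction
  case (add c i x)
  then show ?case
    by (intro span_over_add[OF subringE(1)[OF F] \<phi> span_over_smult[OF F \<phi> \<psi>]])
qed (rule span_over.zero)

text \<open>Repetitions of an index are merged into one coefficient, so that the combination becomes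
  a sum over a set of indices.\<close>

lemma span_over_coeffs:
  assumes F: "subring F R" and \<phi>: "\<And>i. i \<in> S \<Longrightarrow> \<phi> i \<in> carrier R" and x: "x \<in> span_over F \<phi> S"
  obtains T f where "finite T" "T \<subseteq> S" "\<And>i. f i \<in> F" "x = (\<Oplus>i\<in>T. f i \<otimes> \<phi> i)"
proof -
  note Fc = subringE(1)[OF F]
  have "\<exists>T f. finite T \<and> T \<subseteq> S \<and> (\<forall>i. f i \<in> F) \<and> x = (\<Oplus>i\<in>T. f i \<otimes> \<phi> i)"
    using x
  proof induction
    case zero
    then show ?case
      using subringE(2)[OF F] by (intro exI[of _ "{}"] exI[of _ "\<lambda>_. \<zero>"]) auto
  next
    case (add c i x)
    then obtain T f where T: "finite T" "T \<subseteq> S" "\<forall>i. f i \<in> F" "x = (\<Oplus>i\<in>T. f i \<otimes> \<phi> i)"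
      by blast
    \<comment> \<open>Extension by zero treats both cases at once, whether the new index
      \<open>i\<close> is already in \<open>T\<close> or not.\<close>
    define g where "g = (\<lambda>j. if j \<in> T then f j else \<zero>)"
    define h where "h = g(i := c \<oplus> g i)"
    have gF: "g j \<in> F" for j
      using T(3) subringE(2)[OF F] by (simp add: g_def)
    have hF: "h j \<in> F" for j
      using gF add(1) subringE(7)[OF F] by (simp add: h_def)
    have [simp]: "f j \<in> carrier R" "g j \<in> carrier R" "h j \<in> carrier R" "c \<in> carrier R" for j
      using T(3) gF hF Fc add(1) by auto
    have [simp]: "\<phi> j \<in> carrier R" if "j \<in> insert i T" for j
      using that T(2) add(2) \<phi> by auto
    have "x = (\<Oplus>j\<in>insert i T. g j \<otimes> \<phi> j)"
      unfolding T(4)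
      by (rule add.finprod_mono_neutral_cong_left) (use T Fc in \<open>auto simp: g_def\<close>)
    also have "\<dots> = g i \<otimes> \<phi> i \<oplus> (\<Oplus>j\<in>T - {i}. g j \<otimes> \<phi> j)"
      using T(1) by (subst insert_Diff_single[symmetric], subst finsum_insert) auto
    finally have x: "x = g i \<otimes> \<phi> i \<oplus> (\<Oplus>j\<in>T - {i}. g j \<otimes> \<phi> j)" .
    have "(\<Oplus>j\<in>insert i T. h j \<otimes> \<phi> j) = h i \<otimes> \<phi> i \<oplus> (\<Oplus>j\<in>T - {i}. h j \<otimes> \<phi> j)"
      using T(1) by (subst insert_Diff_single[symmetric], subst finsum_insert) auto
    also have "(\<Oplus>j\<in>T - {i}. h j \<otimes> \<phi> j) = (\<Oplus>j\<in>T - {i}. g j \<otimes> \<phi> j)"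
      by (rule finsum_cong') (auto simp: h_def)
    also have "h i \<otimes> \<phi> i \<oplus> (\<Oplus>j\<in>T - {i}. g j \<otimes> \<phi> j) = c \<otimes> \<phi> i \<oplus> x"
      unfolding x by (simp add: h_def l_distr a_assoc)
    finally show ?case
      using T(1,2) add(2) hF by (intro exI[of _ "insert i T"] exI[of _ h]) auto
  qed
  then show ?thesis
    using that by blast
qed

end

text \<open>Distributivity in both factors. The index set \<open>U'\<close> of the products is kept
  apart from \<open>S\<close> and \<open>T\<close>, because besides the closure of rings this has to
  deliver the strict bounds on exponents in \<open>leads_mult\<close>.\<close>

lemma (in cring) span_over_mult:
  assumes F: "subring F R" and \<phi>: "\<And>i. i \<in> U \<Longrightarrow> \<phi> i \<in> carrier R"
    and ST: "S \<subseteq> U" "T \<subseteq> U"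
    and m: "\<And>i j. \<lbrakk>i \<in> S; j \<in> T\<rbrakk> \<Longrightarrow> \<phi> i \<otimes> \<phi> j \<in> span_over F \<phi> U'" and U': "U' \<subseteq> U"
    and x: "x \<in> span_over F \<phi> S" and y: "y \<in> span_over F \<phi> T"
  shows "x \<otimes> y \<in> span_over F \<phi> U'"
  using x
proof induction
  case zero
  have "y \<in> carrier R"
    using ST by (intro span_over_closed[OF subringE(1)[OF F] _ y] \<phi>) auto
  then show ?case
    by (simp add: span_over.zero)
next
  case (add c i x)
  note Fc = subringE(1)[OF F]
  have \<phi>': "\<phi> j \<in> carrier R" if "j \<in> U'" for j
    using that U' \<phi> by auto
  have \<phi>i: "\<phi> i \<otimes> y \<in> span_over F \<phi> U'"
    using y
  proof induction
    case zero
    then show ?case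
      using \<phi> add(2) ST by (simp add: span_over.zero subset_iff)
  next
    case (add d j y)
    have c: "d \<in> carrier R" "\<phi> i \<in> carrier R" "\<phi> j \<in> carrier R" "y \<in> carrier R"
      using add \<open>i \<in> S\<close> \<phi> ST Fc span_over_closed[OF Fc _ add(3)] by auto
    have "d \<otimes> (\<phi> i \<otimes> \<phi> j) \<oplus> \<phi> i \<otimes> y \<in> span_over F \<phi> U'"
      by (rule span_over_add[OF Fc \<phi>' span_over_smult[OF F \<phi>' m[OF \<open>i \<in> S\<close> add(2)] add(1)] add(4)])
    then show ?case
      using c by (simp add: r_distr m_ac)
  qed
  have c: "c \<in> carrier R" "\<phi> i \<in> carrier R" "x \<in> carrier R" "y \<in> carrier R"
    using add \<phi> ST Fc span_over_closed[OF Fc _ add(3)] span_over_closed[OF Fc _ y] by auto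
  have "c \<otimes> (\<phi> i \<otimes> y) \<oplus> x \<otimes> y \<in> span_over F \<phi> U'"
    by (rule span_over_add[OF Fc \<phi>' span_over_smult[OF F \<phi>' \<phi>i add(1)] add(4)])
  then show ?case
    using c by (simp add: l_distr m_assoc)
qed

text \<open>\<open>K\<close> is the field of fractions of the monoid ring of \<open>N\<close> over
  \<open>F\<close>, with monomials \<open>\<phi> \<gamma>\<close>; the order of \<open>'g\<close>
  serves as the monomial order.\<close>

locale monomial_field = field K for K (structure) +
  fixes F :: "'a set" and \<phi> :: "'g::linordered_ab_group_add \<Rightarrow> 'a" and N :: "'g set"
  assumes F_subring: "subring F K"
    and N_zero: "0 \<in> N" and N_add: "\<lbrakk>\<gamma> \<in> N; \<delta> \<in> N\<rbrakk> \<Longrightarrow> \<gamma> + \<delta> \<in> N"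
    and \<phi>_closed: "\<gamma> \<in> N \<Longrightarrow> \<phi> \<gamma> \<in> carrier K"
    and \<phi>_zero: "\<phi> 0 = \<one>"
    and \<phi>_add: "\<lbrakk>\<gamma> \<in> N; \<delta> \<in> N\<rbrakk> \<Longrightarrow> \<phi> (\<gamma> + \<delta>) = \<phi> \<gamma> \<otimes> \<phi> \<delta>"
    and independence: "\<lbrakk>finite S; S \<subseteq> N; \<And>\<gamma>. \<gamma> \<in> S \<Longrightarrow> f \<gamma> \<in> F; (\<Oplus>\<gamma>\<in>S. f \<gamma> \<otimes> \<phi> \<gamma>) = \<zero>; \<delta> \<in> S\<rbrakk>
      \<Longrightarrow> f \<delta> = \<zero>"
    and fractions: "a \<in> carrier K \<Longrightarrow>
      \<exists>x\<in>span_over F \<phi> N. \<exists>y\<in>span_over F \<phi> N. y \<noteq> \<zero> \<and> a \<otimes> y = x"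
begin

lemma F_carrier: "F \<subseteq> carrier K"
  by (rule subringE(1)[OF F_subring])

abbreviation below :: "'g \<Rightarrow> 'a set" where
  "below \<gamma> \<equiv> span_over F \<phi> {\<delta> \<in> N. \<delta> < \<gamma>}"

abbreviation up_to :: "'g \<Rightarrow> 'a set" where
  "up_to \<gamma> \<equiv> span_over F \<phi> {\<delta> \<in> N. \<delta> \<le> \<gamma>}"

definition leads :: "'a \<Rightarrow> 'g \<Rightarrow> bool" where
  "leads a \<gamma> \<longleftrightarrow> \<gamma> \<in> N \<and> a \<in> carrier K \<and> (\<exists>c\<in>F. c \<noteq> \<zero> \<and> a \<ominus> c \<otimes> \<phi> \<gamma> \<in> below \<gamma>)"

lemma span_carrier: "\<lbrakk>S \<subseteq> N; x \<in> span_over F \<phi> S\<rbrakk> \<Longrightarrow> x \<in> carrier K"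
  using span_over_closed[OF F_carrier, of S \<phi> x] \<phi>_closed by auto

lemma single_not_below:
  assumes c: "c \<in> F" "c \<noteq> \<zero>" and \<gamma>: "\<gamma> \<in> N"
  shows "c \<otimes> \<phi> \<gamma> \<notin> below \<gamma>"
proof
  assume "c \<otimes> \<phi> \<gamma> \<in> below \<gamma>"
  then obtain T f where T: "finite T" "T \<subseteq> {\<delta> \<in> N. \<delta> < \<gamma>}" "\<And>i. f i \<in> F"
    "c \<otimes> \<phi> \<gamma> = (\<Oplus>i\<in>T. f i \<otimes> \<phi> i)"
    using span_over_coeffs[OF F_subring, of "{\<delta> \<in> N. \<delta> < \<gamma>}" \<phi>] \<phi>_closed by blast
  \<comment> \<open>Moving the term to the other side gives a linear relation whose coefficient at
    \<open>\<gamma>\<close> is nonzero.\<close>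
  define g where "g = f(\<gamma> := \<ominus> c)"
  have \<gamma>T: "\<gamma> \<notin> T"
    using T(2) by auto
  have cc: "c \<in> carrier K" "\<phi> \<gamma> \<in> carrier K"
    using c \<gamma> F_carrier \<phi>_closed by auto
  have gF: "g \<delta> \<in> F" for \<delta>
    using T(3) c(1) subringE(5)[OF F_subring] by (simp add: g_def)
  have gc: "g i \<otimes> \<phi> i \<in> carrier K" if "i \<in> insert \<gamma> T" for i
    using that gF[of i] T(2) F_carrier \<phi>_closed \<gamma> by (intro m_closed) auto
  have "(\<Oplus>i\<in>insert \<gamma> T. g i \<otimes> \<phi> i) = g \<gamma> \<otimes> \<phi> \<gamma> \<oplus> (\<Oplus>i\<in>T. g i \<otimes> \<phi> i)"
    using T(1) \<gamma>T gc by (intro finsum_insert) auto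
  also have "(\<Oplus>i\<in>T. g i \<otimes> \<phi> i) = (\<Oplus>i\<in>T. f i \<otimes> \<phi> i)"
  proof (rule finsum_cong')
    show "(\<lambda>i. f i \<otimes> \<phi> i) \<in> T \<rightarrow> carrier K"
      using T F_carrier \<phi>_closed by (auto simp: subset_iff)
  qed (use \<gamma>T in \<open>auto simp: g_def\<close>)
  also have "g \<gamma> \<otimes> \<phi> \<gamma> \<oplus> \<dots> = \<zero>"
    using cc by (simp flip: T(4) add: g_def l_minus l_neg)
  finally have "g \<gamma> = \<zero>"
    using T(1,2) \<gamma> gF independence[of "insert \<gamma> T" g \<gamma>] by auto
  then have "\<ominus> (\<ominus> c) = \<zero>"
    by (simp add: g_def)
  then show False
    using c(2) cc(1) by simp
qed

lemma leads_not_below: "leads a \<gamma> \<Longrightarrow> a \<notin> below \<gamma>"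
proof
  assume l: "leads a \<gamma>" and a: "a \<in> below \<gamma>"
  then obtain c where c: "c \<in> F" "c \<noteq> \<zero>" "a \<ominus> c \<otimes> \<phi> \<gamma> \<in> below \<gamma>"
    by (auto simp: leads_def)
  have cc: "c \<otimes> \<phi> \<gamma> \<in> carrier K" "a \<in> carrier K"
    using c l F_carrier \<phi>_closed by (auto simp: leads_def)
  have "a \<ominus> (a \<ominus> c \<otimes> \<phi> \<gamma>) \<in> below \<gamma>"
    by (rule span_over_diff[OF F_subring _ a c(3)]) (use \<phi>_closed in auto)
  also have "a \<ominus> (a \<ominus> c \<otimes> \<phi> \<gamma>) = c \<otimes> \<phi> \<gamma>"
    using cc by (simp add: minus_eq minus_add r_neg2)
  finally show False
    using single_not_below c l by (auto simp: leads_def)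
qed

lemma leads_nonzero: "leads a \<gamma> \<Longrightarrow> a \<noteq> \<zero>"
  using leads_not_below span_over.zero by blast

lemma leads_up_to: "leads a \<gamma> \<Longrightarrow> a \<in> up_to \<gamma>"
proof -
  assume l: "leads a \<gamma>"
  then obtain c where c: "c \<in> F" "c \<noteq> \<zero>" "a \<ominus> c \<otimes> \<phi> \<gamma> \<in> below \<gamma>"
    by (auto simp: leads_def)
  have cc: "c \<otimes> \<phi> \<gamma> \<in> carrier K" "a \<in> carrier K"
    using c l F_carrier \<phi>_closed by (auto simp: leads_def)
  have "a \<ominus> c \<otimes> \<phi> \<gamma> \<in> up_to \<gamma>"
    by (rule span_over_mono[OF _ c(3)]) auto
  then have "c \<otimes> \<phi> \<gamma> \<oplus> (a \<ominus> c \<otimes> \<phi> \<gamma>) \<in> up_to \<gamma>"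
    using l by (intro span_over.add[OF c(1)]) (simp_all add: leads_def)
  also have "c \<otimes> \<phi> \<gamma> \<oplus> (a \<ominus> c \<otimes> \<phi> \<gamma>) = a"
    using cc by (simp add: minus_eq a_lcomm[of "c \<otimes> \<phi> \<gamma>"] r_neg)
  finally show ?thesis .
qed

lemma leads_le:
  assumes "leads a \<gamma>" "a \<in> up_to \<mu>"
  shows "\<gamma> \<le> \<mu>"
proof (rule ccontr)
  assume "\<not> \<gamma> \<le> \<mu>"
  then have "a \<in> below \<gamma>"
    by (intro span_over_mono[OF _ assms(2)]) auto
  then show False
    using leads_not_below[OF assms(1)] by blast
qed

lemma leads_unique: "\<lbrakk>leads a \<gamma>; leads a \<delta>\<rbrakk> \<Longrightarrow> \<gamma> = \<delta>"
  using leads_le leads_up_to by (meson order_antisym)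

text \<open>Induction with the largest exponent split off: it leads if its coefficient is nonzero,
  and otherwise it is dropped.\<close>

lemma leads_exists:
  assumes a: "a \<in> span_over F \<phi> N" "a \<noteq> \<zero>"
  shows "\<exists>\<gamma>. leads a \<gamma>"
proof -
  obtain T f where T: "finite T" "T \<subseteq> N" "\<And>i. f i \<in> F" "a = (\<Oplus>i\<in>T. f i \<otimes> \<phi> i)"
    using span_over_coeffs[OF F_subring \<phi>_closed a(1)] by blast
  have "\<exists>\<gamma>. leads (\<Oplus>i\<in>T. f i \<otimes> \<phi> i) \<gamma>" if "(\<Oplus>i\<in>T. f i \<otimes> \<phi> i) \<noteq> \<zero>"
    using T(1,2) that
  proof (induction T rule: finite_linorder_max_induct)
    case (insert b T)
    have c: "f i \<otimes> \<phi> i \<in> carrier K" if "i \<in> insert b T" for i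
      using that insert.prems T(3) F_carrier \<phi>_closed by (intro m_closed) auto
    have bT: "b \<notin> T"
      using insert.hyps by auto
    have eq: "(\<Oplus>i\<in>insert b T. f i \<otimes> \<phi> i) = f b \<otimes> \<phi> b \<oplus> (\<Oplus>i\<in>T. f i \<otimes> \<phi> i)"
      using insert.hyps(1) bT c by (intro finsum_insert) auto
    have rc: "(\<Oplus>i\<in>T. f i \<otimes> \<phi> i) \<in> carrier K"
      using c by (intro finsum_closed) auto
    show ?case
    proof (cases "f b = \<zero>")
      case True
      then have "(\<Oplus>i\<in>insert b T. f i \<otimes> \<phi> i) = (\<Oplus>i\<in>T. f i \<otimes> \<phi> i)"
        using eq rc \<phi>_closed insert.prems by simp
      then show ?thesis
        using insert by auto
    next
      case False
      have "(\<Oplus>i\<in>T. f i \<otimes> \<phi> i) \<in> below b"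
        using insert.hyps insert.prems T(3) \<phi>_closed F_carrier
        by (intro span_over_finsum[OF F_subring] span_over_single) auto
      moreover have "(\<Oplus>i\<in>insert b T. f i \<otimes> \<phi> i) \<ominus> f b \<otimes> \<phi> b = (\<Oplus>i\<in>T. f i \<otimes> \<phi> i)"
        unfolding eq using c rc by (simp add: minus_eq a_ac r_neg2)
      ultimately have "leads (\<Oplus>i\<in>insert b T. f i \<otimes> \<phi> i) b"
        using False T(3) insert.prems c rc eq by (auto simp: leads_def intro!: bexI[of _ "f b"])
      then show ?thesis
        by blast
    qed
  qed simp
  then show ?thesis
    using T(4) a(2) by blast
qed

lemma leads_single: "\<lbrakk>c \<in> F; c \<noteq> \<zero>; \<gamma> \<in> N\<rbrakk> \<Longrightarrow> leads (c \<otimes> \<phi> \<gamma>) \<gamma>"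
  unfolding leads_def using F_carrier \<phi>_closed[of \<gamma>]
  by (auto simp: minus_eq r_neg intro!: bexI[of _ c] span_over.zero)

lemma span_mult_index:
  assumes "x \<in> span_over F \<phi> S" "y \<in> span_over F \<phi> T" "S \<subseteq> N" "T \<subseteq> N" "U \<subseteq> N"
    and "\<And>\<gamma> \<delta>. \<lbrakk>\<gamma> \<in> S; \<delta> \<in> T\<rbrakk> \<Longrightarrow> \<gamma> + \<delta> \<in> U"
  shows "x \<otimes> y \<in> span_over F \<phi> U"
proof (rule span_over_mult[OF F_subring \<phi>_closed assms(3,4) _ assms(5) assms(1,2)])
  fix \<gamma> \<delta> assume \<gamma>\<delta>: "\<gamma> \<in> S" "\<delta> \<in> T"
  then have N: "\<gamma> \<in> N" "\<delta> \<in> N"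
    using assms by auto
  have "\<one> \<otimes> \<phi> (\<gamma> + \<delta>) \<in> span_over F \<phi> U"
    using assms(6)[OF \<gamma>\<delta>] N N_add \<phi>_closed F_carrier subringE(3)[OF F_subring]
    by (intro span_over_single) auto
  then show "\<phi> \<gamma> \<otimes> \<phi> \<delta> \<in> span_over F \<phi> U"
    using N N_add \<phi>_add \<phi>_closed by simp
qed

text \<open>The leading coefficient is \<open>c d\<close>, nonzero in a field. With leading terms
  \<open>s\<close> of \<open>a\<close> and \<open>t\<close> of \<open>b\<close>, the rest is
  \<open>(a - s) b + s (b - t)\<close>, which has only smaller exponents.\<close>

lemma leads_mult:
  assumes a: "leads a \<alpha>" and b: "leads b \<beta>"
  shows "leads (a \<otimes> b) (\<alpha> + \<beta>)"
proof -
  obtain c where c: "c \<in> F" "c \<noteq> \<zero>" "a \<ominus> c \<otimes> \<phi> \<alpha> \<in> below \<alpha>"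
    using a by (auto simp: leads_def)
  obtain d where d: "d \<in> F" "d \<noteq> \<zero>" "b \<ominus> d \<otimes> \<phi> \<beta> \<in> below \<beta>"
    using b by (auto simp: leads_def)
  have N: "\<alpha> \<in> N" "\<beta> \<in> N"
    using a b by (auto simp: leads_def)
  have cc: "c \<in> carrier K" "\<phi> \<alpha> \<in> carrier K" "d \<in> carrier K" "\<phi> \<beta> \<in> carrier K" "a \<in> carrier K" "b \<in> carrier K"
    using c d a b F_carrier \<phi>_closed by (auto simp: leads_def)
  have "(a \<ominus> c \<otimes> \<phi> \<alpha>) \<otimes> b \<in> below (\<alpha> + \<beta>)"
    by (rule span_mult_index[OF c(3) leads_up_to[OF b]]) (auto simp: N_add add_less_le_mono)
  moreover have "(c \<otimes> \<phi> \<alpha>) \<otimes> (b \<ominus> d \<otimes> \<phi> \<beta>) \<in> below (\<alpha> + \<beta>)"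
    by (rule span_mult_index[OF leads_up_to[OF leads_single[OF c(1,2) N(1)]] d(3)])
      (auto simp: N_add add_le_less_mono)
  ultimately have "(a \<ominus> c \<otimes> \<phi> \<alpha>) \<otimes> b \<oplus> (c \<otimes> \<phi> \<alpha>) \<otimes> (b \<ominus> d \<otimes> \<phi> \<beta>) \<in> below (\<alpha> + \<beta>)"
    by (intro span_over_add[OF F_carrier]) (auto simp: \<phi>_closed)
  also have "(a \<ominus> c \<otimes> \<phi> \<alpha>) \<otimes> b \<oplus> (c \<otimes> \<phi> \<alpha>) \<otimes> (b \<ominus> d \<otimes> \<phi> \<beta>) = a \<otimes> b \<ominus> (c \<otimes> \<phi> \<alpha>) \<otimes> (d \<otimes> \<phi> \<beta>)"
    using cc by (simp add: minus_eq l_distr r_distr l_minus r_minus a_assoc r_neg1)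
  also have "(c \<otimes> \<phi> \<alpha>) \<otimes> (d \<otimes> \<phi> \<beta>) = (c \<otimes> d) \<otimes> \<phi> (\<alpha> + \<beta>)"
    using cc N \<phi>_add by (simp add: m_ac)
  finally show ?thesis
    using c d cc N N_add subringE(6)[OF F_subring c(1) d(1)]
    by (auto simp: leads_def integral_iff intro!: bexI[of _ "c \<otimes> d"])
qed

text \<open>The degree of a fraction: leading exponent of the numerator minus that of the
  denominator. Cross-multiplication in \<open>val_eq\<close> shows independence of the fraction.
  Zero has no such representation, so its value is unspecified.\<close>

definition val :: "'a \<Rightarrow> 'g" where
  "val a = (THE \<gamma>. \<exists>x y \<xi> \<eta>. a \<otimes> y = x \<and> leads x \<xi> \<and> leads y \<eta> \<and> \<gamma> = \<xi> - \<eta>)"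

lemma val_eq:
  assumes a: "a \<in> carrier K" and x: "a \<otimes> y = x" "leads x \<xi>" "leads y \<eta>"
  shows "val a = \<xi> - \<eta>"
  unfolding val_def
proof (rule the_equality)
  show "\<exists>x y \<xi>' \<eta>'. a \<otimes> y = x \<and> leads x \<xi>' \<and> leads y \<eta>' \<and> \<xi> - \<eta> = \<xi>' - \<eta>'"
    using x by blast
  fix \<gamma> assume "\<exists>x y \<xi> \<eta>. a \<otimes> y = x \<and> leads x \<xi> \<and> leads y \<eta> \<and> \<gamma> = \<xi> - \<eta>"
  then obtain x' y' \<xi>' \<eta>' where x': "a \<otimes> y' = x'" "leads x' \<xi>'" "leads y' \<eta>'" "\<gamma> = \<xi>' - \<eta>'"
    by blast
  have "y \<in> carrier K" "y' \<in> carrier K"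
    using x x' by (auto simp: leads_def)
  then have "x \<otimes> y' = x' \<otimes> y"
    using x(1) x'(1) a by (auto simp: m_ac)
  then have "\<xi> + \<eta>' = \<xi>' + \<eta>"
    using leads_mult[OF x(2) x'(3)] leads_mult[OF x'(2) x(3)] leads_unique by metis
  then show "\<gamma> = \<xi> - \<eta>"
    unfolding x'(4) by (simp add: eq_diff_eq diff_add_eq flip: \<open>\<xi> + \<eta>' = \<xi>' + \<eta>\<close>)
qed

lemma fraction_leads:
  assumes a: "a \<in> carrier K" "a \<noteq> \<zero>"
  obtains x y \<xi> \<eta> where "a \<otimes> y = x" "leads x \<xi>" "leads y \<eta>" "val a = \<xi> - \<eta>"
proof -
  obtain x y where xy: "x \<in> span_over F \<phi> N" "y \<in> span_over F \<phi> N" "y \<noteq> \<zero>" "a \<otimes> y = x"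
    using fractions[OF a(1)] by blast
  have "y \<in> carrier K"
    using span_carrier xy(2) by blast
  then have "x \<noteq> \<zero>"
    using xy(3,4) a integral_iff by auto
  then obtain \<xi> \<eta> where "leads x \<xi>" "leads y \<eta>"
    using leads_exists xy by blast
  then show ?thesis
    using that xy(4) val_eq[OF a(1) xy(4)] by blast
qed

lemma val_mult:
  assumes a: "a \<in> carrier K" "a \<noteq> \<zero>" and b: "b \<in> carrier K" "b \<noteq> \<zero>"
  shows "val (a \<otimes> b) = val a + val b"
proof -
  obtain x y \<xi> \<eta> where x: "a \<otimes> y = x" "leads x \<xi>" "leads y \<eta>" "val a = \<xi> - \<eta>"
    using fraction_leads[OF a] .
  obtain x' y' \<xi>' \<eta>' where x': "b \<otimes> y' = x'" "leads x' \<xi>'" "leads y' \<eta>'" "val b = \<xi>' - \<eta>'"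
    using fraction_leads[OF b] .
  have c: "y \<in> carrier K" "y' \<in> carrier K"
    using x x' by (auto simp: leads_def)
  have "(a \<otimes> b) \<otimes> (y \<otimes> y') = x \<otimes> x'"
    using x(1) x'(1) a b c by (auto simp: m_ac)
  then have "val (a \<otimes> b) = (\<xi> + \<xi>') - (\<eta> + \<eta>')"
    using val_eq[OF _ _ leads_mult[OF x(2) x'(2)] leads_mult[OF x(3) x'(3)]] a b by simp
  then show ?thesis
    using x(4) x'(4) by (simp add: add_diff_add)
qed

lemma val_add:
  assumes a: "a \<in> carrier K" "a \<noteq> \<zero>" and b: "b \<in> carrier K" "b \<noteq> \<zero>" and s: "a \<oplus> b \<noteq> \<zero>"
  shows "val (a \<oplus> b) \<le> max (val a) (val b)"
proof -
  obtain x y \<xi> \<eta> where x: "a \<otimes> y = x" "leads x \<xi>" "leads y \<eta>" "val a = \<xi> - \<eta>"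
    using fraction_leads[OF a] .
  obtain x' y' \<xi>' \<eta>' where x': "b \<otimes> y' = x'" "leads x' \<xi>'" "leads y' \<eta>'" "val b = \<xi>' - \<eta>'"
    using fraction_leads[OF b] .
  have c: "y \<in> carrier K" "y' \<in> carrier K" "x \<in> carrier K" "x' \<in> carrier K"
    using x x' by (auto simp: leads_def)
  have nz: "y \<noteq> \<zero>" "y' \<noteq> \<zero>"
    using x x' leads_nonzero by auto
  \<comment> \<open>The numerator over the common denominator \<open>y \<otimes> y'\<close>. Its
    exponents are at most \<open>?\<mu>\<close>; cancellation can only lower the leading
    one.\<close>
  let ?z = "x \<otimes> y' \<oplus> x' \<otimes> y" and ?\<mu> = "max (\<xi> + \<eta>') (\<xi>' + \<eta>)"
  have z: "(a \<oplus> b) \<otimes> (y \<otimes> y') = ?z"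
    using a b c by (simp add: l_distr r_distr m_ac flip: x(1) x'(1))
  have "x \<otimes> y' \<in> up_to ?\<mu>" "x' \<otimes> y \<in> up_to ?\<mu>"
    by (auto intro: span_over_mono[OF _ leads_up_to[OF leads_mult[OF x(2) x'(3)]]]
        span_over_mono[OF _ leads_up_to[OF leads_mult[OF x'(2) x(3)]]] simp: le_max_iff_disj)
  then have zu: "?z \<in> up_to ?\<mu>"
    using \<phi>_closed by (intro span_over_add[OF F_carrier]) auto
  moreover have "?z \<noteq> \<zero>"
    using z s nz a b c by (metis a_closed integral_iff m_closed)
  ultimately obtain \<zeta> where \<zeta>: "leads ?z \<zeta>"
    using leads_exists span_over_mono[of "{\<delta> \<in> N. \<delta> \<le> ?\<mu>}" N] by blast
  have "val (a \<oplus> b) = \<zeta> - (\<eta> + \<eta>')"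
    using val_eq[OF _ z \<zeta> leads_mult[OF x(3) x'(3)]] a b by simp
  moreover have "\<zeta> \<le> ?\<mu>"
    using leads_le[OF \<zeta> zu] .
  ultimately show ?thesis
    using x(4) x'(4) by (auto simp: le_max_iff_disj algebra_simps)
qed

lemma val_\<phi>: "\<gamma> \<in> N \<Longrightarrow> val (\<phi> \<gamma>) = \<gamma>"
  using val_eq[of "\<phi> \<gamma>" \<one> "\<phi> \<gamma>" \<gamma> 0] leads_single[of \<one> \<gamma>] leads_single[of \<one> 0]
    subringE(3)[OF F_subring] N_zero \<phi>_zero \<phi>_closed by simp

lemma val_F: "\<lbrakk>c \<in> F; c \<noteq> \<zero>\<rbrakk> \<Longrightarrow> val c = 0"
  using val_eq[of c \<one> c 0 0] leads_single[of c 0] leads_single[of \<one> 0]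
    subringE(3)[OF F_subring] N_zero \<phi>_zero F_carrier by auto

lemma val_range:
  assumes "a \<in> carrier K" "a \<noteq> \<zero>"
  obtains \<xi> \<eta> where "\<xi> \<in> N" "\<eta> \<in> N" "val a = \<xi> - \<eta>"
  using fraction_leads[OF assms] by (metis leads_def)

end


section \<open>Polynomials and algebraic independence\<close>

lemma (in ring) span_over_coeffs_finite:
  assumes F: "subring F R" and \<phi>: "\<And>i. i \<in> S \<Longrightarrow> \<phi> i \<in> carrier R" and S: "finite S"
    and x: "x \<in> span_over F \<phi> S"
  obtains f where "\<And>i. f i \<in> F" "x = (\<Oplus>i\<in>S. f i \<otimes> \<phi> i)"
proof -
  obtain T f where T: "finite T" "T \<subseteq> S" "\<And>i. f i \<in> F" "x = (\<Oplus>i\<in>T. f i \<otimes> \<phi> i)"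
    using span_over_coeffs[OF F \<phi> x] by blast
  define g where "g = (\<lambda>i. if i \<in> T then f i else \<zero>)"
  have gF: "g i \<in> F" for i
    using T(3) subringE(2)[OF F] by (simp add: g_def)
  have fc: "f i \<in> carrier R" "g i \<in> carrier R" for i
    using T(3) gF subringE(1)[OF F] by auto
  have "x = (\<Oplus>i\<in>S. g i \<otimes> \<phi> i)"
    unfolding T(4)
  proof (rule add.finprod_mono_neutral_cong_left)
    show "(\<lambda>i. g i \<otimes> \<phi> i) \<in> S \<rightarrow> carrier R"
      using fc \<phi> by auto
  qed (use S T \<phi> in \<open>auto simp: g_def\<close>)
  with gF that show ?thesis
    by blast
qed

lemma (in ring) span_over_base:
  assumes F: "subring F R" and "\<And>i. i \<in> S \<Longrightarrow> \<phi> i \<in> carrier R" "i \<in> S"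
  shows "\<phi> i \<in> span_over F \<phi> S"
  using span_over_single[OF subringE(1)[OF F] _ subringE(3)[OF F], of \<phi> i S] assms by simp

lemma (in ring) span_over_sum:
  assumes F: "subring F R" and \<phi>: "\<And>i. i \<in> S \<Longrightarrow> \<phi> i \<in> carrier R" and "finite S"
    and f: "\<And>i. i \<in> S \<Longrightarrow> f i \<in> F"
  shows "(\<Oplus>i\<in>S. f i \<otimes> \<phi> i) \<in> span_over F \<phi> S"
  using f \<phi> by (intro span_over_finsum[OF F \<phi> \<open>finite S\<close>] span_over_single[OF subringE(1)[OF F]])

lemma (in cring) span_over_subring:
  assumes F: "subring F R" and \<phi>: "\<And>i. i \<in> S \<Longrightarrow> \<phi> i \<in> carrier R"
    and one: "\<one> \<in> span_over F \<phi> S"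
    and m: "\<And>i j. \<lbrakk>i \<in> S; j \<in> S\<rbrakk> \<Longrightarrow> \<phi> i \<otimes> \<phi> j \<in> span_over F \<phi> S"
  shows "subring (span_over F \<phi> S) R"
proof (rule subringI)
  show "span_over F \<phi> S \<subseteq> carrier R"
    using span_over_closed[OF subringE(1)[OF F] \<phi>] by auto
  fix x y assume xy: "x \<in> span_over F \<phi> S" "y \<in> span_over F \<phi> S"
  show "\<ominus> x \<in> span_over F \<phi> S"
    by (rule span_over_minus[OF F \<phi> xy(1)])
  show "x \<oplus> y \<in> span_over F \<phi> S"
    by (rule span_over_add[OF subringE(1)[OF F] \<phi> xy])
  show "x \<otimes> y \<in> span_over F \<phi> S"
    by (rule span_over_mult[OF F \<phi> _ _ m _ xy]) auto
qed (rule one)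

context field
begin

text \<open>The localisation of \<open>M\<close> at the nonzero elements of \<open>L\<close>, inside
  the ambient field; \<open>fracs L L\<close> is the field of fractions of \<open>L\<close>.\<close>

definition fracs :: "'a set \<Rightarrow> 'a set \<Rightarrow> 'a set" where
  "fracs L M = {a \<in> carrier R. \<exists>z\<in>L. z \<noteq> \<zero> \<and> z \<otimes> a \<in> M}"

lemma fracs_mono: "\<lbrakk>L \<subseteq> L'; M \<subseteq> M'\<rbrakk> \<Longrightarrow> fracs L M \<subseteq> fracs L' M'"
  by (auto simp: fracs_def)

lemma fracs_base: "\<lbrakk>subring L R; M \<subseteq> carrier R\<rbrakk> \<Longrightarrow> M \<subseteq> fracs L M"
  using subringE(3)[of L R] one_not_zero by (auto simp: fracs_def intro!: bexI[of _ \<one>])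

text \<open>Common denominators, as for ordinary fractions. \<open>M\<close> may lack a unit, as the
  lattice in \<open>finite_extension_variables\<close> may; the assumption
  \<open>L \<subseteq> fracs L M\<close> supplies it after localisation.\<close>

lemma fracs_subring:
  assumes L: "subring L R" and M: "M \<subseteq> carrier R" "L \<subseteq> fracs L M"
    and add: "\<And>x y. \<lbrakk>x \<in> M; y \<in> M\<rbrakk> \<Longrightarrow> x \<oplus> y \<in> M"
    and mult: "\<And>x y. \<lbrakk>x \<in> M; y \<in> M\<rbrakk> \<Longrightarrow> x \<otimes> y \<in> M"
    and smult: "\<And>c x. \<lbrakk>c \<in> L; x \<in> M\<rbrakk> \<Longrightarrow> c \<otimes> x \<in> M"
  shows "subring (fracs L M) R"
proof (rule subringI)
  note Lc = subringE(1)[OF L]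
  show "fracs L M \<subseteq> carrier R"
    by (auto simp: fracs_def)
  show "\<one> \<in> fracs L M"
    using M(2) subringE(3)[OF L] by auto
  fix x assume x: "x \<in> fracs L M"
  then obtain a where a: "a \<in> L" "a \<noteq> \<zero>" "a \<otimes> x \<in> M" "x \<in> carrier R" "a \<in> carrier R"
    using Lc by (auto simp: fracs_def)
  have "(\<ominus> \<one>) \<otimes> (a \<otimes> x) \<in> M"
    by (rule smult[OF subringE(5)[OF L subringE(3)[OF L]] a(3)])
  then have "a \<otimes> (\<ominus> x) \<in> M"
    using a by (simp add: l_minus r_minus)
  then show "\<ominus> x \<in> fracs L M"
    using a by (auto simp: fracs_def)
  fix y assume y: "y \<in> fracs L M"
  then obtain b where b: "b \<in> L" "b \<noteq> \<zero>" "b \<otimes> y \<in> M" "y \<in> carrier R" "b \<in> carrier R"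
    using Lc by (auto simp: fracs_def)
  have ab: "a \<otimes> b \<in> L" "a \<otimes> b \<noteq> \<zero>"
    using a b subringE(6)[OF L] integral_iff by auto
  have "b \<otimes> (a \<otimes> x) \<oplus> a \<otimes> (b \<otimes> y) \<in> M"
    by (rule add[OF smult[OF b(1) a(3)] smult[OF a(1) b(3)]])
  also have "b \<otimes> (a \<otimes> x) \<oplus> a \<otimes> (b \<otimes> y) = (a \<otimes> b) \<otimes> (x \<oplus> y)"
    using a(4,5) b(4,5) by (simp add: r_distr m_ac)
  finally show "x \<oplus> y \<in> fracs L M"
    using a(4) b(4) ab by (auto simp: fracs_def)
  have "(a \<otimes> x) \<otimes> (b \<otimes> y) \<in> M"
    by (rule mult[OF a(3) b(3)])
  also have "(a \<otimes> x) \<otimes> (b \<otimes> y) = (a \<otimes> b) \<otimes> (x \<otimes> y)"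
    using a(4,5) b(4,5) by (simp add: m_ac)
  finally show "x \<otimes> y \<in> fracs L M"
    using a(4) b(4) ab by (auto simp: fracs_def)
qed

lemma fracs_subfield:
  assumes L: "subring L R"
  shows "subfield (fracs L L) R"
proof (rule subfieldI')
  note Lc = subringE(1)[OF L]
  show "subring (fracs L L) R"
    using subringE(6,7)[OF L] fracs_base[OF L Lc] Lc by (intro fracs_subring[OF L])
  fix x assume x: "x \<in> fracs L L - {\<zero>}"
  then obtain a where a: "a \<in> L" "a \<noteq> \<zero>" "a \<otimes> x \<in> L" "x \<in> carrier R" "x \<noteq> \<zero>" "a \<in> carrier R"
    using Lc by (auto simp: fracs_def)
  have i: "inv x \<in> carrier R" "x \<otimes> inv x = \<one>"
    using a by (auto simp: field_Units)
  have "(a \<otimes> x) \<otimes> inv x = a"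
    using a i by (simp add: m_assoc)
  moreover have "a \<otimes> x \<noteq> \<zero>"
    using a integral_iff by auto
  ultimately show "inv x \<in> fracs L L"
    using a i by (auto simp: fracs_def intro!: bexI[of _ "a \<otimes> x"])
qed

lemma common_denominator:
  assumes L: "subring L R" and M: "M \<subseteq> carrier R"
    and smult: "\<And>c x. \<lbrakk>c \<in> L; x \<in> M\<rbrakk> \<Longrightarrow> c \<otimes> x \<in> M"
    and Z: "finite Z" "Z \<subseteq> fracs L M"
  shows "\<exists>q\<in>L. q \<noteq> \<zero> \<and> (\<forall>z\<in>Z. q \<otimes> z \<in> M)"
  using Z
proof (induction Z)
  case empty
  then show ?case
    using subringE(3)[OF L] one_not_zero by (intro bexI[of _ \<one>]) auto
next
  case (insert z Z)
  note Lc = subringE(1)[OF L]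
  obtain q where q: "q \<in> L" "q \<noteq> \<zero>" "\<forall>z\<in>Z. q \<otimes> z \<in> M"
    using insert by auto
  obtain a where a: "a \<in> L" "a \<noteq> \<zero>" "a \<otimes> z \<in> M" "z \<in> carrier R"
    using insert.prems by (auto simp: fracs_def)
  have c: "q \<in> carrier R" "a \<in> carrier R"
    using q a Lc by auto
  have "(q \<otimes> a) \<otimes> t \<in> M" if t: "t \<in> insert z Z" for t
  proof (cases "t = z")
    case True
    then show ?thesis
      using smult[OF q(1) a(3)] c a(4) by (simp add: m_assoc)
  next
    case False
    then have "q \<otimes> t \<in> M" "t \<in> carrier R"
      using t q(3) insert.prems by (auto simp: fracs_def)
    then show ?thesis
      using smult[OF a(1), of "q \<otimes> t"] c by (simp add: m_ac)
  qed
  moreover have "q \<otimes> a \<in> L" "q \<otimes> a \<noteq> \<zero>"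
    using q a c subringE(6)[OF L] integral_iff by auto
  ultimately show ?case
    by blast
qed

section \<open>Monomials as multisets and algebraic independence\<close>

definition mset_val :: "'a multiset \<Rightarrow> 'a" where
  "mset_val M = (\<Otimes>x\<in>set_mset M. x [^] count M x)"

lemma mset_val_closed [simp]: "set_mset M \<subseteq> carrier R \<Longrightarrow> mset_val M \<in> carrier R"
  unfolding mset_val_def by (intro finprod_closed) auto

lemma mset_val_eq:
  assumes "finite A" "set_mset M \<subseteq> A" "A \<subseteq> carrier R"
  shows "mset_val M = (\<Otimes>x\<in>A. x [^] count M x)"
  unfolding mset_val_def
  by (rule finprod_mono_neutral_cong_left) (use assms in \<open>auto simp: not_in_iff\<close>)

lemma mset_val_add:
  assumes "set_mset M \<subseteq> carrier R" "set_mset N \<subseteq> carrier R"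
  shows "mset_val (M + N) = mset_val M \<otimes> mset_val N"
proof -
  let ?A = "set_mset M \<union> set_mset N"
  have A: "finite ?A" "?A \<subseteq> carrier R" "set_mset (M + N) \<subseteq> ?A" "set_mset M \<subseteq> ?A" "set_mset N \<subseteq> ?A"
    using assms by auto
  have "mset_val (M + N) = (\<Otimes>x\<in>?A. x [^] count M x \<otimes> x [^] count N x)"
    unfolding mset_val_eq[OF A(1,3,2)]
    by (rule finprod_cong') (use assms in \<open>auto simp: nat_pow_mult\<close>)
  also have "\<dots> = mset_val M \<otimes> mset_val N"
    unfolding mset_val_eq[OF A(1,4,2)] mset_val_eq[OF A(1,5,2)]
    by (rule finprod_multf) (use assms in auto)
  finally show ?thesis .
qed

lemma mset_val_empty [simp]: "mset_val {#} = \<one>"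
  by (simp add: mset_val_def)

lemma mset_val_single [simp]: "x \<in> carrier R \<Longrightarrow> mset_val {#x#} = x"
  by (simp add: mset_val_def Pi_iff)

lemma indexed_single:
  assumes F: "\<zero> \<in> F" "F \<subseteq> carrier R" and c: "c \<in> F" and M: "set_mset M \<subseteq> B"
  shows "(\<lambda>m. if m = M then c else \<zero>) \<in> indexed_pset B F"
  using M
proof (induction M)
  case empty
  have "indexed_const c \<in> indexed_pset B F"
    by (rule indexed_pset.indexed_const[OF c])
  then show ?case
    by (simp add: indexed_const_def)
next
  case (add x M)
  then have "indexed_pmult (\<lambda>m. if m = M then c else \<zero>) x \<in> indexed_pset B F"
    by (intro indexed_pset.indexed_pmult) auto
  moreover have "indexed_pmult (\<lambda>m. if m = M then c else \<zero>) x = (\<lambda>m. if m = add_mset x M then c else \<zero>)"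
    by (auto simp: indexed_pmult_def fun_eq_iff)
  ultimately show ?case
    by simp
qed

text \<open>A converse to \<open>indexed_pset_finite_support\<close>: coefficients can be prescribed
  on any finite set of monomials, so that a linear relation between monomials becomes a member of
  \<open>indexed_pset\<close>.\<close>

lemma indexed_finite_support:
  assumes F: "\<zero> \<in> F" "F \<subseteq> carrier R"
    and S: "finite S" "\<And>M. M \<in> S \<Longrightarrow> set_mset M \<subseteq> B" "\<And>M. M \<in> S \<Longrightarrow> f M \<in> F"
  shows "(\<lambda>m. if m \<in> S then f m else \<zero>) \<in> indexed_pset B F"
  using S
proof (induction S)
  case empty
  then show ?case
    using indexed_pset.indexed_const[OF F(1), of B] by (simp add: indexed_const_def)
next
  case (insert M S)
  have "indexed_padd (\<lambda>m. if m = M then f M else \<zero>) (\<lambda>m. if m \<in> S then f m else \<zero>) \<in> indexed_pset B F"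
    using insert F by (intro indexed_pset.indexed_padd indexed_single) auto
  moreover have "indexed_padd (\<lambda>m. if m = M then f M else \<zero>) (\<lambda>m. if m \<in> S then f m else \<zero>)
      = (\<lambda>m. if m \<in> insert M S then f m else \<zero>)"
  proof -
    have "f m \<in> carrier R" if "m \<in> insert M S" for m
      using insert.prems(2)[OF that] F(2) by auto
    then show ?thesis
      using insert.hyps(2) by (auto simp: indexed_padd_def fun_eq_iff)
  qed
  ultimately show ?case
    by simp
qed

text \<open>The relation is the vanishing of \<open>indexed_value\<close> at the polynomial with
  coefficients \<open>f\<close> on \<open>S\<close> and zero elsewhere.\<close>

lemma algebraically_independent_monomials:
  assumes ind: "algebraically_independent R F B" and F: "\<zero> \<in> F" "F \<subseteq> carrier R"
    and S: "finite S" "\<And>M. M \<in> S \<Longrightarrow> set_mset M \<subseteq> B" "\<And>M. M \<in> S \<Longrightarrow> f M \<in> F"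
    and sum: "(\<Oplus>M\<in>S. f M \<otimes> mset_val M) = \<zero>" and M: "M \<in> S"
  shows "f M = \<zero>"
proof -
  have B: "B \<subseteq> carrier R"
    using ind by (simp add: algebraically_independent_def)
  let ?P = "\<lambda>m. if m \<in> S then f m else \<zero>"
  have P: "?P \<in> indexed_pset B F"
    by (rule indexed_finite_support[OF F S])
  have "indexed_value R ?P = (\<Oplus>m\<in>{m. ?P m \<noteq> \<zero>}. ?P m \<otimes> mset_val m)"
    by (simp add: indexed_value_def mset_val_def)
  also have "\<dots> = (\<Oplus>m\<in>S. f m \<otimes> mset_val m)"
  proof (rule add.finprod_mono_neutral_cong_left)
    show "(\<lambda>m. f m \<otimes> mset_val m) \<in> S \<rightarrow> carrier R"
      using S(2,3) F(2) B by (intro Pi_I m_closed mset_val_closed) blast+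
    show "{m. ?P m \<noteq> \<zero>} \<subseteq> S"
      by auto
    fix m assume "m \<in> S - {m. ?P m \<noteq> \<zero>}"
    then have "m \<in> S" "f m = \<zero>"
      by auto
    then show "f m \<otimes> mset_val m = \<zero>"
      using S(2) B by (metis l_null mset_val_closed order_trans)
  qed (use S in auto)
  finally have "indexed_value R ?P = \<zero>"
    using sum by simp
  then have "?P = (\<lambda>_. \<zero>)"
    using ind P by (simp add: algebraically_independent_def)
  then show ?thesis
    using M by (meson)
qed

lemma finsum_image_inv_into:
  assumes "inj_on h A" "\<And>a. a \<in> A \<Longrightarrow> G a (h a) \<in> carrier R"
  shows "(\<Oplus>M\<in>h ` A. G (inv_into A h M) M) = (\<Oplus>a\<in>A. G a (h a))"
proof -
  have "(\<Oplus>M\<in>h ` A. G (inv_into A h M) M) = (\<Oplus>a\<in>A. G (inv_into A h (h a)) (h a))"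
    using assms by (intro finsum_reindex) auto
  also have "\<dots> = (\<Oplus>a\<in>A. G a (h a))"
    using assms by (intro finsum_cong') auto
  finally show ?thesis .
qed

text \<open>Reindexing along \<open>h\<close>, for relations whose terms are named by something
  other than multisets.\<close>

lemma algebraically_independent_family:
  assumes ind: "algebraically_independent R F B" and F: "\<zero> \<in> F" "F \<subseteq> carrier R"
    and A: "finite A" "inj_on h A" "\<And>a. a \<in> A \<Longrightarrow> set_mset (h a) \<subseteq> B" "\<And>a. a \<in> A \<Longrightarrow> f a \<in> F"
    and sum: "(\<Oplus>a\<in>A. f a \<otimes> mset_val (h a)) = \<zero>" and a: "a \<in> A"
  shows "f a = \<zero>"
proof -
  have B: "B \<subseteq> carrier R"
    using ind by (simp add: algebraically_independent_def)
  have c: "f b \<otimes> mset_val (h b) \<in> carrier R" if "b \<in> A" for b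
    using A(4)[OF that] F(2) mset_val_closed[OF order_trans[OF A(3)[OF that] B]] by auto
  have sum': "(\<Oplus>M\<in>h ` A. f (inv_into A h M) \<otimes> mset_val M) = \<zero>"
    using finsum_image_inv_into[OF A(2), of "\<lambda>a M. f a \<otimes> mset_val M"] c sum by simp
  have "f (inv_into A h (h a)) = \<zero>"
  proof (rule algebraically_independent_monomials[OF ind F _ _ _ sum'])
    fix M assume "M \<in> h ` A"
    then obtain b where b: "b \<in> A" "M = h b"
      by blast
    show "set_mset M \<subseteq> B" "f (inv_into A h M) \<in> F"
      using A(3,4)[OF b(1)] b A(2) by simp_all
  qed (use A(1) a in auto)
  then show ?thesis
    using A(2) a by simp
qed

section \<open>Polynomial subrings and their fractions\<close>

definition polys :: "'a set \<Rightarrow> 'a set \<Rightarrow> 'a set" where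
  "polys F C = span_over F mset_val {M. set_mset M \<subseteq> C}"

lemma polys_subring:
  assumes F: "subring F R" and C: "C \<subseteq> carrier R"
  shows "subring (polys F C) R"
  unfolding polys_def
proof (rule span_over_subring[OF F])
  have mc: "mset_val M \<in> carrier R" if "M \<in> {M. set_mset M \<subseteq> C}" for M
    using that C by (intro mset_val_closed) auto
  then show "\<And>M. M \<in> {M. set_mset M \<subseteq> C} \<Longrightarrow> mset_val M \<in> carrier R" .
  show "\<one> \<in> span_over F mset_val {M. set_mset M \<subseteq> C}"
    using span_over_base[OF F, where \<phi> = mset_val and i = "{#}" and S = "{M. set_mset M \<subseteq> C}"] mc by simp
  fix M N assume "M \<in> {M. set_mset M \<subseteq> C}" "N \<in> {M. set_mset M \<subseteq> C}"
  then show "mset_val M \<otimes> mset_val N \<in> span_over F mset_val {M. set_mset M \<subseteq> C}"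
    using span_over_base[OF F, where \<phi> = mset_val and i = "M + N" and S = "{M. set_mset M \<subseteq> C}"] mc
      mset_val_add[of M N] C by auto
qed

lemma polys_mono: "C \<subseteq> C' \<Longrightarrow> polys F C \<subseteq> polys F C'"
  unfolding polys_def using span_over_mono[of "{M. set_mset M \<subseteq> C}" "{M. set_mset M \<subseteq> C'}"] by blast

lemma polys_base:
  assumes F: "subring F R" and C: "C \<subseteq> carrier R"
  shows "F \<subseteq> polys F C" "C \<subseteq> polys F C"
proof -
  have mc: "mset_val M \<in> carrier R" if "M \<in> {M. set_mset M \<subseteq> C}" for M
    using that C by (intro mset_val_closed) auto
  show "F \<subseteq> polys F C"
  proof
    fix c assume "c \<in> F"
    then show "c \<in> polys F C"
      using span_over_single[OF subringE(1)[OF F], where \<phi> = mset_val and i = "{#}" and c = c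
          and S = "{M. set_mset M \<subseteq> C}"] subringE(1)[OF F]
      by (auto simp: polys_def)
  qed
  show "C \<subseteq> polys F C"
  proof
    fix c assume "c \<in> C"
    then show "c \<in> polys F C"
      using span_over_base[OF F, where \<phi> = mset_val and i = "{#c#}" and S = "{M. set_mset M \<subseteq> C}"] mc C
      by (auto simp: polys_def)
  qed
qed

text \<open>The fractions in a fixed finite set of variables form a field, and two such fields lie
  in the one for the union of the variables. So the union over all finite sets is closed under the
  field operations.\<close>

lemma generate_field_finite_polys:
  assumes F: "subfield F R" and B: "B \<subseteq> carrier R" and z: "z \<in> generate_field R (F \<union> B)"
  shows "\<exists>B0. finite B0 \<and> B0 \<subseteq> B \<and> z \<in> fracs (polys F B0) (polys F B0)"
proof -
  note Fr = subfieldE(1)[OF F]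
  have sf: "subfield (fracs (polys F C) (polys F C)) R" if "C \<subseteq> B" for C
    using that B by (intro fracs_subfield polys_subring[OF Fr]) auto
  have mono: "fracs (polys F C) (polys F C) \<subseteq> fracs (polys F C') (polys F C')" if "C \<subseteq> C'" for C C'
    using polys_mono[OF that] by (intro fracs_mono)
  have base: "polys F C \<subseteq> fracs (polys F C) (polys F C)" if "C \<subseteq> B" for C
    using that B polys_subring[OF Fr, of C] by (intro fracs_base) (auto dest: subringE(1))
  have join: "\<exists>B0. finite B0 \<and> B0 \<subseteq> B \<and> x \<in> fracs (polys F B0) (polys F B0) \<and> y \<in> fracs (polys F B0) (polys F B0)"
    if x: "\<exists>B0. finite B0 \<and> B0 \<subseteq> B \<and> x \<in> fracs (polys F B0) (polys F B0)"
      and y: "\<exists>B0. finite B0 \<and> B0 \<subseteq> B \<and> y \<in> fracs (polys F B0) (polys F B0)" for x y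
  proof -
    obtain B1 B2 where "finite B1" "B1 \<subseteq> B" "x \<in> fracs (polys F B1) (polys F B1)"
      "finite B2" "B2 \<subseteq> B" "y \<in> fracs (polys F B2) (polys F B2)"
      using x y by blast
    then show ?thesis
      using mono[of B1 "B1 \<union> B2"] mono[of B2 "B1 \<union> B2"] by (intro exI[of _ "B1 \<union> B2"]) auto
  qed
  note sr = subfieldE(1)[OF sf]
  show ?thesis
    using z
  proof induction
    case one
    then show ?case
      using subringE(3)[OF sr[of "{}"]] by (intro exI[of _ "{}"]) auto
  next
    case (incl h)
    then consider "h \<in> F" | "h \<in> B"
      by auto
    then show ?case
    proof cases
      case 1
      then show ?thesis
        using base[of "{}"] polys_base(1)[OF Fr, of "{}"] by (intro exI[of _ "{}"]) auto
    next
      case 2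
      then show ?thesis
        using base[of "{h}"] polys_base(2)[OF Fr, of "{h}"] B by (intro exI[of _ "{h}"]) auto
    qed
  next
    case (a_inv h)
    then show ?case
      using subringE(5)[OF sr] by blast
  next
    case (m_inv h)
    then obtain B0 where B0: "finite B0" "B0 \<subseteq> B" "h \<in> fracs (polys F B0) (polys F B0)"
      by blast
    then have "inv h \<in> fracs (polys F B0) (polys F B0)"
      using subfield_m_inv(1)[OF sf[OF B0(2)], of h] m_inv(2) by auto
    then show ?case
      using B0 by blast
  next
    case (eng_add h1 h2)
    then show ?case
      using join[of h1 h2] subringE(7)[OF sr] by meson
  next
    case (eng_mult h1 h2)
    then show ?case
      using join[of h1 h2] subringE(6)[OF sr] by meson
  qed
qed

lemma finite_generate_field_polys:
  assumes F: "subfield F R" and B: "B \<subseteq> carrier R" and Z: "finite Z" "Z \<subseteq> generate_field R (F \<union> B)"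
  obtains B0 where "finite B0" "B0 \<subseteq> B" "Z \<subseteq> fracs (polys F B0) (polys F B0)"
proof -
  obtain b where b: "\<And>z. z \<in> Z \<Longrightarrow> finite (b z) \<and> b z \<subseteq> B \<and> z \<in> fracs (polys F (b z)) (polys F (b z))"
    using generate_field_finite_polys[OF F B] Z(2) by (metis subsetD)
  have "Z \<subseteq> fracs (polys F (\<Union>(b ` Z))) (polys F (\<Union>(b ` Z)))"
  proof
    fix z assume z: "z \<in> Z"
    then have "polys F (b z) \<subseteq> polys F (\<Union>(b ` Z))"
      by (intro polys_mono) auto
    then show "z \<in> fracs (polys F (\<Union>(b ` Z))) (polys F (\<Union>(b ` Z)))"
      using fracs_mono b[OF z] by blast
  qed
  moreover have "finite (\<Union>(b ` Z))" "\<Union>(b ` Z) \<subseteq> B"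
    using b Z(1) by auto
  ultimately show ?thesis
    using that by blast
qed

lemma combine_map:
  assumes "distinct us" "set us \<subseteq> carrier R" "\<And>u. u \<in> set us \<Longrightarrow> c u \<in> carrier R"
  shows "combine (map c us) us = (\<Oplus>u\<in>set us. c u \<otimes> u)"
  using assms
proof (induction us)
  case (Cons u us)
  have "(\<Oplus>u\<in>set (u # us). c u \<otimes> u) = c u \<otimes> u \<oplus> (\<Oplus>u\<in>set us. c u \<otimes> u)"
    using Cons.prems unfolding list.set by (intro finsum_insert) (auto intro!: m_closed)
  then show ?case
    using Cons by simp
qed simp

lemma independent_sum:
  assumes L: "subfield L R" and us: "independent L us" and c: "\<And>u. u \<in> set us \<Longrightarrow> c u \<in> L"
    and sum: "(\<Oplus>u\<in>set us. c u \<otimes> u) = \<zero>" and u: "u \<in> set us"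
  shows "c u = \<zero>"
proof -
  have "combine (map c us) us = \<zero>"
    using sum combine_map[OF independent_distinct[OF L us] independent_in_carrier[OF us], of c]
      c subfieldE(3)[OF L] by auto
  moreover have "set (map c us) \<subseteq> L"
    using c by auto
  ultimately have "set (take (length us) (map c us)) \<subseteq> {\<zero>}"
    by (intro independent_imp_trivial_combine[OF L us])
  then show ?thesis
    using u by auto
qed

lemma Span_span_over:
  assumes L: "subfield L R" and us: "set us \<subseteq> carrier R" and a: "a \<in> Span L us"
  shows "a \<in> span_over L (\<lambda>u. u) (set us)"
proof -
  note Lr = subfieldE(1)[OF L]
  have id: "\<And>u. u \<in> set us \<Longrightarrow> u \<in> carrier R"
    using us by auto
  have "subalgebra L (span_over L (\<lambda>u. u) (set us)) R"
  proof -
    have "subgroup (span_over L (\<lambda>u. u) (set us)) (add_monoid R)"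
    proof (rule add.subgroupI)
      show "span_over L (\<lambda>u. u) (set us) \<subseteq> carrier R"
        using span_over_closed[OF subringE(1)[OF Lr] id] by auto
      show "span_over L (\<lambda>u. u) (set us) \<noteq> {}"
        using span_over.zero by auto
    qed (auto intro: span_over_minus[OF Lr id] span_over_add[OF subringE(1)[OF Lr] id])
    then show ?thesis
      using span_over_smult[OF Lr id] by (auto simp: subalgebra_def subalgebra_axioms_def)
  qed
  moreover have "set us \<subseteq> span_over L (\<lambda>u. u) (set us)"
    using span_over_base[OF Lr id] by auto
  ultimately show ?thesis
    using subalgebra_Span_incl[OF L] a by blast
qed

lemma finsum_product:
  assumes "finite A" "finite B" "\<And>a b. \<lbrakk>a \<in> A; b \<in> B\<rbrakk> \<Longrightarrow> f a b \<in> carrier R"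
  shows "(\<Oplus>a\<in>A. \<Oplus>b\<in>B. f a b) = (\<Oplus>x\<in>A \<times> B. case x of (a, b) \<Rightarrow> f a b)"
  using assms(1,3)
proof (induction A)
  case (insert a A)
  have "(\<Oplus>x\<in>insert a A \<times> B. case x of (a, b) \<Rightarrow> f a b) = (\<Oplus>x\<in>Pair a ` B \<union> A \<times> B. case x of (a, b) \<Rightarrow> f a b)"
    by (rule arg_cong[where f = "finsum R _"]) auto
  also have "\<dots> = (\<Oplus>x\<in>Pair a ` B. case x of (a, b) \<Rightarrow> f a b) \<oplus> (\<Oplus>x\<in>A \<times> B. case x of (a, b) \<Rightarrow> f a b)"
    using insert assms(2) by (intro finsum_Un_disjoint) auto
  also have "(\<Oplus>x\<in>Pair a ` B. case x of (a, b) \<Rightarrow> f a b) = (\<Oplus>b\<in>B. f a b)"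
    using insert.prems by (subst finsum_reindex) (auto simp: inj_on_def)
  also have "(\<Oplus>b\<in>B. f a b) \<oplus> (\<Oplus>x\<in>A \<times> B. case x of (a, b) \<Rightarrow> f a b) = (\<Oplus>b\<in>B. f a b) \<oplus> (\<Oplus>a\<in>A. \<Oplus>b\<in>B. f a b)"
    using insert by simp
  also have "\<dots> = (\<Oplus>a\<in>insert a A. \<Oplus>b\<in>B. f a b)"
    using insert by (intro finsum_insert[symmetric]) (auto intro!: finsum_closed)
  finally show ?case
    by simp
qed simp

text \<open>Expanding each coefficient into monomials \<open>L\<close> over \<open>C\<close> gives a
  relation over \<open>F\<close> between the products \<open>M + L\<close>. These are pairwise
  different, as \<open>L\<close> is recovered from the sum by keeping the variables in
  \<open>C\<close>.\<close>

lemma polys_independent: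
  assumes ind: "algebraically_independent R F B" and F: "subring F R" and C: "C \<subseteq> B"
    and S: "finite S" "\<And>M. M \<in> S \<Longrightarrow> set_mset M \<subseteq> B - C" "\<And>M. M \<in> S \<Longrightarrow> g M \<in> polys F C"
    and sum: "(\<Oplus>M\<in>S. g M \<otimes> mset_val M) = \<zero>" and M: "M \<in> S"
  shows "g M = \<zero>"
proof -
  note Fc = subringE(1)[OF F]
  have B: "B \<subseteq> carrier R"
    using ind by (simp add: algebraically_independent_def)
  have mC: "mset_val L \<in> carrier R" if "set_mset L \<subseteq> B" for L
    using that B by (intro mset_val_closed) auto
  have mCC: "mset_val L \<in> carrier R" if "L \<in> {L. set_mset L \<subseteq> C}" for L
    using that C by (intro mC) auto
  have "\<forall>M\<in>S. \<exists>T f. finite T \<and> T \<subseteq> {L. set_mset L \<subseteq> C} \<and> (\<forall>L. f L \<in> F) \<and> g M = (\<Oplus>L\<in>T. f L \<otimes> mset_val L)"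
  proof
    fix M assume "M \<in> S"
    then have "g M \<in> span_over F mset_val {L. set_mset L \<subseteq> C}"
      using S(3) by (simp add: polys_def)
    then show "\<exists>T f. finite T \<and> T \<subseteq> {L. set_mset L \<subseteq> C} \<and> (\<forall>L. f L \<in> F) \<and> g M = (\<Oplus>L\<in>T. f L \<otimes> mset_val L)"
    proof (rule span_over_coeffs[OF F, rotated])
      fix L assume "L \<in> {L. set_mset L \<subseteq> C}"
      then show "mset_val L \<in> carrier R"
        by (rule mCC)
    qed blast
  qed
  from bchoice[OF this] obtain T where "\<forall>M\<in>S. \<exists>f. finite (T M) \<and> T M \<subseteq> {L. set_mset L \<subseteq> C}
      \<and> (\<forall>L. f L \<in> F) \<and> g M = (\<Oplus>L\<in>T M. f L \<otimes> mset_val L)"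
    by blast
  from bchoice[OF this] obtain f where Tf: "\<forall>M\<in>S. finite (T M) \<and> T M \<subseteq> {L. set_mset L \<subseteq> C}
      \<and> (\<forall>L. f M L \<in> F) \<and> g M = (\<Oplus>L\<in>T M. f M L \<otimes> mset_val L)"
    by blast
  \<comment> \<open>One finite index set serves all the expansions, with \<open>h\<close> extending
    the coefficients by zero.\<close>
  define U where "U = (\<Union>M\<in>S. T M)"
  define h where "h = (\<lambda>M L. if L \<in> T M then f M L else \<zero>)"
  have U: "finite U" "\<And>L. L \<in> U \<Longrightarrow> set_mset L \<subseteq> C"
    using Tf S(1) by (auto simp: U_def)
  have hF: "h M L \<in> F" if "M \<in> S" for M L
    using Tf that subringE(2)[OF F] by (simp add: h_def)
  have gh: "g M = (\<Oplus>L\<in>U. h M L \<otimes> mset_val L)" if M: "M \<in> S" for M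
  proof -
    have "(\<Oplus>L\<in>T M. f M L \<otimes> mset_val L) = (\<Oplus>L\<in>U. h M L \<otimes> mset_val L)"
    proof (rule add.finprod_mono_neutral_cong_left)
      show "(\<lambda>L. h M L \<otimes> mset_val L) \<in> U \<rightarrow> carrier R"
      proof (rule Pi_I)
        fix L assume L: "L \<in> U"
        show "h M L \<otimes> mset_val L \<in> carrier R"
          by (intro m_closed subsetD[OF Fc hF[OF M]] mC order_trans[OF U(2)[OF L] C])
      qed
      show "T M \<subseteq> U"
        using M by (auto simp: U_def)
      fix L assume "L \<in> U - T M"
      then show "h M L \<otimes> mset_val L = \<zero>"
        using U(2)[of L] mC[of L] C by (auto simp: h_def)
    qed (use U(1) in \<open>auto simp: h_def\<close>)
    then show ?thesis
      using Tf M by simp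
  qed
  have tc: "h M L \<in> carrier R" "mset_val M \<in> carrier R" "mset_val L \<in> carrier R" if "M \<in> S" "L \<in> U" for M L
  proof -
    show "h M L \<in> carrier R"
      by (rule subsetD[OF Fc hF[OF that(1)]])
    show "mset_val M \<in> carrier R"
      using S(2)[OF that(1)] by (intro mC) blast
    show "mset_val L \<in> carrier R"
      by (rule mC[OF order_trans[OF U(2)[OF that(2)] C]])
  qed
  have inj: "inj_on (\<lambda>(M, L). M + L) (S \<times> U)"
  proof (rule inj_onI, clarify)
    fix M L M' L' assume ml: "M \<in> S" "M' \<in> S" "L \<in> U" "L' \<in> U" "M + L = M' + L'"
    have S0: "filter_mset (\<lambda>x. x \<in> C) N = {#}" if "N \<in> S" for N
      by (rule multiset_eqI) (use S(2)[OF that] in \<open>auto simp: count_eq_zero_iff\<close>)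
    have U0: "filter_mset (\<lambda>x. x \<in> C) N = N" if "N \<in> U" for N
      by (rule multiset_eqI) (use U(2)[OF that] in \<open>auto simp: count_eq_zero_iff\<close>)
    have "L = filter_mset (\<lambda>x. x \<in> C) (M + L)"
      by (simp only: filter_union_mset S0[OF ml(1)] U0[OF ml(3)] add_0)
    also have "\<dots> = L'"
      by (simp only: ml(5) filter_union_mset S0[OF ml(2)] U0[OF ml(4)] add_0)
    finally have "L = L'" .
    then show "M = M' \<and> L = L'"
      using ml(5) by simp
  qed
  have "(\<Oplus>x\<in>S \<times> U. case x of (M, L) \<Rightarrow> h M L \<otimes> mset_val (M + L)) = (\<Oplus>M\<in>S. \<Oplus>L\<in>U. h M L \<otimes> mset_val (M + L))"
  proof (rule finsum_product[symmetric, OF S(1) U(1)])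
    fix M L assume ml: "M \<in> S" "L \<in> U"
    have "set_mset (M + L) \<subseteq> B"
      using S(2)[OF ml(1)] U(2)[OF ml(2)] C by auto
    then show "h M L \<otimes> mset_val (M + L) \<in> carrier R"
      using tc(1)[OF ml] mC by simp
  qed
  also have "\<dots> = (\<Oplus>M\<in>S. g M \<otimes> mset_val M)"
  proof (rule finsum_cong')
    show "(\<lambda>M. g M \<otimes> mset_val M) \<in> S \<rightarrow> carrier R"
    proof (rule Pi_I)
      fix M assume M: "M \<in> S"
      have "g M \<in> carrier R"
        using S(3)[OF M] subringE(1)[OF polys_subring[OF F order_trans[OF C B]]] by blast
      moreover have "mset_val M \<in> carrier R"
        using S(2)[OF M] by (intro mC) blast
      ultimately show "g M \<otimes> mset_val M \<in> carrier R"
        by simp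
    qed
    fix M assume M: "M \<in> S"
    have "g M \<otimes> mset_val M = (\<Oplus>L\<in>U. (h M L \<otimes> mset_val L) \<otimes> mset_val M)"
      unfolding gh[OF M]
    proof (rule finsum_ldistr[OF U(1)])
      show "mset_val M \<in> carrier R"
        using S(2)[OF M] by (intro mC) blast
    qed (use tc[OF M] in \<open>auto simp: Pi_iff\<close>)
    also have "\<dots> = (\<Oplus>L\<in>U. h M L \<otimes> mset_val (M + L))"
    proof (rule finsum_cong')
      fix L assume L: "L \<in> U"
      have "set_mset M \<subseteq> carrier R" "set_mset L \<subseteq> carrier R"
        using S(2)[OF M] U(2)[OF L] C B by auto
      then show "(h M L \<otimes> mset_val L) \<otimes> mset_val M = h M L \<otimes> mset_val (M + L)"
        using tc[OF M L] by (simp add: mset_val_add m_ac)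
    next
      show "(\<lambda>L. h M L \<otimes> mset_val (M + L)) \<in> U \<rightarrow> carrier R"
      proof (rule Pi_I)
        fix L assume L: "L \<in> U"
        have "set_mset (M + L) \<subseteq> B"
          using S(2)[OF M] U(2)[OF L] C by auto
        then show "h M L \<otimes> mset_val (M + L) \<in> carrier R"
          using tc(1)[OF M L] mC by simp
      qed
    qed simp
    finally show "(\<Oplus>L\<in>U. h M L \<otimes> mset_val (M + L)) = g M \<otimes> mset_val M"
      by simp
  qed simp
  finally have sum': "(\<Oplus>x\<in>S \<times> U. (case x of (M, L) \<Rightarrow> h M L) \<otimes> mset_val (case x of (M, L) \<Rightarrow> M + L)) = \<zero>"
    using sum by (simp add: case_prod_unfold)
  have "h M L = \<zero>" if L: "L \<in> U" for L
  proof -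
    have "(case (M, L) of (M, L) \<Rightarrow> h M L) = \<zero>"
    proof (rule algebraically_independent_family[OF ind subringE(2)[OF F] Fc _ inj _ _ sum'])
      fix x assume "x \<in> S \<times> U"
      then obtain N N' where x: "x = (N, N')" "N \<in> S" "N' \<in> U"
        by auto
      show "set_mset (case x of (M, L) \<Rightarrow> M + L) \<subseteq> B"
        using x S(2)[OF x(2)] U(2)[OF x(3)] C by auto
      show "(case x of (M, L) \<Rightarrow> h M L) \<in> F"
        using x hF by simp
    qed (use S(1) U(1) M L in auto)
    then show ?thesis
      by simp
  qed
  then have "g M = (\<Oplus>L\<in>U. \<zero>)"
    unfolding gh[OF M] using mC[OF order_trans[OF U(2) C]] by (intro finsum_cong') auto
  then show ?thesis
    by simp
qed

end


section \<open>Finite extensions of purely transcendental extensions\<close>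

context field
begin

lemma mset_val_in_subring:
  assumes L: "subring L R" and M: "set_mset M \<subseteq> L"
  shows "mset_val M \<in> L"
  using M
proof (induction M)
  case empty
  then show ?case
    using subringE(3)[OF L] by simp
next
  case (add x M)
  have xM: "x \<in> L" "x \<in> carrier R" "set_mset M \<subseteq> carrier R"
    using add.prems subringE(1)[OF L] by auto
  have "mset_val (add_mset x M) = x \<otimes> mset_val M"
    using mset_val_add[of "{#x#}" M] xM by simp
  then show ?case
    using add xM subringE(6)[OF L] by simp
qed

lemma polys_subset:
  assumes L: "subring L R" and "F \<subseteq> L" "C \<subseteq> L"
  shows "polys F C \<subseteq> L"
proof
  fix x assume "x \<in> polys F C"
  then show "x \<in> L"
    unfolding polys_def
  proof induction
    case zero
    then show ?case
      by (rule subringE(2)[OF L])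
  next
    case (add c M x)
    then have "mset_val M \<in> L"
      using assms(3) by (intro mset_val_in_subring[OF L]) auto
    then show ?case
      using add assms(2) subringE(6,7)[OF L] by blast
  qed
qed

lemma subring_finsum:
  assumes L: "subring L R" and "finite A" "\<And>i. i \<in> A \<Longrightarrow> f i \<in> L"
  shows "finsum R f A \<in> L"
proof (rule subalgebra_finsum[OF _ assms(2,3)])
  show "subalgebra {} L R"
    using subring.axioms(1)[OF L] by (simp add: subalgebra_def subalgebra_axioms_def)
qed

text \<open>Only finitely many variables occur in the structure constants of a basis; they go into \<open>F\<close>
  together with the basis, and the remaining variables stay independent over \<open>F\<close>.\<close>

lemma finite_extension_variables:
  assumes K0: "subfield K0 R" and L: "subfield L R"
    and pt: "purely_transcendental_basis R K0 L B" and inf: "infinite B"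
    and fd: "finite_dimension L (carrier R)"
  obtains F and y :: "nat \<Rightarrow> 'a" where "subring F R" "inj y" "range y \<subseteq> carrier R"
    and "\<And>S g M. \<lbrakk>finite S; \<And>M. M \<in> S \<Longrightarrow> set_mset M \<subseteq> range y; \<And>M. M \<in> S \<Longrightarrow> g M \<in> F;
      (\<Oplus>M\<in>S. g M \<otimes> mset_val M) = \<zero>; M \<in> S\<rbrakk> \<Longrightarrow> g M = \<zero>"
    and "carrier R \<subseteq> fracs (polys F (range y)) (polys F (range y))"
proof -
  have ind: "algebraically_independent R K0 B" and Leq: "L = generate_field R (K0 \<union> B)"
    using pt by (auto simp: purely_transcendental_basis_def)
  have B: "B \<subseteq> carrier R"
    using ind by (simp add: algebraically_independent_def)
  note K0r = subfieldE(1)[OF K0] and Lr = subfieldE(1)[OF L]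
  note Lc = subringE(1)[OF Lr]
  have BL: "B \<subseteq> L" "K0 \<subseteq> L"
    unfolding Leq by (auto intro: generate_field.incl)
  obtain n where "dimension n L (carrier R)"
    using fd by (auto simp: finite_dimension_def)
  then obtain us where us: "set us \<subseteq> carrier R" "independent L us" "Span L us = carrier R"
    using exists_base[OF L] by blast
  let ?U = "set us"
  have idc: "u \<in> carrier R" if "u \<in> ?U" for u
    using us(1) that by auto
  have "\<exists>c. (\<forall>u. c u \<in> L) \<and> a = (\<Oplus>u\<in>?U. c u \<otimes> u)" if "a \<in> carrier R" for a
  proof -
    have "a \<in> span_over L (\<lambda>u. u) ?U"
      using Span_span_over[OF L us(1)] us(3) that by blast
    from span_over_coeffs_finite[OF Lr _ _ this] show ?thesis
      using idc by (metis List.finite_set)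
  qed
  then obtain co where co: "\<And>a u. a \<in> carrier R \<Longrightarrow> co a u \<in> L"
    "\<And>a. a \<in> carrier R \<Longrightarrow> a = (\<Oplus>u\<in>?U. co a u \<otimes> u)"
    by metis
  \<comment> \<open>The coordinates of the unit and of all products of two basis vectors, that is,
    the structure constants of the extension.\<close>
  define Z where "Z = (\<lambda>(a, u). co a u) ` (insert \<one> ((\<lambda>(u, v). u \<otimes> v) ` (?U \<times> ?U)) \<times> ?U)"
  have Z: "finite Z" "Z \<subseteq> L"
    using co(1) idc by (auto simp: Z_def)
  obtain B0 where B0: "finite B0" "B0 \<subseteq> B" "Z \<subseteq> fracs (polys K0 B0) (polys K0 B0)"
    using finite_generate_field_polys[OF K0 B Z(1)] Z(2) unfolding Leq by blast
  have P0: "subring (polys K0 B0) R"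
    using polys_subring[OF K0r order_trans[OF B0(2) B]] .
  obtain q where q0: "q \<in> polys K0 B0" "q \<noteq> \<zero>" and qZ: "\<And>z. z \<in> Z \<Longrightarrow> q \<otimes> z \<in> polys K0 B0"
    using common_denominator[OF P0 subringE(1)[OF P0] subringE(6)[OF P0] Z(1) B0(3)] by blast
  have "infinite (B - B0)"
    using inf B0(1) by simp
  \<comment> \<open>The variables \<open>y\<close> avoid \<open>B0\<close>, so the structure
    constants involve only variables that remain in \<open>C\<close>.\<close>
  then obtain y :: "nat \<Rightarrow> 'a" where y: "inj y" "range y \<subseteq> B - B0"
    using infinite_countable_subset by blast
  define C where "C = B - range y"
  have C: "C \<subseteq> B" "B0 \<subseteq> C" "range y \<subseteq> B - C" "B \<subseteq> C \<union> range y"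
    using y B0(2) by (auto simp: C_def)
  define P where "P = polys K0 C"
  have Pr: "subring P R"
    unfolding P_def using polys_subring[OF K0r order_trans[OF C(1) B]] .
  note Pc = subringE(1)[OF Pr]
  have PB0: "polys K0 B0 \<subseteq> P"
    unfolding P_def by (rule polys_mono[OF C(2)])
  have PL: "P \<subseteq> L"
    unfolding P_def using BL C(1) by (intro polys_subset[OF Lr]) auto
  have q: "q \<in> P" "q \<in> carrier R" "q \<in> L"
    using q0 PB0 Pc PL by auto
  \<comment> \<open>The basis is scaled by the common denominator: \<open>q q u v\<close> is a
    combination of the \<open>\<alpha> w\<close> with coefficients \<open>q c\<close>,
    \<open>c\<close> a structure constant, and these lie in \<open>P\<close>. Hence the
    \<open>P\<close>-span of the scaled basis is closed under products.\<close>
  define \<alpha> where "\<alpha> = (\<lambda>u. q \<otimes> u)"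
  have \<alpha>c: "\<alpha> u \<in> carrier R" if "u \<in> ?U" for u
    using idc[OF that] q by (simp add: \<alpha>_def)
  define \<Lambda> where "\<Lambda> = span_over P \<alpha> ?U"
  have \<Lambda>c: "\<Lambda> \<subseteq> carrier R"
    unfolding \<Lambda>_def using span_over_closed[OF Pc, where \<phi> = \<alpha> and S = ?U] \<alpha>c by blast
  have \<Lambda>add: "x \<oplus> z \<in> \<Lambda>" if "x \<in> \<Lambda>" "z \<in> \<Lambda>" for x z
    using that unfolding \<Lambda>_def by (intro span_over_add[OF Pc \<alpha>c])
  have \<Lambda>smult: "c \<otimes> x \<in> \<Lambda>" if "c \<in> P" "x \<in> \<Lambda>" for c x
    using that unfolding \<Lambda>_def by (intro span_over_smult[OF Pr \<alpha>c])
  have scaled: "q \<otimes> (q \<otimes> a) \<in> \<Lambda>" if a: "a \<in> insert \<one> ((\<lambda>(u, v). u \<otimes> v) ` (?U \<times> ?U))" for a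
  proof -
    have ac: "a \<in> carrier R"
      using a idc by auto
    have qco: "q \<otimes> co a u \<in> P" if "u \<in> ?U" for u
      using qZ[of "co a u"] a that PB0 by (force simp: Z_def)
    have "q \<otimes> (q \<otimes> a) = (\<Oplus>u\<in>?U. q \<otimes> (q \<otimes> (co a u \<otimes> u)))"
    proof -
      have c: "co a u \<otimes> u \<in> carrier R" if "u \<in> ?U" for u
        using co(1)[OF ac] Lc idc[OF that] by auto
      have "q \<otimes> a = (\<Oplus>u\<in>?U. q \<otimes> (co a u \<otimes> u))"
        using c q(2) by (subst co(2)[OF ac], intro finsum_rdistr) auto
      then show ?thesis
        using c q(2) finsum_rdistr[of ?U q "\<lambda>u. q \<otimes> (co a u \<otimes> u)"] by (simp add: Pi_iff)
    qed
    also have "\<dots> = (\<Oplus>u\<in>?U. (q \<otimes> co a u) \<otimes> \<alpha> u)"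
    proof (rule finsum_cong')
      fix u assume u: "u \<in> ?U"
      have "co a u \<in> carrier R"
        using co(1)[OF ac] Lc by auto
      then show "q \<otimes> (q \<otimes> (co a u \<otimes> u)) = (q \<otimes> co a u) \<otimes> \<alpha> u"
        using q(2) idc[OF u] by (simp add: \<alpha>_def m_ac)
    qed (use qco Pc \<alpha>c in auto)
    also have "\<dots> \<in> \<Lambda>"
      unfolding \<Lambda>_def using qco by (intro span_over_sum[OF Pr \<alpha>c]) auto
    finally show ?thesis .
  qed
  have \<Lambda>mult: "x \<otimes> z \<in> \<Lambda>" if "x \<in> \<Lambda>" "z \<in> \<Lambda>" for x z
    unfolding \<Lambda>_def
  proof (rule span_over_mult[OF Pr \<alpha>c _ _ _ _ that[unfolded \<Lambda>_def]])
    fix u v assume uv: "u \<in> ?U" "v \<in> ?U"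
    have "q \<otimes> (q \<otimes> (u \<otimes> v)) \<in> \<Lambda>"
      using uv by (intro scaled) force
    then show "\<alpha> u \<otimes> \<alpha> v \<in> span_over P \<alpha> ?U"
      using q(2) idc[OF uv(1)] idc[OF uv(2)] by (simp add: \<alpha>_def \<Lambda>_def m_ac)
  qed auto
  have one\<Lambda>: "q \<otimes> q \<in> \<Lambda>"
    using scaled[of \<one>] q(2) by simp
  \<comment> \<open>Inverting the nonzero elements of \<open>P\<close> recovers the unit and the
    unscaled basis: \<open>F\<close> is the span of the basis over the field of fractions of
    \<open>P\<close>.\<close>
  define F where "F = fracs P \<Lambda>"
  have qq: "q \<otimes> q \<in> P" "q \<otimes> q \<noteq> \<zero>"
    using q q0(2) subringE(6)[OF Pr] integral_iff by auto
  have PF: "P \<subseteq> F"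
  proof
    fix c assume c: "c \<in> P"
    have "c \<otimes> (q \<otimes> q) \<in> \<Lambda>"
      by (rule \<Lambda>smult[OF c one\<Lambda>])
    then have "(q \<otimes> q) \<otimes> c \<in> \<Lambda>"
      using c Pc q(2) by (auto simp: m_ac)
    then show "c \<in> F"
      using c Pc qq by (auto simp: F_def fracs_def)
  qed
  have Fr: "subring F R"
    unfolding F_def using PF by (intro fracs_subring[OF Pr \<Lambda>c] \<Lambda>add \<Lambda>mult \<Lambda>smult) (simp_all add: F_def)
  have UF: "?U \<subseteq> F"
  proof
    fix u assume u: "u \<in> ?U"
    have "q \<otimes> u \<in> \<Lambda>"
      using span_over_base[OF Pr, where \<phi> = \<alpha> and i = u and S = ?U] \<alpha>c u by (simp add: \<Lambda>_def \<alpha>_def)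
    then show "u \<in> F"
      using q q0(2) idc[OF u] by (auto simp: F_def fracs_def)
  qed
  have yc: "range y \<subseteq> carrier R"
    using C B by auto
  show ?thesis
  proof (rule that[OF Fr y(1) yc])
    fix S g M
    assume S: "finite S" "\<And>M. M \<in> S \<Longrightarrow> set_mset M \<subseteq> range y" "\<And>M. M \<in> S \<Longrightarrow> g M \<in> F"
      and sum: "(\<Oplus>M\<in>S. g M \<otimes> mset_val M) = \<zero>" and M: "M \<in> S"
    have gc: "g N \<in> carrier R" if "N \<in> S" for N
      using S(3)[OF that] by (auto simp: F_def fracs_def)
    have mc: "mset_val N \<in> carrier R" if "N \<in> S" for N
      using S(2)[OF that] yc by (intro mset_val_closed) auto
    have mL: "mset_val N \<in> L" if "N \<in> S" for N
      using S(2)[OF that] C(3) BL by (intro mset_val_in_subring[OF Lr]) auto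
    \<comment> \<open>Denominators are cleared, so that all coefficients become
      \<open>P\<close>-combinations of the scaled basis.\<close>
    obtain s where s: "s \<in> P" "s \<noteq> \<zero>" "\<And>N. N \<in> S \<Longrightarrow> s \<otimes> g N \<in> \<Lambda>"
      using common_denominator[OF Pr \<Lambda>c \<Lambda>smult, of "g ` S"] S(1,3) by (auto simp: F_def)
    have sc: "s \<in> carrier R"
      using s(1) Pc by auto
    have "\<exists>h. (\<forall>u. h u \<in> P) \<and> s \<otimes> g N = (\<Oplus>u\<in>?U. h u \<otimes> \<alpha> u)" if N: "N \<in> S" for N
      using s(3)[OF N] unfolding \<Lambda>_def
      by (rule span_over_coeffs_finite[OF Pr \<alpha>c, rotated 2]) auto
    then obtain h where hP: "\<And>N u. N \<in> S \<Longrightarrow> h N u \<in> P"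
      and h: "\<And>N. N \<in> S \<Longrightarrow> s \<otimes> g N = (\<Oplus>u\<in>?U. h N u \<otimes> \<alpha> u)"
      by metis
    have hc: "h N u \<in> carrier R" if "N \<in> S" for N u
      using hP[OF that] Pc by auto
    \<comment> \<open>\<open>k u \<otimes> q\<close> is the coordinate at \<open>u\<close> of the
      relation multiplied by \<open>s\<close>. It lies in \<open>L\<close>, so linear independence
      of the basis splits the relation into one relation over \<open>P\<close> for each
      \<open>u\<close>.\<close>
    define k where "k = (\<lambda>u. \<Oplus>N\<in>S. h N u \<otimes> mset_val N)"
    have kc: "k u \<in> carrier R" for u
      unfolding k_def using hc mc by (intro finsum_closed) auto
    have kL: "k u \<in> L" for u
      unfolding k_def
    proof (rule subring_finsum[OF Lr S(1)])
      fix N assume N: "N \<in> S"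
      show "h N u \<otimes> mset_val N \<in> L"
        by (rule subringE(6)[OF Lr subsetD[OF PL hP[OF N]] mL[OF N]])
    qed
    have "(\<Oplus>u\<in>?U. (k u \<otimes> q) \<otimes> u) = (\<Oplus>u\<in>?U. \<Oplus>N\<in>S. (h N u \<otimes> \<alpha> u) \<otimes> mset_val N)"
    proof (rule finsum_cong')
      fix u assume u: "u \<in> ?U"
      have "(k u \<otimes> q) \<otimes> u = k u \<otimes> \<alpha> u"
        using kc q(2) idc[OF u] by (simp add: \<alpha>_def m_assoc)
      also have "\<dots> = (\<Oplus>N\<in>S. (h N u \<otimes> mset_val N) \<otimes> \<alpha> u)"
        unfolding k_def using S(1) hc mc \<alpha>c[OF u] by (intro finsum_ldistr) auto
      also have "\<dots> = (\<Oplus>N\<in>S. (h N u \<otimes> \<alpha> u) \<otimes> mset_val N)"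
        using hc mc \<alpha>c[OF u] by (intro finsum_cong') (auto simp: m_ac)
      finally show "(k u \<otimes> q) \<otimes> u = (\<Oplus>N\<in>S. (h N u \<otimes> \<alpha> u) \<otimes> mset_val N)" .
    next
      show "(\<lambda>u. \<Oplus>N\<in>S. (h N u \<otimes> \<alpha> u) \<otimes> mset_val N) \<in> ?U \<rightarrow> carrier R"
        using hc mc \<alpha>c by (intro Pi_I finsum_closed) auto
    qed simp
    also have "\<dots> = (\<Oplus>N\<in>S. \<Oplus>u\<in>?U. (h N u \<otimes> \<alpha> u) \<otimes> mset_val N)"
      using S(1) hc mc \<alpha>c by (intro finsum_swap) auto
    also have "\<dots> = (\<Oplus>N\<in>S. s \<otimes> (g N \<otimes> mset_val N))"
    proof (rule finsum_cong')
      fix N assume N: "N \<in> S"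
      have "s \<otimes> (g N \<otimes> mset_val N) = (\<Oplus>u\<in>?U. h N u \<otimes> \<alpha> u) \<otimes> mset_val N"
        using sc gc[OF N] mc[OF N] by (simp add: m_assoc[symmetric] h[OF N])
      also have "\<dots> = (\<Oplus>u\<in>?U. (h N u \<otimes> \<alpha> u) \<otimes> mset_val N)"
        using hc[OF N] mc[OF N] \<alpha>c by (intro finsum_ldistr) auto
      finally show "(\<Oplus>u\<in>?U. (h N u \<otimes> \<alpha> u) \<otimes> mset_val N) = s \<otimes> (g N \<otimes> mset_val N)"
        by simp
    qed (use sc gc mc in auto)
    also have "\<dots> = s \<otimes> (\<Oplus>N\<in>S. g N \<otimes> mset_val N)"
      using S(1) sc gc mc by (intro finsum_rdistr[symmetric]) auto
    also have "\<dots> = \<zero>"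
      using sum sc by simp
    finally have zero: "(\<Oplus>u\<in>?U. (k u \<otimes> q) \<otimes> u) = \<zero>" .
    have "k u \<otimes> q = \<zero>" if "u \<in> ?U" for u
      by (rule independent_sum[OF L us(2) _ zero that]) (use kL q(3) subringE(6)[OF Lr] in auto)
    then have k0: "k u = \<zero>" if "u \<in> ?U" for u
      using that kc q q0(2) integral_iff by auto
    have "h M u = \<zero>" if u: "u \<in> ?U" for u
    proof (rule polys_independent[OF ind K0r C(1) S(1) _ _ _ M])
      show "set_mset N \<subseteq> B - C" if "N \<in> S" for N
        using S(2)[OF that] C(3) by auto
      show "h N u \<in> polys K0 C" if "N \<in> S" for N
        using hP[OF that] by (simp add: P_def)
      show "(\<Oplus>N\<in>S. h N u \<otimes> mset_val N) = \<zero>"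
        using k0[OF u] by (simp add: k_def)
    qed
    then have "s \<otimes> g M = (\<Oplus>u\<in>?U. \<zero>)"
      unfolding h[OF M] using \<alpha>c by (intro finsum_cong') auto
    then have "s \<otimes> g M = \<zero>"
      by simp
    then show "g M = \<zero>"
      using s(2) sc gc[OF M] integral_iff by auto
  next
    let ?P = "polys F (range y)"
    have sr: "subring ?P R"
      by (rule polys_subring[OF Fr yc])
    have sf: "subfield (fracs ?P ?P) R"
      by (rule fracs_subfield[OF sr])
    have PQ: "?P \<subseteq> fracs ?P ?P"
      using fracs_base[OF sr subringE(1)[OF sr]] .
    have FQ: "F \<subseteq> fracs ?P ?P" "range y \<subseteq> fracs ?P ?P"
      using polys_base[OF Fr yc] PQ by auto
    have "K0 \<subseteq> P" "C \<subseteq> P"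
      unfolding P_def using polys_base[OF K0r order_trans[OF C(1) B]] by auto
    \<comment> \<open>\<open>B\<close> is covered by \<open>C\<close> and the variables
      \<open>y\<close>. So the field of fractions contains \<open>L\<close>, and together with the
      basis it contains the whole field.\<close>
    then have "K0 \<union> B \<subseteq> fracs ?P ?P"
      using C(4) PF FQ by blast
    then have LQ: "L \<subseteq> fracs ?P ?P"
      unfolding Leq using B subringE(1)[OF K0r] by (intro generate_field_min_subfield1[OF _ sf]) auto
    show "carrier R \<subseteq> fracs ?P ?P"
    proof
      fix a assume a: "a \<in> carrier R"
      have "(\<Oplus>u\<in>?U. co a u \<otimes> u) \<in> fracs ?P ?P"
      proof (rule subring_finsum[OF subfieldE(1)[OF sf]])
        fix u assume "u \<in> ?U"
        then have "u \<in> fracs ?P ?P" "co a u \<in> fracs ?P ?P"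
          using co(1)[OF a] LQ UF FQ(1) by auto
        then show "co a u \<otimes> u \<in> fracs ?P ?P"
          by (intro subringE(6)[OF subfieldE(1)[OF sf]])
      qed simp
      then show "a \<in> fracs ?P ?P"
        using co(2)[OF a] by simp
    qed
  qed
qed

section \<open>Roots of unity and the characteristic\<close>

lemma eval_root_poly:
  assumes a: "a \<in> carrier R" and x: "x \<in> carrier R"
  shows "eval (\<one> # replicate n \<zero> @ [a]) x = x [^] Suc n \<oplus> a"
proof -
  have "eval (replicate n \<zero> @ [a]) x = a"
    using eval_replicate[of "[a]" x n] a x by simp
  then show ?thesis
    using x by simp
qed

text \<open>Coefficient lists start with the highest degree, so \<open>replicate n \<one>\<close> is
  \<open>1 + X + ... + X^(n-1)\<close>, and the product telescopes as a geometric sum.\<close>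

lemma eval_geometric:
  assumes x: "x \<in> carrier R"
  shows "(x \<ominus> \<one>) \<otimes> eval (replicate n \<one>) x = x [^] n \<ominus> \<one>"
proof (induction n)
  case 0
  then show ?case
    using x by (simp add: minus_eq r_neg)
next
  case (Suc n)
  have e: "eval (replicate n \<one>) x \<in> carrier R"
    using x by (intro eval_in_carrier) auto
  have "(x \<ominus> \<one>) \<otimes> eval (replicate (Suc n) \<one>) x
      = (x \<ominus> \<one>) \<otimes> (x [^] n) \<oplus> (x \<ominus> \<one>) \<otimes> eval (replicate n \<one>) x"
    using x e by (simp add: r_distr)
  also have "\<dots> = (x \<ominus> \<one>) \<otimes> (x [^] n) \<oplus> (x [^] n \<ominus> \<one>)"
    by (simp only: Suc)
  also have "\<dots> = x [^] Suc n \<ominus> \<one>"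
  proof -
    have "(x \<ominus> \<one>) \<otimes> t \<oplus> (t \<ominus> \<one>) = t \<otimes> x \<ominus> \<one>" if "t \<in> carrier R" for t
      using x that by (simp add: minus_eq l_distr l_minus a_assoc r_neg1 m_comm[of t])
    then show ?thesis
      using x by simp
  qed
  finally show ?case .
qed

lemma eval_geometric_one: "eval (replicate n \<one>) \<one> = [n] \<cdot>\<^bsub>R\<^esub> \<one>"
  by (induction n) (simp_all add: a_comm)

lemma root_exists:
  assumes "algebraically_closed R" and P: "P \<noteq> []" "set P \<subseteq> carrier R" "lead_coeff P \<noteq> \<zero>" "length P > 1"
  shows "\<exists>x\<in>carrier R. eval P x = \<zero>"
proof -
  have P': "P \<in> carrier (poly_ring R)"
    using P by (simp add: univ_poly_carrier[symmetric] polynomial_def)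
  then have "splitted P"
    by (rule algebraically_closed.roots_over_carrier[OF assms(1)])
  then have "roots P \<noteq> {#}"
    using P(4) by (auto simp: splitted_def)
  then obtain x where "x \<in># roots P"
    by blast
  then show ?thesis
    using roots_mem_iff_is_root[OF P'] by (auto simp: is_root_def)
qed

text \<open>If \<open>p\<close> annihilated the unit, Bezout would show that every annihilator is a
  multiple of \<open>p\<close>, and their greatest common divisor would be \<open>p\<close>
  itself.\<close>

lemma char_condition:
  assumes p: "Factorial_Ring.prime p" "p \<noteq> ring_char R"
  shows "[p] \<cdot>\<^bsub>R\<^esub> \<one> \<noteq> \<zero>"
proof
  assume p0: "[p] \<cdot>\<^bsub>R\<^esub> \<one> = \<zero>"
  have "p dvd n" if n: "[n] \<cdot>\<^bsub>R\<^esub> \<one> = \<zero>" for n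
  proof (rule ccontr)
    assume "\<not> p dvd n"
    then have "coprime p n"
      using p(1) prime_imp_coprime by blast
    then obtain a b where ab: "a * p = b * n + 1"
      using bezout_nat[of p n] p(1) prime_gt_0_nat by (metis coprime_imp_gcd_eq_1 mult.commute not_gr_zero)
    have "[(a * p)] \<cdot>\<^bsub>R\<^esub> \<one> = \<zero>"
      using p0 add.nat_pow_pow[of \<one> a p] by (simp add: mult.commute)
    moreover have "[(b * n)] \<cdot>\<^bsub>R\<^esub> \<one> = \<zero>"
      using n add.nat_pow_pow[of \<one> b n] by (simp add: mult.commute)
    ultimately show False
      using ab by simp
  qed
  then have "ring_char R = p"
    unfolding ring_char_def using p0 by (intro dvd_antisym Gcd_dvd Gcd_greatest) auto
  then show False
    using p(2) by simp
qed

text \<open>A root of \<open>1 + X + ... + X^(p-1)\<close> is a \<open>p\<close>-th root of unity.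
  It differs from 1, where the polynomial takes the value \<open>p\<close>, nonzero by
  \<open>char_condition\<close>. The other members are iterated \<open>p\<close>-th roots of
  it.\<close>

lemma roots_of_unity:
  assumes ac: "algebraically_closed R" and p: "Factorial_Ring.prime p" "p \<noteq> ring_char R"
  obtains \<zeta> :: "nat \<Rightarrow> 'a" where "\<And>i. \<zeta> i \<in> carrier R" "\<zeta> 0 \<noteq> \<one>" "\<zeta> 0 [^] p = \<one>" "\<And>i. \<zeta> (Suc i) [^] p = \<zeta> i"
proof -
  have p1: "p > 1"
    using p(1) prime_gt_1_nat by blast
  obtain z where z: "z \<in> carrier R" "eval (replicate p \<one>) z = \<zero>"
    using root_exists[OF ac, of "replicate p \<one>"] p1 by auto
  have "z [^] p \<ominus> \<one> = \<zero>"
    using eval_geometric[OF z(1), of p] z by simp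
  then have z1: "z [^] p = \<one>"
    using z(1) by simp
  have z2: "z \<noteq> \<one>"
    using z(2) eval_geometric_one[of p] char_condition[OF p] by auto
  have "\<exists>x\<in>carrier R. x [^] p = a" if a: "a \<in> carrier R" for a
  proof -
    obtain n where n: "p = Suc n" "n > 0"
      using p1 by (cases p) auto
    obtain x where x: "x \<in> carrier R" "eval (\<one> # replicate n \<zero> @ [\<ominus> a]) x = \<zero>"
      using root_exists[OF ac, of "\<one> # replicate n \<zero> @ [\<ominus> a]"] a n by auto
    then have "x [^] p \<oplus> \<ominus> a = \<zero>"
      using eval_root_poly[of "\<ominus> a" x n] a n by simp
    then have "x [^] p = a"
      using a x(1) by (metis add.inv_closed add.inv_equality minus_minus nat_pow_closed)
    then show ?thesis
      using x(1) by blast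
  qed
  then obtain r where r: "\<And>a. a \<in> carrier R \<Longrightarrow> r a \<in> carrier R \<and> r a [^] p = a"
    by metis
  define \<zeta> where "\<zeta> i = (r ^^ i) z" for i
  have c: "\<zeta> i \<in> carrier R" for i
    by (induction i) (simp_all add: \<zeta>_def z(1) r)
  show ?thesis
    by (rule that[of \<zeta>, OF c]) (use z1 z2 r c in \<open>simp_all add: \<zeta>_def\<close>)
qed

end


section \<open>The division algebra\<close>

text \<open>The Laurent monomial with exponent vector \<open>m\<close>; it is formed in a group
  because exponents may be negative.\<close>

definition (in comm_group) mprod :: "(nat \<Rightarrow> 'a) \<Rightarrow> (nat \<Rightarrow>\<^sub>0 int) \<Rightarrow> 'a" where
  "mprod y m = (\<Otimes>i\<in>Poly_Mapping.keys m. y i [^] Poly_Mapping.lookup m i)"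

context comm_group
begin

lemma mprod_eq:
  assumes "range y \<subseteq> carrier G" "finite A" "Poly_Mapping.keys m \<subseteq> A"
  shows "mprod y m = (\<Otimes>i\<in>A. y i [^] Poly_Mapping.lookup m i)"
  unfolding mprod_def
  by (rule finprod_mono_neutral_cong_left) (use assms in \<open>auto simp: in_keys_iff\<close>)

lemma mprod_closed [simp]: "range y \<subseteq> carrier G \<Longrightarrow> mprod y m \<in> carrier G"
  unfolding mprod_def by (intro finprod_closed) auto

lemma mprod_add:
  assumes y: "range y \<subseteq> carrier G"
  shows "mprod y (m + n) = mprod y m \<otimes> mprod y n"
proof -
  let ?A = "Poly_Mapping.keys m \<union> Poly_Mapping.keys n"
  have A: "finite ?A" "Poly_Mapping.keys (m + n) \<subseteq> ?A" "Poly_Mapping.keys m \<subseteq> ?A" "Poly_Mapping.keys n \<subseteq> ?A"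
    using Poly_Mapping.keys_add[of m n] by auto
  have yc: "y i \<in> carrier G" for i
    using y by auto
  have "mprod y (m + n) = (\<Otimes>i\<in>?A. y i [^] Poly_Mapping.lookup m i \<otimes> y i [^] Poly_Mapping.lookup n i)"
    unfolding mprod_eq[OF y A(1,2)]
    by (rule finprod_cong') (use yc in \<open>auto simp: lookup_add int_pow_mult\<close>)
  also have "\<dots> = mprod y m \<otimes> mprod y n"
    unfolding mprod_eq[OF y A(1,3)] mprod_eq[OF y A(1,4)]
    by (rule finprod_multf) (use y in auto)
  finally show ?thesis .
qed

lemma mprod_eq_one: "(\<And>i. y i [^] Poly_Mapping.lookup m i = \<one>) \<Longrightarrow> mprod y m = \<one>"
  unfolding mprod_def by (intro finprod_one_eqI) simp

lemma mprod_zero [simp]: "mprod y 0 = \<one>"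
  by (simp add: mprod_def)

lemma mprod_single:
  assumes "range y \<subseteq> carrier G"
  shows "mprod y (Poly_Mapping.single i k) = y i [^] k"
proof -
  have "y i \<in> carrier G"
    using assms by auto
  then show ?thesis
    using mprod_eq[OF assms, of "{i}" "Poly_Mapping.single i k"] by (simp add: Pi_iff)
qed

end

section \<open>The lattice and its cosets\<close>

definition p_lattice :: "nat \<Rightarrow> (nat \<Rightarrow>\<^sub>0 int) set" where
  "p_lattice p = {s. \<forall>i. int (p ^ Suc i) dvd Poly_Mapping.lookup s i}"

text \<open>The exponents of the \<open>y_i\<close> belonging to a lattice vector: as
  \<open>u_i\<close> raised to \<open>p^(i+1)\<close> is \<open>y_i\<close>, coordinate
  \<open>i\<close> is divided by \<open>p^(i+1)\<close>.\<close>

definition lquot :: "nat \<Rightarrow> (nat \<Rightarrow>\<^sub>0 int) \<Rightarrow> nat \<Rightarrow>\<^sub>0 int" where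
  "lquot p s = Poly_Mapping.mapp (\<lambda>i z. z div int (p ^ Suc i)) s"

text \<open>The exponents of the bicharacter pairing neighbouring coordinates: \<open>\<beta>(s, t) = \<Prod>\<^sub>i \<zeta>\<^sub>i\<close>
  raised to \<open>s\<^sub>i\<^sub>+\<^sub>1 t\<^sub>i\<close>.\<close>

definition shift_mult :: "(nat \<Rightarrow>\<^sub>0 int) \<Rightarrow> (nat \<Rightarrow>\<^sub>0 int) \<Rightarrow> nat \<Rightarrow>\<^sub>0 int" where
  "shift_mult s t = Poly_Mapping.mapp (\<lambda>i z. Poly_Mapping.lookup s (Suc i) * z) t"

lemma lookup_lquot: "Poly_Mapping.lookup (lquot p s) i = Poly_Mapping.lookup s i div int (p ^ Suc i)"
  by (simp add: lquot_def lookup_mapp in_keys_iff when_def)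

lemma lookup_shift_mult:
  "Poly_Mapping.lookup (shift_mult s t) i = Poly_Mapping.lookup s (Suc i) * Poly_Mapping.lookup t i"
  by (simp add: shift_mult_def lookup_mapp in_keys_iff when_def)

lemma lookup_gmul: "Poly_Mapping.lookup (gmul n s) i = int n * Poly_Mapping.lookup s i"
  by (induction n) (simp_all add: lookup_add algebra_simps)

lemma p_lattice_zero: "0 \<in> p_lattice p"
  and p_lattice_add: "\<lbrakk>s \<in> p_lattice p; t \<in> p_lattice p\<rbrakk> \<Longrightarrow> s + t \<in> p_lattice p"
  and p_lattice_diff: "\<lbrakk>s \<in> p_lattice p; t \<in> p_lattice p\<rbrakk> \<Longrightarrow> s - t \<in> p_lattice p"
  by (auto simp: p_lattice_def lookup_add lookup_minus)

lemma lquot_add: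
  assumes "s \<in> p_lattice p"
  shows "lquot p (s + t) = lquot p s + lquot p t"
  by (rule poly_mapping_eqI)
    (use assms in \<open>auto simp: p_lattice_def lookup_lquot lookup_add intro!: div_plus_div_distrib_dvd_left\<close>)

text \<open>A finitely supported map is encoded by the list of its values up to the largest key,
  which the length of the list recovers. Inserting 0 covers the empty support.\<close>

lemma countable_poly_mapping_int: "countable (UNIV :: (nat \<Rightarrow>\<^sub>0 int) set)"
proof -
  let ?f = "\<lambda>m. map (Poly_Mapping.lookup m) [0..<Suc (Max (insert 0 (Poly_Mapping.keys m)))]"
  have "inj (?f :: (nat \<Rightarrow>\<^sub>0 int) \<Rightarrow> int list)"
  proof (rule injI)
    fix m n :: "nat \<Rightarrow>\<^sub>0 int" assume eq: "?f m = ?f n"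
    have k: "Poly_Mapping.lookup m' i = 0" if "i > Max (insert 0 (Poly_Mapping.keys m'))" for m' :: "nat \<Rightarrow>\<^sub>0 int" and i
    proof (rule ccontr)
      assume "Poly_Mapping.lookup m' i \<noteq> 0"
      then have "i \<le> Max (insert 0 (Poly_Mapping.keys m'))"
        by (intro Max_ge) (auto simp: in_keys_iff)
      then show False
        using that by simp
    qed
    have len: "Max (insert 0 (Poly_Mapping.keys m)) = Max (insert 0 (Poly_Mapping.keys n))"
      using arg_cong[OF eq, of length] by simp
    show "m = n"
    proof (rule poly_mapping_eqI)
      fix i
      show "Poly_Mapping.lookup m i = Poly_Mapping.lookup n i"
      proof (cases "i \<le> Max (insert 0 (Poly_Mapping.keys m))")
        case True
        then show ?thesis
          using arg_cong[OF eq, of "\<lambda>xs. xs ! i"] len by (simp del: upt_Suc)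
      next
        case False
        then show ?thesis
          using k[of m i] k[of n i] len False by (metis not_le)
      qed
    qed
  qed
  then show ?thesis
    by (rule countableI')
qed

lemma coset_enumeration:
  fixes D :: "'g::ab_group_add set"
  assumes count: "countable (UNIV :: 'g set)" and D0: "0 \<in> D"
    and diff: "\<And>s t. \<lbrakk>s \<in> D; t \<in> D\<rbrakk> \<Longrightarrow> s - t \<in> D"
    and inf: "infinite (range (\<lambda>s. {t. t - s \<in> D}))"
  obtains e :: "nat \<Rightarrow> 'g" and \<tau> where "\<And>n. \<tau> (e n) = n" "e (\<tau> 0) = 0" "\<And>s t. \<tau> s = \<tau> t \<longleftrightarrow> s - t \<in> D"
proof -
  let ?c = "\<lambda>s. {t. t - s \<in> D}"
  let ?Q = "range ?c"
  define \<tau> where "\<tau> = (\<lambda>s. to_nat_on ?Q (?c s))"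
  have cQ: "countable ?Q"
    using count by simp
  have neg: "- s \<in> D" if "s \<in> D" for s
    using diff[OF D0 that] by simp
  have c_eq: "?c s = ?c t \<longleftrightarrow> s - t \<in> D" for s t
  proof
    assume "?c s = ?c t"
    moreover have "s \<in> ?c s"
      using D0 by simp
    ultimately have "s \<in> ?c t"
      by (simp only:)
    then show "s - t \<in> D"
      by simp
  next
    assume st: "s - t \<in> D"
    have "u - s \<in> D \<longleftrightarrow> u - t \<in> D" for u
      using diff[OF _ st, of "u - t"] diff[OF _ neg[OF st], of "u - s"] by auto
    then show "?c s = ?c t"
      by auto
  qed
  have \<tau>_iff: "\<tau> s = \<tau> t \<longleftrightarrow> s - t \<in> D" for s t
    using c_eq[of s t] inj_on_to_nat_on[OF cQ] by (auto simp: \<tau>_def inj_on_def)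
  have "\<exists>s. \<tau> s = n" for n
  proof -
    have "n \<in> to_nat_on ?Q ` ?Q"
      using bij_betw_imp_surj_on[OF to_nat_on_infinite[OF cQ inf]] by simp
    then show ?thesis
      unfolding \<tau>_def by blast
  qed
  then obtain e' where e': "\<And>n. \<tau> (e' n) = n"
    by metis
  \<comment> \<open>The representatives are arbitrary except at the index of \<open>D\<close>
    itself, where 0 is put in.\<close>
  show ?thesis
    by (rule that[of \<tau> "e'(\<tau> 0 := 0)"]) (auto simp: e' \<tau>_iff)
qed

lemma gmul_pos: "0 < s \<Longrightarrow> 0 < gmul (Suc n) (s :: 'g::linordered_ab_group_add)"
  by (induction n) (simp_all add: add_pos_pos)

lemma gmul_uminus: "gmul n (- s) = - gmul n (s :: 'g::ab_group_add)"
  using gmul_diff[of n 0 s] by (simp add: gmul_def)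

lemma gmul_eq_zero:
  fixes s :: "'g::linordered_ab_group_add"
  assumes "gmul n s = 0" "n > 0"
  shows "s = 0"
proof -
  obtain m where m: "n = Suc m"
    using assms(2) by (cases n) auto
  have "\<not> 0 < s" "\<not> 0 < - s"
    using gmul_pos[of s m] gmul_pos[of "- s" m] assms(1) m gmul_uminus[of n s] by auto
  then show ?thesis
    by simp
qed

text \<open>What the construction takes from the field: variables that are independent over
  \<open>F\<close> and generate \<open>K\<close> by fractions, and a compatible tower of roots of
  unity in which \<open>\<zeta> i\<close> has order \<open>p^(i+1)\<close>.\<close>

locale twist_data = field K for K (structure) +
  fixes F :: "'a set" and y \<zeta> :: "nat \<Rightarrow> 'a" and p :: nat
  assumes F_subring: "subring F K"
    and y_inj: "inj y" and y_carrier: "range y \<subseteq> carrier K"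
    and y_independent: "\<lbrakk>finite S; \<And>M. M \<in> S \<Longrightarrow> set_mset M \<subseteq> range y; \<And>M. M \<in> S \<Longrightarrow> g M \<in> F;
      (\<Oplus>M\<in>S. g M \<otimes> mset_val M) = \<zero>; M \<in> S\<rbrakk> \<Longrightarrow> g M = \<zero>"
    and y_fracs: "carrier K \<subseteq> fracs (polys F (range y)) (polys F (range y))"
    and p_prime: "Factorial_Ring.prime p" and p_not_zero: "[p] \<cdot>\<^bsub>K\<^esub> \<one> \<noteq> \<zero>"
    and \<zeta>_carrier: "\<zeta> i \<in> carrier K" and \<zeta>_0: "\<zeta> 0 \<noteq> \<one>" "\<zeta> 0 [^] p = \<one>"
    and \<zeta>_Suc: "\<zeta> (Suc i) [^] p = \<zeta> i"
begin

lemma units_group: "comm_group (Multiplicative_Group.mult_of K)"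
  by (rule group.group_comm_groupI[OF field_mult_group]) (simp add: m_comm)

text \<open>Integer powers, and with them Laurent monomials, live in the multiplicative group of
  \<open>K\<close>; the rewrites express its operations by those of \<open>K\<close>.\<close>

sublocale MU: comm_group "Multiplicative_Group.mult_of K"
  rewrites "monoid.mult (Multiplicative_Group.mult_of K) = monoid.mult K" and "monoid.one (Multiplicative_Group.mult_of K) = \<one>"
    and "carrier (Multiplicative_Group.mult_of K) = carrier K - {\<zero>}"
  using units_group by simp_all

lemma p_gt_1: "p > 1"
  using p_prime prime_gt_1_nat by blast

lemma y_nonzero: "y i \<noteq> \<zero>"
proof
  assume "y i = \<zero>"
  then have "(\<Oplus>M\<in>{{#y i#}}. \<one> \<otimes> mset_val M) = \<zero>"
    using y_carrier by (simp add: Pi_iff)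
  then have "\<one> = \<zero>"
    using subringE(3)[OF F_subring] by (intro y_independent[of "{{#y i#}}" "\<lambda>_. \<one>" "{#y i#}"]) auto
  then show False
    using one_not_zero by simp
qed

lemma y_units: "range y \<subseteq> carrier K - {\<zero>}"
  using y_carrier y_nonzero by auto

lemma \<zeta>_power: "\<zeta> i [^] (p ^ Suc i) = \<one>" "\<zeta> i [^] (p ^ i) = \<zeta> 0"
proof (induction i)
  case (Suc i)
  have "\<zeta> (Suc i) [^] (p ^ Suc n) = \<zeta> i [^] (p ^ n)" for n
    using \<zeta>_carrier nat_pow_pow[of "\<zeta> (Suc i)" p "p ^ n"] by (simp add: \<zeta>_Suc)
  with Suc show "\<zeta> (Suc i) [^] (p ^ Suc (Suc i)) = \<one>" "\<zeta> (Suc i) [^] (p ^ Suc i) = \<zeta> 0"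
    by (simp_all only:)
qed (use \<zeta>_0 \<zeta>_carrier in simp_all)

lemma \<zeta>_units: "range \<zeta> \<subseteq> carrier K - {\<zero>}"
proof -
  have "\<zeta> i \<noteq> \<zero>" for i
    using \<zeta>_power(1)[of i] p_gt_1 one_not_zero by (metis nat_pow_zero power_not_zero not_one_less_zero neq0_conv)
  then show ?thesis
    using \<zeta>_carrier by auto
qed

text \<open>By \<open>\<zeta>_power\<close> the order of \<open>\<zeta> i\<close> divides
  \<open>p^(i+1)\<close> but not \<open>p^i\<close>, so it equals \<open>p^(i+1)\<close>.\<close>

lemma \<zeta>_int_pow: "\<zeta> i [^]\<^bsub>Multiplicative_Group.mult_of K\<^esub> (k :: int) = \<one> \<longleftrightarrow> int (p ^ Suc i) dvd k"
proof -
  have \<zeta>i: "\<zeta> i \<in> carrier K - {\<zero>}"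
    using \<zeta>_units by auto
  have "MU.ord (\<zeta> i) dvd p ^ Suc i"
    using MU.pow_eq_id[OF \<zeta>i, of "p ^ Suc i"] \<zeta>_power(1)[of i] by (simp add: Multiplicative_Group.nat_pow_mult_of)
  moreover have "\<not> MU.ord (\<zeta> i) dvd p ^ i"
    using MU.pow_eq_id[OF \<zeta>i, of "p ^ i"] \<zeta>_power(2)[of i] \<zeta>_0 by (simp add: Multiplicative_Group.nat_pow_mult_of)
  ultimately have "MU.ord (\<zeta> i) = p ^ Suc i"
    using divides_primepow_nat[OF p_prime, of "MU.ord (\<zeta> i)" "Suc i"] by (auto simp: le_Suc_eq le_imp_power_dvd)
  then show ?thesis
    using MU.int_pow_eq_id[OF \<zeta>i, of k] by simp
qed

section \<open>The scalars and the bicharacter\<close>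

abbreviation D :: "(nat \<Rightarrow>\<^sub>0 int) set" where
  "D \<equiv> p_lattice p"

definition \<chi> :: "(nat \<Rightarrow>\<^sub>0 int) \<Rightarrow> 'a" where
  "\<chi> s = MU.mprod y (lquot p s)"

definition \<beta> :: "(nat \<Rightarrow>\<^sub>0 int) \<Rightarrow> (nat \<Rightarrow>\<^sub>0 int) \<Rightarrow> 'a" where
  "\<beta> s t = MU.mprod \<zeta> (shift_mult s t)"

lemma \<chi>_closed: "\<chi> s \<in> carrier K - {\<zero>}"
  unfolding \<chi>_def by (rule MU.mprod_closed[OF y_units])

lemma \<chi>_add: "s \<in> D \<Longrightarrow> \<chi> (s + t) = \<chi> s \<otimes> \<chi> t"
  unfolding \<chi>_def using MU.mprod_add[OF y_units] by (simp add: lquot_add)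

lemma \<beta>_closed: "\<beta> s t \<in> carrier K - {\<zero>}"
  unfolding \<beta>_def by (rule MU.mprod_closed[OF \<zeta>_units])

lemma \<beta>_add: "\<beta> (s + s') t = \<beta> s t \<otimes> \<beta> s' t" "\<beta> s (t + t') = \<beta> s t \<otimes> \<beta> s t'"
proof -
  have "shift_mult (s + s') t = shift_mult s t + shift_mult s' t"
    "shift_mult s (t + t') = shift_mult s t + shift_mult s t'"
    by (auto intro!: poly_mapping_eqI simp: lookup_shift_mult lookup_add algebra_simps)
  then show "\<beta> (s + s') t = \<beta> s t \<otimes> \<beta> s' t" "\<beta> s (t + t') = \<beta> s t \<otimes> \<beta> s t'"
    unfolding \<beta>_def using MU.mprod_add[OF \<zeta>_units] by simp_all
qed

lemma \<beta>_eq_one: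
  assumes "\<And>i. int (p ^ Suc i) dvd Poly_Mapping.lookup s (Suc i) * Poly_Mapping.lookup t i"
  shows "\<beta> s t = \<one>"
  unfolding \<beta>_def by (rule MU.mprod_eq_one) (simp only: \<zeta>_int_pow lookup_shift_mult assms)

text \<open>The order \<open>p^(i+1)\<close> of \<open>\<zeta> i\<close> divides coordinate
  \<open>i\<close> of a lattice vector on the right, and a fortiori coordinate \<open>i+1\<close> of
  one on the left.\<close>

lemma \<beta>_D: "s \<in> D \<Longrightarrow> \<beta> s t = \<one>" "t \<in> D \<Longrightarrow> \<beta> s t = \<one>"
proof -
  assume s: "s \<in> D"
  show "\<beta> s t = \<one>"
  proof (rule \<beta>_eq_one)
    fix i
    have "int (p ^ Suc i) dvd int (p ^ Suc (Suc i))"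
      by simp
    then show "int (p ^ Suc i) dvd Poly_Mapping.lookup s (Suc i) * Poly_Mapping.lookup t i"
      using s unfolding p_lattice_def by (blast intro: dvd_trans dvd_mult2)
  qed
next
  assume "t \<in> D"
  then show "\<beta> s t = \<one>"
    by (intro \<beta>_eq_one dvd_mult) (simp add: p_lattice_def)
qed

lemma \<beta>_gmul: "\<beta> (gmul n s) t = \<beta> s t [^] n" "\<beta> t (gmul n s) = \<beta> t s [^] n"
  by (induction n) (simp_all add: \<beta>_add \<beta>_D p_lattice_zero)

text \<open>If \<open>p^(m+1) s\<close> is in the lattice, \<open>p^(i+2)\<close> divides
  \<open>p^(m+1)\<close> times coordinate \<open>i+1\<close> of \<open>s\<close>. Cancelling one
  \<open>p\<close>, the order \<open>p^(i+1)\<close> of \<open>\<zeta> i\<close> divides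
  \<open>p^m\<close> times that coordinate. The gain of one power comes from pairing coordinate
  \<open>i+1\<close> through a root of the smaller order \<open>p^(i+1)\<close>.\<close>

lemma \<beta>_exponent:
  assumes s: "gmul (p ^ Suc m) s \<in> D"
  shows "\<beta> s t [^] (p ^ m) = \<one>"
proof -
  have "\<beta> (gmul (p ^ m) s) t = \<one>"
  proof (rule \<beta>_eq_one)
    fix i
    let ?a = "Poly_Mapping.lookup s (Suc i)"
    have "\<forall>j. int (p ^ Suc j) dvd int (p ^ Suc m) * Poly_Mapping.lookup s j"
      using s by (simp only: p_lattice_def lookup_gmul mem_Collect_eq simp_thms)
    then have "int (p ^ Suc (Suc i)) dvd int (p ^ Suc m) * ?a"
      by blast
    then have "int p * int (p ^ Suc i) dvd int p * (int (p ^ m) * ?a)"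
      by (simp add: mult.assoc)
    then have "int (p ^ Suc i) dvd int (p ^ m) * ?a"
      using p_gt_1 by (subst (asm) dvd_mult_cancel_left) simp
    then show "int (p ^ Suc i) dvd Poly_Mapping.lookup (gmul (p ^ m) s) (Suc i) * Poly_Mapping.lookup t i"
      unfolding lookup_gmul by (rule dvd_mult2)
  qed
  then show ?thesis
    by (simp add: \<beta>_gmul)
qed

lemma torsion: "\<exists>m. gmul (p ^ m) s \<in> D"
proof -
  let ?m = "Suc (Max (insert 0 (Poly_Mapping.keys s)))"
  have "int (p ^ Suc i) dvd int (p ^ ?m) * Poly_Mapping.lookup s i" for i
  proof (cases "i \<in> Poly_Mapping.keys s")
    case True
    then have "Suc i \<le> ?m"
      by simp
    then have "p ^ Suc i dvd p ^ ?m"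
      by (rule le_imp_power_dvd)
    then show ?thesis
      by (intro dvd_mult2) (simp only: of_nat_dvd_iff)
  next
    case False
    then show ?thesis
      by (simp add: in_keys_iff)
  qed
  then have "gmul (p ^ ?m) s \<in> D"
    by (simp add: p_lattice_def lookup_gmul del: power_Suc)
  then show ?thesis
    by blast
qed


text \<open>The last coordinate \<open>n\<close> at which \<open>s\<close> violates the lattice
  condition is detected by the unit vector at \<open>n+1\<close>. In one order the pairing is a
  nontrivial power of \<open>\<zeta> n\<close>; in the other it involves only coordinate
  \<open>n+2\<close> of \<open>s\<close>, which satisfies the condition.\<close>

lemma \<beta>_nondegenerate:
  assumes "s \<notin> D"
  shows "\<exists>t. \<beta> s t \<noteq> \<beta> t s"
proof -
  let ?B = "{i. \<not> int (p ^ Suc i) dvd Poly_Mapping.lookup s i}"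
  have "?B \<subseteq> Poly_Mapping.keys s"
    by (auto simp: in_keys_iff)
  then have fin: "finite ?B"
    by (rule finite_subset) simp
  have ne: "?B \<noteq> {}"
    using assms by (auto simp: p_lattice_def)
  define n where "n = Max ?B"
  have n: "n \<in> ?B"
    unfolding n_def using fin ne by (rule Max_in)
  have max: "int (p ^ Suc i) dvd Poly_Mapping.lookup s i" if "i > n" for i
    using that Max_ge[OF fin, of i] unfolding n_def by fastforce
  let ?t = "Poly_Mapping.single (Suc n) 1"
  have "\<beta> s ?t = \<one>"
  proof (rule \<beta>_eq_one)
    fix i
    have "int (p ^ Suc i) dvd Poly_Mapping.lookup s (Suc i)" if "i = Suc n"
    proof -
      have "int (p ^ Suc i) dvd int (p ^ Suc (Suc i))"
        by simp
      then show ?thesis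
        using max[of "Suc i"] that by (meson dvd_trans lessI less_SucI)
    qed
    then show "int (p ^ Suc i) dvd Poly_Mapping.lookup s (Suc i) * Poly_Mapping.lookup ?t i"
      by (cases "i = Suc n") (simp_all add: lookup_single when_def)
  qed
  moreover have "\<beta> ?t s \<noteq> \<one>"
  proof -
    have "shift_mult ?t s = Poly_Mapping.single n (Poly_Mapping.lookup s n)"
      by (rule poly_mapping_eqI) (auto simp: lookup_shift_mult lookup_single when_def)
    then have "\<beta> ?t s = \<zeta> n [^]\<^bsub>Multiplicative_Group.mult_of K\<^esub> Poly_Mapping.lookup s n"
      unfolding \<beta>_def using MU.mprod_single[OF \<zeta>_units] by simp
    then show ?thesis
      using n by (simp add: \<zeta>_int_pow del: power_Suc)
  qed
  ultimately show ?thesis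
    by metis
qed

section \<open>Polynomial monomials as lattice vectors\<close>

definition N :: "(nat \<Rightarrow>\<^sub>0 int) set" where
  "N = {s \<in> D. \<forall>i. 0 \<le> Poly_Mapping.lookup s i}"

text \<open>Turns a lattice vector into the multiset of variables of its monomial, so that the
  independence of the \<open>y_i\<close> can be applied. The conversion by \<open>nat\<close> loses
  nothing on \<open>N\<close>, where the quotients are nonnegative.\<close>

definition exponents :: "(nat \<Rightarrow>\<^sub>0 int) \<Rightarrow> 'a multiset" where
  "exponents s = (\<Sum>i\<in>Poly_Mapping.keys (lquot p s). replicate_mset (nat (Poly_Mapping.lookup (lquot p s) i)) (y i))"

lemma set_exponents: "set_mset (exponents s) \<subseteq> range y"
proof -
  have "set_mset (\<Sum>i\<in>A. replicate_mset (n i) (y i)) \<subseteq> range y" if "finite A" for A and n :: "nat \<Rightarrow> nat"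
    using that by (induction A) auto
  then show ?thesis
    by (simp add: exponents_def)
qed

lemma count_exponents: "count (exponents s) (y i) = nat (Poly_Mapping.lookup (lquot p s) i)"
proof -
  have "count (exponents s) (y i)
      = (\<Sum>j\<in>Poly_Mapping.keys (lquot p s). if j = i then nat (Poly_Mapping.lookup (lquot p s) j) else 0)"
    unfolding exponents_def count_sum using y_inj by (intro sum.cong) (auto simp: inj_eq)
  also have "\<dots> = nat (Poly_Mapping.lookup (lquot p s) i)"
    by (simp add: in_keys_iff)
  finally show ?thesis .
qed

lemma exponents_inj: "inj_on exponents N"
proof (rule inj_onI)
  fix s t assume st: "s \<in> N" "t \<in> N" "exponents s = exponents t"
  show "s = t"
  proof (rule poly_mapping_eqI)
    fix i
    have pos: "0 < int (p ^ Suc i)"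
      using p_gt_1 by simp
    have "nat (Poly_Mapping.lookup s i div int (p ^ Suc i)) = nat (Poly_Mapping.lookup t i div int (p ^ Suc i))"
      using count_exponents[of s i] count_exponents[of t i] st(3) by (simp only: lookup_lquot)
    then have "Poly_Mapping.lookup s i div int (p ^ Suc i) = Poly_Mapping.lookup t i div int (p ^ Suc i)"
      using st(1,2) pos by (simp add: N_def pos_imp_zdiv_nonneg_iff eq_nat_nat_iff del: power_Suc)
    then show "Poly_Mapping.lookup s i = Poly_Mapping.lookup t i"
      using st(1,2) unfolding N_def p_lattice_def by (metis (mono_tags, lifting) dvd_div_mult_self mem_Collect_eq)
  qed
qed

lemma mset_val_exponents:
  assumes s: "s \<in> N"
  shows "mset_val (exponents s) = \<chi> s"
proof -
  let ?l = "Poly_Mapping.lookup (lquot p s)" and ?A = "Poly_Mapping.keys (lquot p s)"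
  have yc: "y i \<in> carrier K" "y i \<in> carrier K - {\<zero>}" for i
    using y_units by auto
  have replicate: "mset_val (replicate_mset n x) = x [^] n" if "x \<in> carrier K" for n x
  proof (induction n)
    case (Suc n)
    then show ?case
      using mset_val_add[of "{#x#}" "replicate_mset n x"] that by (auto simp: m_comm split: if_splits)
  qed simp
  have "mset_val (\<Sum>i\<in>A. replicate_mset (nat (?l i)) (y i)) = (\<Otimes>i\<in>A. y i [^] nat (?l i))" if "finite A" for A
    using that
  proof (induction A)
    case (insert a A)
    have "set_mset (\<Sum>i\<in>A. replicate_mset (nat (?l i)) (y i)) \<subseteq> carrier K"
      using insert.hyps(1) by (induction A) (auto simp: yc split: if_splits)
    then show ?case
      using insert yc mset_val_add[of "replicate_mset (nat (?l a)) (y a)"] replicate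
      by (auto simp: Pi_iff split: if_splits)
  qed simp
  then have "mset_val (exponents s) = (\<Otimes>i\<in>?A. y i [^] nat (?l i))"
    by (simp add: exponents_def)
  \<comment> \<open>Passage from products in \<open>K\<close> to products in its multiplicative
    group, where \<open>\<chi>\<close> is defined through integer powers.\<close>
  also have "\<dots> = finprod (Multiplicative_Group.mult_of K) (\<lambda>i. y i [^] nat (?l i)) ?A"
  proof -
    have "(\<Otimes>i\<in>A. y i [^] n i) = finprod (Multiplicative_Group.mult_of K) (\<lambda>i. y i [^] n i) A"
      if "finite A" for A and n :: "nat \<Rightarrow> nat"
      using that
    proof (induction A)
      case (insert a A)
      have "y i [^] n i \<in> carrier K - {\<zero>}" for i
        using MU.nat_pow_closed[OF yc(2)[of i], of "n i"] by (simp add: Multiplicative_Group.nat_pow_mult_of)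
      then show ?case
        using insert by (simp add: Pi_iff)
    qed simp
    then show ?thesis
      by simp
  qed
  also have "\<dots> = \<chi> s"
    unfolding \<chi>_def MU.mprod_def
  proof (rule MU.finprod_cong')
    show "(\<lambda>i. y i [^]\<^bsub>Multiplicative_Group.mult_of K\<^esub> ?l i) \<in> ?A \<rightarrow> carrier K - {\<zero>}"
      using yc(2) MU.int_pow_closed by blast
    fix i
    have "0 \<le> ?l i"
      using s p_gt_1 by (simp add: N_def lookup_lquot pos_imp_zdiv_nonneg_iff)
    then show "y i [^] nat (?l i) = y i [^]\<^bsub>Multiplicative_Group.mult_of K\<^esub> ?l i"
      using int_pow_int[of "Multiplicative_Group.mult_of K" "y i" "nat (?l i)"]
      by (simp add: Multiplicative_Group.nat_pow_mult_of)
  qed simp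
  finally show ?thesis .
qed

lemma single_N: "Poly_Mapping.single i (int (p ^ Suc i)) \<in> N"
  by (auto simp: N_def p_lattice_def lookup_single when_def)

lemma \<chi>_single: "\<chi> (Poly_Mapping.single i (int (p ^ Suc i))) = y i"
proof -
  have "lquot p (Poly_Mapping.single i (int (p ^ Suc i))) = Poly_Mapping.single i 1"
    using p_gt_1 by (intro poly_mapping_eqI) (auto simp: lookup_lquot lookup_single when_def)
  then show ?thesis
    unfolding \<chi>_def using MU.mprod_single[OF y_units, of i 1] y_units by (simp add: MU.int_pow_1 subset_iff)
qed

lemma \<chi>_zero: "\<chi> 0 = \<one>"
proof -
  have "lquot p 0 = 0"
    by (rule poly_mapping_eqI) (simp add: lookup_lquot)
  then show ?thesis
    by (simp add: \<chi>_def)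
qed

lemma N_zero: "0 \<in> N" and N_add: "\<lbrakk>s \<in> N; t \<in> N\<rbrakk> \<Longrightarrow> s + t \<in> N" and N_D: "s \<in> N \<Longrightarrow> s \<in> D"
  by (auto simp: N_def p_lattice_zero p_lattice_add lookup_add)

lemma polys_subset_span: "polys F (range y) \<subseteq> span_over F \<chi> N"
proof
  have \<chi>c: "\<chi> s \<in> carrier K" for s
    using \<chi>_closed by auto
  have monomial: "\<exists>s\<in>N. mset_val M = \<chi> s" if "set_mset M \<subseteq> range y" for M
    using that
  proof (induction M)
    case empty
    then show ?case
      using N_zero \<chi>_zero by (intro bexI[of _ 0]) auto
  next
    case (add x M)
    then obtain s i where s: "s \<in> N" "mset_val M = \<chi> s" "x = y i"
      by auto
    have "mset_val (add_mset x M) = y i \<otimes> \<chi> s"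
      using mset_val_add[of "{#x#}" M] add.prems y_carrier s by auto
    then have "mset_val (add_mset x M) = \<chi> (Poly_Mapping.single i (int (p ^ Suc i)) + s)"
      using \<chi>_add[OF N_D[OF single_N]] \<chi>_single by (simp del: power_Suc)
    then show ?case
      using N_add[OF single_N s(1)] by blast
  qed
  fix x assume "x \<in> polys F (range y)"
  then show "x \<in> span_over F \<chi> N"
    unfolding polys_def
  proof (rule span_over_subset_span[OF F_subring \<chi>c, rotated])
    fix M assume "M \<in> {M. set_mset M \<subseteq> range y}"
    then obtain s where "s \<in> N" "mset_val M = \<chi> s"
      using monomial by blast
    then show "mset_val M \<in> span_over F \<chi> N"
      using span_over_base[OF F_subring, where \<phi> = \<chi> and i = s and S = N] \<chi>c by simp
  qed
qed

text \<open>Independence of the \<open>\<chi> s\<close> is that of the monomials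
  \<open>exponents s\<close>, which differ for different \<open>s \<in> N\<close>; the
  representation by fractions comes from \<open>y_fracs\<close>.\<close>

sublocale monomial_field K F \<chi> N
proof (rule monomial_field.intro[OF field_axioms], rule monomial_field_axioms.intro)
  show "subring F K"
    by (rule F_subring)
  show "0 \<in> N" "\<And>s t. \<lbrakk>s \<in> N; t \<in> N\<rbrakk> \<Longrightarrow> s + t \<in> N"
    by (rule N_zero N_add; assumption)+
  show "\<chi> s \<in> carrier K" for s
    using \<chi>_closed by auto
  show "\<chi> 0 = \<one>"
    by (rule \<chi>_zero)
  show "\<chi> (s + t) = \<chi> s \<otimes> \<chi> t" if "s \<in> N" for s t
    by (rule \<chi>_add[OF N_D[OF that]])
  show "\<exists>x\<in>span_over F \<chi> N. \<exists>z\<in>span_over F \<chi> N. z \<noteq> \<zero> \<and> a \<otimes> z = x" if a: "a \<in> carrier K" for a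
  proof -
    obtain z where z: "z \<in> polys F (range y)" "z \<noteq> \<zero>" "z \<otimes> a \<in> polys F (range y)"
      using y_fracs a by (auto simp: fracs_def)
    have "z \<in> carrier K"
      using z(1) subringE(1)[OF polys_subring[OF F_subring y_carrier]] by auto
    then have "a \<otimes> z = z \<otimes> a"
      using a by (simp add: m_comm)
    then show ?thesis
      using z polys_subset_span by (metis subsetD)
  qed
  fix S f \<delta>
  assume S: "finite S" "S \<subseteq> N" "\<And>\<gamma>. \<gamma> \<in> S \<Longrightarrow> f \<gamma> \<in> F"
    and sum: "(\<Oplus>\<gamma>\<in>S. f \<gamma> \<otimes> \<chi> \<gamma>) = \<zero>" and \<delta>: "\<delta> \<in> S"
  have inj: "inj_on exponents S"
    using exponents_inj S(2) inj_on_subset by blast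
  have fc: "f \<gamma> \<otimes> mset_val (exponents \<gamma>) \<in> carrier K" if "\<gamma> \<in> S" for \<gamma>
    using S(3)[OF that] subringE(1)[OF F_subring] mset_val_closed[OF order_trans[OF set_exponents y_carrier]]
    by auto
  have "(\<Oplus>\<gamma>\<in>S. f \<gamma> \<otimes> mset_val (exponents \<gamma>)) = (\<Oplus>\<gamma>\<in>S. f \<gamma> \<otimes> \<chi> \<gamma>)"
  proof (rule finsum_cong')
    show "(\<lambda>\<gamma>. f \<gamma> \<otimes> \<chi> \<gamma>) \<in> S \<rightarrow> carrier K"
      using S(3) subringE(1)[OF F_subring] \<chi>_closed by (intro Pi_I m_closed) auto
  qed (use S(2) mset_val_exponents in auto)
  then have sum': "(\<Oplus>M\<in>exponents ` S. f (inv_into S exponents M) \<otimes> mset_val M) = \<zero>"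
    using finsum_image_inv_into[OF inj, of "\<lambda>\<gamma> M. f \<gamma> \<otimes> mset_val M"] fc sum by simp
  have "f (inv_into S exponents (exponents \<delta>)) = \<zero>"
  proof (rule y_independent[OF _ _ _ sum'])
    fix M assume "M \<in> exponents ` S"
    then obtain \<gamma> where \<gamma>: "\<gamma> \<in> S" "M = exponents \<gamma>"
      by blast
    then show "set_mset M \<subseteq> range y" "f (inv_into S exponents M) \<in> F"
      using set_exponents S(3) inj by auto
  qed (use S(1) \<delta> in auto)
  then show "f \<delta> = \<zero>"
    using inj \<delta> by simp
qed

lemma val_power: "\<lbrakk>a \<in> carrier K; a \<noteq> \<zero>\<rbrakk> \<Longrightarrow> a [^] n \<noteq> \<zero> \<and> val (a [^] n) = gmul n (val a)" for n :: nat
proof (induction n)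
  case 0
  then show ?case
    using val_F[of \<one>] subringE(3)[OF F_subring] by simp
next
  case (Suc n)
  then show ?case
    using val_mult[of "a [^] n" a] integral_iff[of "a [^] n" a] by simp
qed

text \<open>\<open>\<beta> s t\<close> is a root of unity, and a linearly ordered value group is
  torsion-free.\<close>

lemma val_\<beta>: "val (\<beta> s t) = 0"
proof -
  obtain m where "gmul (p ^ m) s \<in> D"
    using torsion by blast
  then have "\<beta> s t [^] (p ^ m) = \<one>"
    using \<beta>_gmul(1)[of "p ^ m" s t] \<beta>_D(1) by simp
  then have "gmul (p ^ m) (val (\<beta> s t)) = 0"
    using val_power[of "\<beta> s t" "p ^ m"] \<beta>_closed[of s t] val_F[of \<one>] subringE(3)[OF F_subring] by simp
  then show ?thesis
    using gmul_eq_zero p_gt_1 by force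
qed

lemma val_D:
  assumes "a \<in> carrier K" "a \<noteq> \<zero>"
  shows "val a \<in> D"
  using val_range[OF assms] p_lattice_diff N_D by metis

text \<open>\<open>val_\<phi>\<close> covers only nonnegative vectors. With \<open>b\<close> the
  vector of absolute values, both \<open>b\<close> and \<open>d + b\<close> are nonnegative, and
  additivity of \<open>val\<close> gives the value at \<open>d\<close> as a difference.\<close>

lemma val_\<chi>_D:
  assumes "d \<in> D"
  shows "val (\<chi> d) = d"
proof -
  define b where "b = Poly_Mapping.mapp (\<lambda>i z. \<bar>z\<bar>) d"
  have lb: "Poly_Mapping.lookup b i = \<bar>Poly_Mapping.lookup d i\<bar>" for i
    by (simp add: b_def lookup_mapp in_keys_iff when_def)
  have bN: "b \<in> N"
    using assms by (simp add: N_def p_lattice_def lb del: power_Suc)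
  have "0 \<le> z + \<bar>z\<bar>" for z :: int
    by simp
  then have "d + b \<in> N"
    using assms bN p_lattice_add by (simp add: N_def lookup_add lb)
  then have "val (\<chi> (d + b)) = d + b"
    by (rule val_\<phi>)
  moreover have "val (\<chi> (d + b)) = val (\<chi> d) + b"
    using \<chi>_add[OF assms, of b] val_mult[of "\<chi> d" "\<chi> b"] \<chi>_closed[of d] \<chi>_closed[of b] val_\<phi>[OF bN] by simp
  ultimately show ?thesis
    by simp
qed

text \<open>The unit vectors are pairwise incongruent modulo the lattice, as \<open>p^(i+1)\<close>
  does not divide 1.\<close>

lemma infinite_cosets: "infinite (range (\<lambda>s. {t. t - s \<in> D}))"
proof -
  let ?c = "\<lambda>i :: nat. {t. t - Poly_Mapping.single i 1 \<in> D}"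
  have "inj ?c"
  proof (rule injI)
    fix i j assume eq: "?c i = ?c j"
    have "Poly_Mapping.single i 1 \<in> ?c i"
      by (simp add: p_lattice_zero)
    then have "Poly_Mapping.single i 1 \<in> ?c j"
      by (simp only: eq)
    then have d: "int (p ^ Suc i) dvd Poly_Mapping.lookup (Poly_Mapping.single i 1 - Poly_Mapping.single j 1) i"
      by (simp add: p_lattice_def del: power_Suc)
    show "i = j"
    proof (rule ccontr)
      assume "i \<noteq> j"
      then have "int (p ^ Suc i) dvd 1"
        using d by (simp add: lookup_minus lookup_single when_def del: power_Suc)
      then have "p ^ Suc i = 1"
        by (metis nat_dvd_1_iff_1 of_nat_1 of_nat_dvd_iff)
      then show False
        using p_gt_1 by simp
    qed
  qed
  then have "infinite (range ?c)"
    by (rule range_inj_infinite)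
  then show ?thesis
    by (rule infinite_super[rotated]) auto
qed

lemma p_twisted_group_exists:
  "\<exists>e \<tau>. p_twisted_group K e \<tau> D \<chi> \<beta> val p"
proof -
  obtain e :: "nat \<Rightarrow> nat \<Rightarrow>\<^sub>0 int" and \<tau>
    where e: "\<And>n. \<tau> (e n) = n" "e (\<tau> 0) = 0" "\<And>s t. \<tau> s = \<tau> t \<longleftrightarrow> s - t \<in> D"
    by (rule coset_enumeration[of D, OF countable_poly_mapping_int p_lattice_zero p_lattice_diff infinite_cosets])
      (assumption+, rule that)
  \<comment> \<open>Multiples of the unit lie in \<open>F\<close>, and nonzero elements of
    \<open>F\<close> are constants for the valuation.\<close>
  have "[p] \<cdot>\<^bsub>K\<^esub> \<one> \<in> F"
  proof -
    have "[n] \<cdot>\<^bsub>K\<^esub> \<one> \<in> F" for n :: nat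
      using subringE(2,3,7)[OF F_subring] by (induction n) simp_all
    then show ?thesis .
  qed
  then have vp: "val ([p] \<cdot>\<^bsub>K\<^esub> \<one>) = 0"
    using val_F p_not_zero by blast
  have "p_twisted_group K e \<tau> D \<chi> \<beta> val p"
    by unfold_locales
      (use e \<chi>_closed \<chi>_add \<beta>_closed \<beta>_add \<beta>_D val_D val_mult val_add val_\<chi>_D val_\<beta> p_prime
        torsion p_not_zero vp \<beta>_nondegenerate \<beta>_exponent in auto)
  then show ?thesis
    by blast
qed

lemma D_proper: "\<exists>s. s \<notin> D"
proof (intro exI notI)
  assume "Poly_Mapping.single 0 1 \<in> D"
  then have "int (p ^ Suc 0) dvd Poly_Mapping.lookup (Poly_Mapping.single 0 (1 :: int)) (0 :: nat)"
    unfolding p_lattice_def by blast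
  then show False
    using p_gt_1 by (simp only: lookup_single_eq) simp
qed

end

theorem theorem2p1:
  fixes K :: "('a, 'b) ring_scheme" and K0 Kinf B :: "'a set" and p :: nat
  assumes "field K"
    and "subfield K0 K"
    and "algebraically_closed (K\<lparr>carrier := K0\<rparr>)"
    and "subfield Kinf K"
    and "purely_transcendental_basis K K0 Kinf B"
    and "infinite B"
    and "ring.finite_dimension K Kinf (carrier K)"
    and "Factorial_Ring.prime p"
    and "p \<noteq> ring_char (K\<lparr>carrier := K0\<rparr>)"
  shows "\<exists>(R :: (nat \<Rightarrow> 'a) ring) (f :: 'a \<Rightarrow> nat \<Rightarrow> 'a) k.
           k = f ` carrier K \<and>
           algebra_over K f R \<and>
           centre R = k \<and>
           skew_field R \<and>
           LFD k R \<and>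
           (countable_dimension k R \<and>
            (\<forall>A n. unital_subalgebra k A R \<and> ring.dimension R n k A \<longrightarrow> (\<exists>m. n = p ^ m))) \<and>
           ((\<forall>A. central_subalgebra k A R \<and> ring.finite_dimension R k A \<longrightarrow> A = k) \<and>
            \<not> NLF k R)"
proof -
  interpret K: field K
    by fact
  let ?L = "K\<lparr>carrier := K0\<rparr>"
  have K0c: "K0 \<subseteq> carrier K"
    using subfieldE(3)[OF assms(2)] .
  interpret L: field ?L
    using K.subfield_iff(2)[OF assms(2)] .
  \<comment> \<open>The subfield has the operations of \<open>K\<close>, so multiples and powers
    formed in either structure agree.\<close>
  have add_pow_eq: "[n] \<cdot>\<^bsub>?L\<^esub> \<one>\<^bsub>?L\<^esub> = [n] \<cdot>\<^bsub>K\<^esub> \<one>\<^bsub>K\<^esub>" for n :: nat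
    by (simp add: add_pow_def nat_pow_def)
  have pow_eq: "x [^]\<^bsub>?L\<^esub> (n :: nat) = x [^]\<^bsub>K\<^esub> n" for x n
    by (simp add: nat_pow_def)
  \<comment> \<open>The roots of unity are found in the algebraically closed field \<open>K0\<close>
    and then used in \<open>K\<close>.\<close>
  obtain \<zeta> where \<zeta>: "\<And>i. \<zeta> i \<in> K0" "\<zeta> 0 \<noteq> \<one>\<^bsub>K\<^esub>" "\<zeta> 0 [^]\<^bsub>K\<^esub> p = \<one>\<^bsub>K\<^esub>" "\<And>i. \<zeta> (Suc i) [^]\<^bsub>K\<^esub> p = \<zeta> i"
    using L.roots_of_unity[OF assms(3,8,9)] unfolding pow_eq by auto
  show ?thesis
  proof (rule K.finite_extension_variables[OF assms(2,4,5,6,7)])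
    fix F and y :: "nat \<Rightarrow> 'a"
    assume Fy: "subring F K" "inj y" "range y \<subseteq> carrier K"
      "\<And>S g M. \<lbrakk>finite S; \<And>M. M \<in> S \<Longrightarrow> set_mset M \<subseteq> range y; \<And>M. M \<in> S \<Longrightarrow> g M \<in> F;
        (\<Oplus>\<^bsub>K\<^esub>M\<in>S. g M \<otimes>\<^bsub>K\<^esub> K.mset_val M) = \<zero>\<^bsub>K\<^esub>; M \<in> S\<rbrakk> \<Longrightarrow> g M = \<zero>\<^bsub>K\<^esub>"
      "carrier K \<subseteq> K.fracs (K.polys F (range y)) (K.polys F (range y))"
    interpret T: twist_data K F y \<zeta> p
    proof (rule twist_data.intro[OF assms(1)], rule twist_data_axioms.intro)
      show "[p] \<cdot>\<^bsub>K\<^esub> \<one>\<^bsub>K\<^esub> \<noteq> \<zero>\<^bsub>K\<^esub>"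
        using L.char_condition[OF assms(8,9)] add_pow_eq by simp
    qed (use Fy \<zeta> K0c assms(8) in auto)
    obtain e \<tau> where "p_twisted_group K e \<tau> T.D T.\<chi> T.\<beta> T.val p"
      using T.p_twisted_group_exists by blast
    then interpret P: p_twisted_group K e \<tau> T.D T.\<chi> T.\<beta> T.val p .
    have "algebra_over K P.emb P.TW"
      using K.field_axioms P.TW_ring P.emb_ring_hom P.emb_central by (simp add: algebra_over_def)
    then show ?thesis
      using P.centre_TW P.skew_field_TW P.LFD_TW P.countable_dimension_TW P.dimension_p_power
        P.central_subalgebra_trivial P.not_NLF_TW[OF T.D_proper]
      by (intro exI[of _ P.TW] exI[of _ P.emb] exI[of _ "P.emb ` carrier K"]) blast
  qed
qed

end
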